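(* Let $A/B$ be a separable QF extension of rings and let $E=\mathrm{End}\,A_B$. Then $A/B$ is D3 (depth three) if and only if the composite ring extension $E/B$, given by $B\to A\stackrel{\lambda}{\longrightarrow}E$ with $\lambda_a(x)=ax$, is D2 (depth two).
   Context: Rings are unital. $X^{(n)}$ denotes the direct sum of $n$ copies of $X$. For bimodules $X,Y$ over the same pair of rings, $X\,|\,Y$ means $X\oplus P\cong Y^{(n)}$ for some bimodule $P$ and some $n\in\mathbb{N}$, and $X\sim Y$ (similar) means $X\,|\,Y$ and $Y\,|\,X$. A ring extension $A/B$ is a unital ring homomorphism $B\to A$ (not necessarily injective), via which $A$ is a natural $B$-bimodule. $({}_BA)^*=\mathrm{Hom}({}_BA,{}_BB)$ is an $(A,B)$-bimodule via $(a\cdot f\cdot b)(x)=f(xa)b$, and $(A_B)^*=\mathrm{Hom}(A_B,B_B)$ is a $(B,A)$-bimodule via $(b\cdot g\cdot a)(x)=b\,g(ax)$. QF extension: $A/B$ is left QF if ${}_BA$ is finitely generated projective and $A\,|\,({}_BA)^*$ as $(A,B)$-bimodules; right QF if $A_B$ is finitely generated projective and $A\,|\,(A_B)^*$ as $(B,A)$-bimodules; QF if both left and right QF. Separable extension: $A/B$ is separable if there is $e=\sum e^1\otimes_Be^2\in A\otimes_BA$ with $\sum e^1e^2=1_A$ and $ae=ea$ for all $a\in A$. Depth two: a ring extension $A/B$ is right D2 if $A\otimes_BA\sim A$ as natural $(A,B)$-bimodules, left D2 if $A\otimes_BA\sim A$ as natural $(B,A)$-bimodules, and D2 if it is both left and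 right D2. Depth three: a tower of rings $C\to B\to A$ (unital ring homomorphisms) is right D3 if $A\otimes_BA\sim A$ as natural $(A,C)$-bimodules. A ring extension $A/B$ is a (right) D3 extension if the tower $B\to A\stackrel{\lambda}{\longrightarrow}E=\mathrm{End}\,A_B$ is right D3, i.e. $E\otimes_AE\sim E$ as natural $(E,B)$-bimodules. *)

theory Defs
  imports "HOL-Algebra.Algebra" "HOL-Library.FuncSet"
begin

section \<open>Bimodules\<close>

text \<open>As in HOL-Algebra's record of modules, the additive group of a bimodule is carried by the
  ring record, whose multiplicative fields are not used. A one-sided module is a record of which
  only one of the two actions is considered.\<close>

record ('r, 's, 'm) bimod = "'m ring" +
  lact :: "'r \<Rightarrow> 'm \<Rightarrow> 'm" (infixl \<open>\<triangleright>\<index>\<close> 70)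
  ract :: "'m \<Rightarrow> 's \<Rightarrow> 'm" (infixl \<open>\<triangleleft>\<index>\<close> 70)

locale left_module = R?: ring R + M?: abelian_group M
  for R :: "('r, 'c) ring_scheme" (structure) and M :: "('r, 's, 'm, 'x) bimod_scheme" (structure) +
  assumes lact_closed: "\<lbrakk>r \<in> carrier R; m \<in> carrier M\<rbrakk> \<Longrightarrow> r \<triangleright>\<^bsub>M\<^esub> m \<in> carrier M"
    and lact_l_distr: "\<lbrakk>r \<in> carrier R; r' \<in> carrier R; m \<in> carrier M\<rbrakk> \<Longrightarrow>
      (r \<oplus>\<^bsub>R\<^esub> r') \<triangleright>\<^bsub>M\<^esub> m = r \<triangleright>\<^bsub>M\<^esub> m \<oplus>\<^bsub>M\<^esub> r' \<triangleright>\<^bsub>M\<^esub> m"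
    and lact_r_distr: "\<lbrakk>r \<in> carrier R; m \<in> carrier M; m' \<in> carrier M\<rbrakk> \<Longrightarrow>
      r \<triangleright>\<^bsub>M\<^esub> (m \<oplus>\<^bsub>M\<^esub> m') = r \<triangleright>\<^bsub>M\<^esub> m \<oplus>\<^bsub>M\<^esub> r \<triangleright>\<^bsub>M\<^esub> m'"
    and lact_assoc: "\<lbrakk>r \<in> carrier R; r' \<in> carrier R; m \<in> carrier M\<rbrakk> \<Longrightarrow>
      (r \<otimes>\<^bsub>R\<^esub> r') \<triangleright>\<^bsub>M\<^esub> m = r \<triangleright>\<^bsub>M\<^esub> (r' \<triangleright>\<^bsub>M\<^esub> m)"
    and lact_one: "m \<in> carrier M \<Longrightarrow> \<one>\<^bsub>R\<^esub> \<triangleright>\<^bsub>M\<^esub> m = m"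

locale right_module = S?: ring S + M?: abelian_group M
  for S :: "('s, 'd) ring_scheme" (structure) and M :: "('r, 's, 'm, 'x) bimod_scheme" (structure) +
  assumes ract_closed: "\<lbrakk>s \<in> carrier S; m \<in> carrier M\<rbrakk> \<Longrightarrow> m \<triangleleft>\<^bsub>M\<^esub> s \<in> carrier M"
    and ract_r_distr: "\<lbrakk>s \<in> carrier S; s' \<in> carrier S; m \<in> carrier M\<rbrakk> \<Longrightarrow>
      m \<triangleleft>\<^bsub>M\<^esub> (s \<oplus>\<^bsub>S\<^esub> s') = m \<triangleleft>\<^bsub>M\<^esub> s \<oplus>\<^bsub>M\<^esub> m \<triangleleft>\<^bsub>M\<^esub> s'"
    and ract_l_distr: "\<lbrakk>s \<in> carrier S; m \<in> carrier M; m' \<in> carrier M\<rbrakk> \<Longrightarrow>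
      (m \<oplus>\<^bsub>M\<^esub> m') \<triangleleft>\<^bsub>M\<^esub> s = m \<triangleleft>\<^bsub>M\<^esub> s \<oplus>\<^bsub>M\<^esub> m' \<triangleleft>\<^bsub>M\<^esub> s"
    and ract_assoc: "\<lbrakk>s \<in> carrier S; s' \<in> carrier S; m \<in> carrier M\<rbrakk> \<Longrightarrow>
      m \<triangleleft>\<^bsub>M\<^esub> (s \<otimes>\<^bsub>S\<^esub> s') = (m \<triangleleft>\<^bsub>M\<^esub> s) \<triangleleft>\<^bsub>M\<^esub> s'"
    and ract_one: "m \<in> carrier M \<Longrightarrow> m \<triangleleft>\<^bsub>M\<^esub> \<one>\<^bsub>S\<^esub> = m"

locale bimodule = left_module R M + right_module S M
  for R :: "('r, 'c) ring_scheme" (structure) and S :: "('s, 'd) ring_scheme" (structure)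
    and M :: "('r, 's, 'm, 'x) bimod_scheme" (structure) +
  assumes lact_ract: "\<lbrakk>r \<in> carrier R; m \<in> carrier M; s \<in> carrier S\<rbrakk> \<Longrightarrow>
      (r \<triangleright>\<^bsub>M\<^esub> m) \<triangleleft>\<^bsub>M\<^esub> s = r \<triangleright>\<^bsub>M\<^esub> (m \<triangleleft>\<^bsub>M\<^esub> s)"

definition additive_maps ::
    "('r, 's, 'm, 'x) bimod_scheme \<Rightarrow> ('p, 'q, 'n, 'y) bimod_scheme \<Rightarrow> ('m \<Rightarrow> 'n) set"
  where "additive_maps M N = {f. f \<in> carrier M \<rightarrow> carrier N \<and>
    (\<forall>x\<in>carrier M. \<forall>y\<in>carrier M. f (x \<oplus>\<^bsub>M\<^esub> y) = f x \<oplus>\<^bsub>N\<^esub> f y)}"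

definition left_hom ::
    "('r, 'c) ring_scheme \<Rightarrow> ('r, 's, 'm, 'x) bimod_scheme \<Rightarrow> ('r, 'q, 'n, 'y) bimod_scheme
      \<Rightarrow> ('m \<Rightarrow> 'n) set"
  where "left_hom R M N = {f \<in> additive_maps M N.
    \<forall>r\<in>carrier R. \<forall>x\<in>carrier M. f (r \<triangleright>\<^bsub>M\<^esub> x) = r \<triangleright>\<^bsub>N\<^esub> f x}"

definition right_hom ::
    "('s, 'c) ring_scheme \<Rightarrow> ('r, 's, 'm, 'x) bimod_scheme \<Rightarrow> ('p, 's, 'n, 'y) bimod_scheme
      \<Rightarrow> ('m \<Rightarrow> 'n) set"
  where "right_hom S M N = {f \<in> additive_maps M N.
    \<forall>s\<in>carrier S. \<forall>x\<in>carrier M. f (x \<triangleleft>\<^bsub>M\<^esub> s) = f x \<triangleleft>\<^bsub>N\<^esub> s}"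

definition left_isomorphic ::
    "('r, 'c) ring_scheme \<Rightarrow> ('r, 's, 'm, 'x) bimod_scheme \<Rightarrow> ('r, 'q, 'n, 'y) bimod_scheme \<Rightarrow> bool"
  where "left_isomorphic R M N \<longleftrightarrow> (\<exists>f\<in>left_hom R M N. bij_betw f (carrier M) (carrier N))"

definition right_isomorphic ::
    "('s, 'c) ring_scheme \<Rightarrow> ('r, 's, 'm, 'x) bimod_scheme \<Rightarrow> ('p, 's, 'n, 'y) bimod_scheme \<Rightarrow> bool"
  where "right_isomorphic S M N \<longleftrightarrow> (\<exists>f\<in>right_hom S M N. bij_betw f (carrier M) (carrier N))"

definition bimod_isomorphic ::
    "('r, 'c) ring_scheme \<Rightarrow> ('s, 'd) ring_scheme \<Rightarrow> ('r, 's, 'm, 'x) bimod_scheme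
      \<Rightarrow> ('r, 's, 'n, 'y) bimod_scheme \<Rightarrow> bool"
  where "bimod_isomorphic R S M N \<longleftrightarrow>
    (\<exists>f\<in>left_hom R M N \<inter> right_hom S M N. bij_betw f (carrier M) (carrier N))"

definition direct_sum ::
    "('r, 's, 'm, 'x) bimod_scheme \<Rightarrow> ('r, 's, 'n, 'y) bimod_scheme \<Rightarrow> ('r, 's, 'm \<times> 'n) bimod"
  where "direct_sum M N =
    \<lparr>carrier = carrier M \<times> carrier N, monoid.mult = undefined, one = undefined,
     ring.zero = (\<zero>\<^bsub>M\<^esub>, \<zero>\<^bsub>N\<^esub>), add = (\<lambda>(m, n) (m', n'). (m \<oplus>\<^bsub>M\<^esub> m', n \<oplus>\<^bsub>N\<^esub> n')),
     lact = (\<lambda>r (m, n). (r \<triangleright>\<^bsub>M\<^esub> m, r \<triangleright>\<^bsub>N\<^esub> n)),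
     ract = (\<lambda>(m, n) s. (m \<triangleleft>\<^bsub>M\<^esub> s, n \<triangleleft>\<^bsub>N\<^esub> s))\<rparr>"

definition copower ::
    "('r, 's, 'm, 'x) bimod_scheme \<Rightarrow> 'i set \<Rightarrow> ('r, 's, 'i \<Rightarrow> 'm) bimod"
  where "copower M I =
    \<lparr>carrier = {f \<in> I \<rightarrow>\<^sub>E carrier M. finite {i \<in> I. f i \<noteq> \<zero>\<^bsub>M\<^esub>}},
     monoid.mult = undefined, one = undefined,
     ring.zero = (\<lambda>i\<in>I. \<zero>\<^bsub>M\<^esub>), add = (\<lambda>f g. \<lambda>i\<in>I. f i \<oplus>\<^bsub>M\<^esub> g i),
     lact = (\<lambda>r f. \<lambda>i\<in>I. r \<triangleright>\<^bsub>M\<^esub> f i), ract = (\<lambda>f s. \<lambda>i\<in>I. f i \<triangleleft>\<^bsub>M\<^esub> s)\<rparr>"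

text \<open>The relation \<open>U | V\<close>. The complement \<open>P\<close> is isomorphic to a sub-bimodule of
  \<open>copower V {..<n}\<close>, the direct sum of \<open>n\<close> copies of \<open>V\<close>, so it is no restriction to take its
  elements in the element type of that direct sum.\<close>

definition bimod_divides ::
    "('r, 'c) ring_scheme \<Rightarrow> ('s, 'd) ring_scheme \<Rightarrow> ('r, 's, 'm, 'x) bimod_scheme
      \<Rightarrow> ('r, 's, 'n, 'y) bimod_scheme \<Rightarrow> bool"
  where "bimod_divides R S U V \<longleftrightarrow>
    (\<exists>(P :: ('r, 's, nat \<Rightarrow> 'n) bimod) (n :: nat).
      bimodule R S P \<and> bimod_isomorphic R S (direct_sum U P) (copower V {..<n}))"

definition bimod_similar ::
    "('r, 'c) ring_scheme \<Rightarrow> ('s, 'd) ring_scheme \<Rightarrow> ('r, 's, 'm, 'x) bimod_scheme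
      \<Rightarrow> ('r, 's, 'n, 'y) bimod_scheme \<Rightarrow> bool"
  where "bimod_similar R S U V \<longleftrightarrow> bimod_divides R S U V \<and> bimod_divides R S V U"

text \<open>The bimodule structure on a ring \<open>A\<close> obtained by restricting along \<open>f\<close> on the left and along
  \<open>g\<close> on the right.\<close>

definition ring_bimod ::
    "('r \<Rightarrow> 'a) \<Rightarrow> ('a, 'c) ring_scheme \<Rightarrow> ('s \<Rightarrow> 'a) \<Rightarrow> ('r, 's, 'a) bimod"
  where "ring_bimod f A g =
    \<lparr>carrier = carrier A, monoid.mult = undefined, one = undefined,
     ring.zero = \<zero>\<^bsub>A\<^esub>, add = (\<oplus>\<^bsub>A\<^esub>),
     lact = (\<lambda>r x. f r \<otimes>\<^bsub>A\<^esub> x), ract = (\<lambda>x s. x \<otimes>\<^bsub>A\<^esub> g s)\<rparr>"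


section \<open>Finitely generated projective modules\<close>

definition left_fin_gen :: "('r, 'c) ring_scheme \<Rightarrow> ('r, 's, 'm, 'x) bimod_scheme \<Rightarrow> bool"
  where "left_fin_gen R M \<longleftrightarrow> (\<exists>G. finite G \<and> G \<subseteq> carrier M \<and>
    (\<forall>m\<in>carrier M. \<exists>c\<in>G \<rightarrow> carrier R. m = (\<Oplus>\<^bsub>M\<^esub>x\<in>G. c x \<triangleright>\<^bsub>M\<^esub> x)))"

definition right_fin_gen :: "('s, 'c) ring_scheme \<Rightarrow> ('r, 's, 'm, 'x) bimod_scheme \<Rightarrow> bool"
  where "right_fin_gen S M \<longleftrightarrow> (\<exists>G. finite G \<and> G \<subseteq> carrier M \<and>
    (\<forall>m\<in>carrier M. \<exists>c\<in>G \<rightarrow> carrier S. m = (\<Oplus>\<^bsub>M\<^esub>x\<in>G. x \<triangleleft>\<^bsub>M\<^esub> c x)))"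

text \<open>A projective module is a direct summand of a free one. The index set of the free module may
  be taken inside the module, because a projective module is a summand of the free module on its
  underlying set. The unused action of the complement \<open>Q\<close> is arbitrary.\<close>

definition left_projective :: "('r, 'c) ring_scheme \<Rightarrow> ('r, 'r, 'm, 'x) bimod_scheme \<Rightarrow> bool"
  where "left_projective R M \<longleftrightarrow>
    (\<exists>(Q :: ('r, 'r, 'm \<Rightarrow> 'r) bimod) (I :: 'm set).
      left_module R Q \<and>
      left_isomorphic R (direct_sum M Q) (copower (ring_bimod id R id) I))"

definition right_projective :: "('s, 'c) ring_scheme \<Rightarrow> ('s, 's, 'm, 'x) bimod_scheme \<Rightarrow> bool"
  where "right_projective S M \<longleftrightarrow>
    (\<exists>(Q :: ('s, 's, 'm \<Rightarrow> 's) bimod) (I :: 'm set).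
      right_module S Q \<and>
      right_isomorphic S (direct_sum M Q) (copower (ring_bimod id S id) I))"


section \<open>Tensor products\<close>

definition tensor_relators ::
    "('r, 'c) ring_scheme \<Rightarrow> ('q, 'r, 'm, 'x) bimod_scheme \<Rightarrow> ('r, 's, 'n, 'y) bimod_scheme
      \<Rightarrow> ('m \<times> 'n \<Rightarrow>\<^sub>0 int) set"
  where "tensor_relators R M N =
    {frag_of (m \<oplus>\<^bsub>M\<^esub> m', n) - frag_of (m, n) - frag_of (m', n) | m m' n.
      m \<in> carrier M \<and> m' \<in> carrier M \<and> n \<in> carrier N} \<union>
    {frag_of (m, n \<oplus>\<^bsub>N\<^esub> n') - frag_of (m, n) - frag_of (m, n') | m n n'.
      m \<in> carrier M \<and> n \<in> carrier N \<and> n' \<in> carrier N} \<union>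
    {frag_of (m \<triangleleft>\<^bsub>M\<^esub> r, n) - frag_of (m, r \<triangleright>\<^bsub>N\<^esub> n) | m r n.
      m \<in> carrier M \<and> r \<in> carrier R \<and> n \<in> carrier N}"

definition tensor_null ::
    "('r, 'c) ring_scheme \<Rightarrow> ('q, 'r, 'm, 'x) bimod_scheme \<Rightarrow> ('r, 's, 'n, 'y) bimod_scheme
      \<Rightarrow> ('m \<times> 'n \<Rightarrow>\<^sub>0 int) set"
  where "tensor_null R M N =
    generate (free_Abelian_group (carrier M \<times> carrier N)) (tensor_relators R M N)"

definition tensor_class ::
    "('r, 'c) ring_scheme \<Rightarrow> ('q, 'r, 'm, 'x) bimod_scheme \<Rightarrow> ('r, 's, 'n, 'y) bimod_scheme
      \<Rightarrow> ('m \<times> 'n \<Rightarrow>\<^sub>0 int) \<Rightarrow> ('m \<times> 'n \<Rightarrow>\<^sub>0 int) set"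
  where "tensor_class R M N w =
    tensor_null R M N #>\<^bsub>free_Abelian_group (carrier M \<times> carrier N)\<^esub> w"

definition pure_tensor ::
    "('r, 'c) ring_scheme \<Rightarrow> ('q, 'r, 'm, 'x) bimod_scheme \<Rightarrow> ('r, 's, 'n, 'y) bimod_scheme
      \<Rightarrow> 'm \<Rightarrow> 'n \<Rightarrow> ('m \<times> 'n \<Rightarrow>\<^sub>0 int) set"
  where "pure_tensor R M N m n = tensor_class R M N (frag_of (m, n))"

text \<open>The tensor product over \<open>R\<close>, a quotient of the free abelian group on pairs. The actions are
  \<open>q (m \<otimes> n) = (q m) \<otimes> n\<close> and \<open>(m \<otimes> n) s = m \<otimes> (n s)\<close>, extended additively to the free group and
  passed to cosets; all representatives \<open>w\<close> of a coset \<open>c\<close> give the same class.\<close>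

definition tensor ::
    "('r, 'c) ring_scheme \<Rightarrow> ('q, 'r, 'm, 'x) bimod_scheme \<Rightarrow> ('r, 's, 'n, 'y) bimod_scheme
      \<Rightarrow> ('q, 's, ('m \<times> 'n \<Rightarrow>\<^sub>0 int) set) bimod"
  where "tensor R M N =
    (let T = free_Abelian_group (carrier M \<times> carrier N) Mod tensor_null R M N in
     \<lparr>carrier = carrier T, monoid.mult = undefined, one = undefined,
      ring.zero = \<one>\<^bsub>T\<^esub>, add = (\<otimes>\<^bsub>T\<^esub>),
      lact = (\<lambda>q c. \<Union>w\<in>c. tensor_class R M N
        (frag_extend (\<lambda>(m, n). frag_of (q \<triangleright>\<^bsub>M\<^esub> m, n)) w)),
      ract = (\<lambda>c s. \<Union>w\<in>c. tensor_class R M N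
        (frag_extend (\<lambda>(m, n). frag_of (m, n \<triangleleft>\<^bsub>N\<^esub> s)) w))\<rparr>)"


section \<open>Ring extensions\<close>

text \<open>A ring extension \<open>A/B\<close> is given by \<open>ring_hom_ring B A h\<close>.\<close>

definition separable_extension ::
    "('b, 'd) ring_scheme \<Rightarrow> ('a, 'c) ring_scheme \<Rightarrow> ('b \<Rightarrow> 'a) \<Rightarrow> bool"
  where "separable_extension B A h \<longleftrightarrow>
    (let M = ring_bimod id A h; N = ring_bimod h A id; T = tensor B M N in
     \<exists>(n :: nat) x y. x \<in> {..<n} \<rightarrow> carrier A \<and> y \<in> {..<n} \<rightarrow> carrier A \<and>
       (\<Oplus>\<^bsub>A\<^esub>i\<in>{..<n}. x i \<otimes>\<^bsub>A\<^esub> y i) = \<one>\<^bsub>A\<^esub> \<and>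
       (\<forall>a\<in>carrier A.
         a \<triangleright>\<^bsub>T\<^esub> (\<Oplus>\<^bsub>T\<^esub>i\<in>{..<n}. pure_tensor B M N (x i) (y i)) =
         (\<Oplus>\<^bsub>T\<^esub>i\<in>{..<n}. pure_tensor B M N (x i) (y i)) \<triangleleft>\<^bsub>T\<^esub> a))"

definition left_dual ::
    "('b, 'd) ring_scheme \<Rightarrow> ('a, 'c) ring_scheme \<Rightarrow> ('b \<Rightarrow> 'a) \<Rightarrow> ('a, 'b, 'a \<Rightarrow> 'b) bimod"
  where "left_dual B A h =
    \<lparr>carrier = left_hom B (ring_bimod h A h) (ring_bimod id B id) \<inter> extensional (carrier A),
     monoid.mult = undefined, one = undefined,
     ring.zero = (\<lambda>x\<in>carrier A. \<zero>\<^bsub>B\<^esub>), add = (\<lambda>f g. \<lambda>x\<in>carrier A. f x \<oplus>\<^bsub>B\<^esub> g x),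
     lact = (\<lambda>a f. \<lambda>x\<in>carrier A. f (x \<otimes>\<^bsub>A\<^esub> a)),
     ract = (\<lambda>f b. \<lambda>x\<in>carrier A. f x \<otimes>\<^bsub>B\<^esub> b)\<rparr>"

definition right_dual ::
    "('b, 'd) ring_scheme \<Rightarrow> ('a, 'c) ring_scheme \<Rightarrow> ('b \<Rightarrow> 'a) \<Rightarrow> ('b, 'a, 'a \<Rightarrow> 'b) bimod"
  where "right_dual B A h =
    \<lparr>carrier = right_hom B (ring_bimod h A h) (ring_bimod id B id) \<inter> extensional (carrier A),
     monoid.mult = undefined, one = undefined,
     ring.zero = (\<lambda>x\<in>carrier A. \<zero>\<^bsub>B\<^esub>), add = (\<lambda>f g. \<lambda>x\<in>carrier A. f x \<oplus>\<^bsub>B\<^esub> g x),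
     lact = (\<lambda>b g. \<lambda>x\<in>carrier A. b \<otimes>\<^bsub>B\<^esub> g x),
     ract = (\<lambda>g a. \<lambda>x\<in>carrier A. g (a \<otimes>\<^bsub>A\<^esub> x))\<rparr>"

definition left_QF :: "('b, 'd) ring_scheme \<Rightarrow> ('a, 'c) ring_scheme \<Rightarrow> ('b \<Rightarrow> 'a) \<Rightarrow> bool"
  where "left_QF B A h \<longleftrightarrow>
    left_fin_gen B (ring_bimod h A h) \<and> left_projective B (ring_bimod h A h) \<and>
    bimod_divides A B (ring_bimod id A h) (left_dual B A h)"

definition right_QF :: "('b, 'd) ring_scheme \<Rightarrow> ('a, 'c) ring_scheme \<Rightarrow> ('b \<Rightarrow> 'a) \<Rightarrow> bool"
  where "right_QF B A h \<longleftrightarrow>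
    right_fin_gen B (ring_bimod h A h) \<and> right_projective B (ring_bimod h A h) \<and>
    bimod_divides B A (ring_bimod h A id) (right_dual B A h)"

definition QF_extension :: "('b, 'd) ring_scheme \<Rightarrow> ('a, 'c) ring_scheme \<Rightarrow> ('b \<Rightarrow> 'a) \<Rightarrow> bool"
  where "QF_extension B A h \<longleftrightarrow> left_QF B A h \<and> right_QF B A h"

definition right_D2 :: "('b, 'd) ring_scheme \<Rightarrow> ('a, 'c) ring_scheme \<Rightarrow> ('b \<Rightarrow> 'a) \<Rightarrow> bool"
  where "right_D2 B A h \<longleftrightarrow>
    bimod_similar A B (tensor B (ring_bimod id A h) (ring_bimod h A h)) (ring_bimod id A h)"

definition left_D2 :: "('b, 'd) ring_scheme \<Rightarrow> ('a, 'c) ring_scheme \<Rightarrow> ('b \<Rightarrow> 'a) \<Rightarrow> bool"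
  where "left_D2 B A h \<longleftrightarrow>
    bimod_similar B A (tensor B (ring_bimod h A h) (ring_bimod h A id)) (ring_bimod h A id)"

definition D2 :: "('b, 'd) ring_scheme \<Rightarrow> ('a, 'c) ring_scheme \<Rightarrow> ('b \<Rightarrow> 'a) \<Rightarrow> bool"
  where "D2 B A h \<longleftrightarrow> left_D2 B A h \<and> right_D2 B A h"

text \<open>For a tower \<open>k : C \<rightarrow> B\<close>, \<open>h : B \<rightarrow> A\<close>.\<close>

definition right_D3_tower ::
    "('c, 'e) ring_scheme \<Rightarrow> ('b, 'd) ring_scheme \<Rightarrow> ('a, 'f) ring_scheme
      \<Rightarrow> ('c \<Rightarrow> 'b) \<Rightarrow> ('b \<Rightarrow> 'a) \<Rightarrow> bool"
  where "right_D3_tower C B A k h \<longleftrightarrow>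
    bimod_similar A C (tensor B (ring_bimod id A h) (ring_bimod h A (h \<circ> k)))
      (ring_bimod id A (h \<circ> k))"

definition End_ring ::
    "('b, 'd) ring_scheme \<Rightarrow> ('a, 'c) ring_scheme \<Rightarrow> ('b \<Rightarrow> 'a) \<Rightarrow> ('a \<Rightarrow> 'a) ring"
  where "End_ring B A h =
    \<lparr>carrier = right_hom B (ring_bimod h A h) (ring_bimod h A h) \<inter> extensional (carrier A),
     monoid.mult = compose (carrier A), one = (\<lambda>x\<in>carrier A. x),
     ring.zero = (\<lambda>x\<in>carrier A. \<zero>\<^bsub>A\<^esub>), add = (\<lambda>f g. \<lambda>x\<in>carrier A. f x \<oplus>\<^bsub>A\<^esub> g x)\<rparr>"

definition left_mult :: "('a, 'c) ring_scheme \<Rightarrow> 'a \<Rightarrow> 'a \<Rightarrow> 'a"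
  where "left_mult A a = (\<lambda>x\<in>carrier A. a \<otimes>\<^bsub>A\<^esub> x)"

definition D3_extension :: "('b, 'd) ring_scheme \<Rightarrow> ('a, 'c) ring_scheme \<Rightarrow> ('b \<Rightarrow> 'a) \<Rightarrow> bool"
  where "D3_extension B A h \<longleftrightarrow> right_D3_tower B A (End_ring B A h) h (left_mult A)"

end

(*
A bimodule U divides V exactly when finitely many bimodule maps U -> V -> U sum up to the identity.
For U = A (x)_B A and V = A this turns the depth conditions into quasi-bases, that is, equations
1 (x) y = sum_i gamma_i(y) t_i with bimodule endomorphisms gamma_i and central tensors t_i. The quasi-Frobenius
conditions become Casimir elements sum_k x_jk (x) y_jk with bilinear forms F_j such that
a = sum x_jk F_j(y_jk a) (left) or a = sum F_j(a x_jk) y_jk (right).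

If e is a separability idempotent of A/B, a right D2 quasi-basis (beta_i, s_i) of E/B gives the D3
quasi-basis y |-> sum e^1 beta_i(e^2 y), s_i. Conversely, a right system makes A (x)_B A a direct summand of a power of E,
so that E (x)_B E = E (x)_A (A (x)_B A) (x)_A E divides E (x)_A E (x)_A E, which divides E by D3. The left
system of A/B and a dual basis of A over B yield a left system (u_jk, v_jk, F_j) of E/B, and with it the right
D2 quasi-basis is turned into the left one: sum_k u_jk (x) beta_i(v_jk), y |-> s_i^1 F_j(s_i^2 y).
*)
theory Submission
  imports Defs
begin

section \<open>Additive maps and finite sums\<close>

text \<open>Depth three is a right-hand condition, while depth two of \<open>E/B\<close> has a left
  half as well; that half must be manufactured by transposing the right one. In the Frobenius case a
  Frobenius homomorphism with dual bases does the transposing. The quasi-Frobenius condition yields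
  instead a divisibility of \<open>A\<close> by its dual, so every formula carries an outer sum over
  \<open>j\<close> whose terms give the identity only together. The forms of \<open>E/B\<close> are
  composites. By the Casimir property, \<open>S_j(w) = \<Sum>m. w(x_jm) y_jm\<close> is an
  \<open>A\<close>-\<open>A\<close>-bilinear map from \<open>E\<close> to \<open>A\<close>, the
  analogue of a Frobenius homomorphism of \<open>E/A\<close>; following it by
  \<open>\<epsilon>_i\<close> gives a form indexed by the pair \<open>(i, j)\<close>. Elements of
  tensor products are cosets without canonical representatives. All arguments therefore run through
  additive maps obtained from balanced maps and compared on pure tensors. The matrices over
  \<open>B\<close> that witness commutation serve the same end: they can be pushed through an
  arbitrary balanced map, and those of \<open>E/B\<close> arise as block matrices from those of
  \<open>A/B\<close>.\<close>

definition add_hom :: "('a, 'c) ring_scheme \<Rightarrow> ('b, 'd) ring_scheme \<Rightarrow> ('a \<Rightarrow> 'b) set"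
  where "add_hom G H = {f. f \<in> carrier G \<rightarrow> carrier H \<and>
    (\<forall>x\<in>carrier G. \<forall>y\<in>carrier G. f (x \<oplus>\<^bsub>G\<^esub> y) = f x \<oplus>\<^bsub>H\<^esub> f y)}"

lemma add_homI:
  assumes "\<And>x. x \<in> carrier G \<Longrightarrow> f x \<in> carrier H"
    and "\<And>x y. \<lbrakk>x \<in> carrier G; y \<in> carrier G\<rbrakk> \<Longrightarrow> f (x \<oplus>\<^bsub>G\<^esub> y) = f x \<oplus>\<^bsub>H\<^esub> f y"
  shows "f \<in> add_hom G H"
  using assms by (auto simp: add_hom_def)

lemma add_hom_closed: "\<lbrakk>f \<in> add_hom G H; x \<in> carrier G\<rbrakk> \<Longrightarrow> f x \<in> carrier H"
  by (auto simp: add_hom_def)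

lemma add_hom_add:
  "\<lbrakk>f \<in> add_hom G H; x \<in> carrier G; y \<in> carrier G\<rbrakk> \<Longrightarrow> f (x \<oplus>\<^bsub>G\<^esub> y) = f x \<oplus>\<^bsub>H\<^esub> f y"
  by (auto simp: add_hom_def)

lemma add_hom_comp: "\<lbrakk>f \<in> add_hom G H; g \<in> add_hom H L\<rbrakk> \<Longrightarrow> (\<lambda>x. g (f x)) \<in> add_hom G L"
  by (auto simp: add_hom_def Pi_iff)

text \<open>\<open>additive_maps\<close> is typed for bimodule records. \<open>add_hom\<close>
  states the same for bare ring records, so that maps between rings, bimodules and tensor products
  compose and add up under one set of rules.\<close>

lemma additive_maps_eq_add_hom: "additive_maps M N = add_hom M N"
  by (simp add: additive_maps_def add_hom_def)

lemma add_hom_zero: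
  assumes "abelian_group G" "abelian_group H" "f \<in> add_hom G H"
  shows "f \<zero>\<^bsub>G\<^esub> = \<zero>\<^bsub>H\<^esub>"
proof -
  interpret G: abelian_group G by fact
  interpret H: abelian_group H by fact
  have "f \<zero>\<^bsub>G\<^esub> \<oplus>\<^bsub>H\<^esub> f \<zero>\<^bsub>G\<^esub> = f \<zero>\<^bsub>G\<^esub>"
    using add_hom_add[OF assms(3), of "\<zero>\<^bsub>G\<^esub>" "\<zero>\<^bsub>G\<^esub>"] by simp
  moreover have "f \<zero>\<^bsub>G\<^esub> \<in> carrier H" using assms(3) by (simp add: add_hom_closed)
  ultimately show ?thesis using H.add.r_cancel_one' by metis
qed

text \<open>Infinite \<open>I\<close> is covered too: \<open>finsum\<close> is then zero on both
  sides, and \<open>f\<close> preserves zero.\<close>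

lemma add_hom_finsum:
  assumes "abelian_group G" "abelian_group H" "f \<in> add_hom G H" "\<And>i. i \<in> I \<Longrightarrow> x i \<in> carrier G"
  shows "f (\<Oplus>\<^bsub>G\<^esub>i\<in>I. x i) = (\<Oplus>\<^bsub>H\<^esub>i\<in>I. f (x i))"
proof -
  interpret G: abelian_group G by fact
  interpret H: abelian_group H by fact
  show ?thesis using assms(4)
  proof (induction I rule: infinite_finite_induct)
    case (insert i I)
    then have "x \<in> I \<rightarrow> carrier G" by auto
    with insert show ?case
      using assms(3) by (simp add: add_hom_add add_hom_closed Pi_iff)
  qed (simp_all add: add_hom_zero[OF assms(1-3)])
qed

lemma (in abelian_group) finsum_swap:
  assumes "\<And>i j. \<lbrakk>i \<in> I; j \<in> J\<rbrakk> \<Longrightarrow> f i j \<in> carrier G"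
  shows "(\<Oplus>i\<in>I. \<Oplus>j\<in>J. f i j) = (\<Oplus>j\<in>J. \<Oplus>i\<in>I. f i j)"
  using assms
proof (induction I rule: infinite_finite_induct)
  case (insert i I)
  have "(\<Oplus>i\<in>insert i I. \<Oplus>j\<in>J. f i j) = (\<Oplus>j\<in>J. f i j) \<oplus> (\<Oplus>j\<in>J. \<Oplus>i\<in>I. f i j)"
    using insert by (simp add: Pi_iff)
  also have "\<dots> = (\<Oplus>j\<in>J. f i j \<oplus> (\<Oplus>i\<in>I. f i j))"
    using insert by (subst finsum_addf) (auto simp: Pi_iff)
  also have "\<dots> = (\<Oplus>j\<in>J. \<Oplus>i\<in>insert i I. f i j)"
    using insert by (intro finsum_cong') (auto simp: Pi_iff)
  finally show ?case .
qed simp_all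

lemma (in abelian_group) finsum_Times:
  assumes "finite I" "finite J" "\<And>i j. \<lbrakk>i \<in> I; j \<in> J\<rbrakk> \<Longrightarrow> f i j \<in> carrier G"
  shows "(\<Oplus>p\<in>I \<times> J. f (fst p) (snd p)) = (\<Oplus>i\<in>I. \<Oplus>j\<in>J. f i j)"
  using assms(1,3)
proof (induction I rule: finite_induct)
  case (insert i I)
  have "(\<Oplus>p\<in>insert i I \<times> J. f (fst p) (snd p))
      = (\<Oplus>p\<in>Pair i ` J \<union> I \<times> J. f (fst p) (snd p))"
    by (intro arg_cong2[where f = "finsum G"]) auto
  also have "\<dots> = (\<Oplus>p\<in>Pair i ` J. f (fst p) (snd p)) \<oplus> (\<Oplus>p\<in>I \<times> J. f (fst p) (snd p))"
    using insert assms(2) by (intro finsum_Un_disjoint) auto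
  also have "(\<Oplus>p\<in>Pair i ` J. f (fst p) (snd p)) = (\<Oplus>j\<in>J. f i j)"
    using insert by (subst finsum_reindex) (auto simp: inj_on_def)
  finally show ?case using insert by (simp add: Pi_iff)
qed simp

lemma (in abelian_group) finsum_lessThan_add:
  fixes m n :: nat
  assumes "\<And>i. i < m + n \<Longrightarrow> f i \<in> carrier G"
  shows "(\<Oplus>i\<in>{..<m + n}. f i) = (\<Oplus>i\<in>{..<m}. f i) \<oplus> (\<Oplus>i\<in>{..<n}. f (m + i))"
  using assms
proof (induction n)
  case (Suc n)
  have "(\<Oplus>i\<in>{..<m + Suc n}. f i) = f (m + n) \<oplus> (\<Oplus>i\<in>{..<m + n}. f i)"
    using Suc.prems by (simp add: lessThan_Suc Pi_iff)
  also have "\<dots> = (\<Oplus>i\<in>{..<m}. f i) \<oplus> (f (m + n) \<oplus> (\<Oplus>i\<in>{..<n}. f (m + i)))"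
    using Suc by (simp add: a_lcomm Pi_iff)
  finally show ?case using Suc.prems by (simp add: lessThan_Suc Pi_iff)
qed (simp add: Pi_iff)

lemma add_hom_sum:
  assumes "abelian_group H" "\<And>i. i \<in> I \<Longrightarrow> f i \<in> add_hom G H"
  shows "(\<lambda>x. \<Oplus>\<^bsub>H\<^esub>i\<in>I. f i x) \<in> add_hom G H"
proof -
  interpret H: abelian_group H by fact
  show ?thesis
  proof (rule add_homI)
    fix x assume x: "x \<in> carrier G"
    then have *: "f i x \<in> carrier H" if "i \<in> I" for i
      using assms(2) that by (blast intro: add_hom_closed)
    then show "(\<Oplus>\<^bsub>H\<^esub>i\<in>I. f i x) \<in> carrier H" by (simp add: Pi_iff)
    fix y assume y: "y \<in> carrier G"
    then have **: "f i y \<in> carrier H" if "i \<in> I" for i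
      using assms(2) that by (blast intro: add_hom_closed)
    have "(\<Oplus>\<^bsub>H\<^esub>i\<in>I. f i (x \<oplus>\<^bsub>G\<^esub> y)) = (\<Oplus>\<^bsub>H\<^esub>i\<in>I. f i x \<oplus>\<^bsub>H\<^esub> f i y)"
      using x y * ** by (intro H.finsum_cong') (auto simp: add_hom_add[OF assms(2)])
    also have "\<dots> = (\<Oplus>\<^bsub>H\<^esub>i\<in>I. f i x) \<oplus>\<^bsub>H\<^esub> (\<Oplus>\<^bsub>H\<^esub>i\<in>I. f i y)"
      using * ** by (intro H.finsum_addf) auto
    finally show "(\<Oplus>\<^bsub>H\<^esub>i\<in>I. f i (x \<oplus>\<^bsub>G\<^esub> y))
      = (\<Oplus>\<^bsub>H\<^esub>i\<in>I. f i x) \<oplus>\<^bsub>H\<^esub> (\<Oplus>\<^bsub>H\<^esub>i\<in>I. f i y)" .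
  qed
qed

text \<open>The additive span of \<open>S\<close>, with functions compared on \<open>D\<close> only.
  Quasi-bases arise below as nested sums over various index sets; closure of this predicate under
  finite sums reduces them to a single family over \<open>{..<n}\<close>, the index set that a
  direct sum of \<open>n\<close> copies asks for.\<close>

definition finite_sum_of :: "('t, 'c) ring_scheme \<Rightarrow> 'x set \<Rightarrow> ('x \<Rightarrow> 't) set \<Rightarrow> ('x \<Rightarrow> 't) \<Rightarrow> bool"
  where "finite_sum_of G D S w \<longleftrightarrow>
    (\<exists>(n :: nat) s. s \<in> {..<n} \<rightarrow> S \<and> (\<forall>x\<in>D. w x = (\<Oplus>\<^bsub>G\<^esub>i\<in>{..<n}. s i x)))"

context
  fixes G :: "('t, 'c) ring_scheme" and D :: "'x set" and S :: "('x \<Rightarrow> 't) set"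
  assumes G: "abelian_group G" and S: "S \<subseteq> D \<rightarrow> carrier G"
begin

interpretation G: abelian_group G by (rule G)

lemma finite_sum_of_base: "w \<in> S \<Longrightarrow> finite_sum_of G D S w"
  unfolding finite_sum_of_def using S
  by (intro exI[of _ 1] exI[of _ "\<lambda>_. w"]) (auto simp: lessThan_Suc Pi_iff subset_iff)

lemma finite_sum_of_closed: "\<lbrakk>finite_sum_of G D S w; x \<in> D\<rbrakk> \<Longrightarrow> w x \<in> carrier G"
  unfolding finite_sum_of_def using S by (fastforce simp: Pi_iff subset_iff)

lemma finite_sum_of_add:
  assumes "finite_sum_of G D S w" "finite_sum_of G D S v"
  shows "finite_sum_of G D S (\<lambda>x. w x \<oplus>\<^bsub>G\<^esub> v x)"
proof -
  obtain m s where s: "s \<in> {..<m::nat} \<rightarrow> S" "\<And>x. x \<in> D \<Longrightarrow> w x = (\<Oplus>\<^bsub>G\<^esub>i\<in>{..<m}. s i x)"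
    using assms(1) by (auto simp: finite_sum_of_def)
  obtain n r where r: "r \<in> {..<n::nat} \<rightarrow> S" "\<And>x. x \<in> D \<Longrightarrow> v x = (\<Oplus>\<^bsub>G\<^esub>i\<in>{..<n}. r i x)"
    using assms(2) by (auto simp: finite_sum_of_def)
  define q where "q i = (if i < m then s i else r (i - m))" for i
  have q: "q \<in> {..<m + n} \<rightarrow> S" using s(1) r(1) by (auto simp: q_def Pi_iff)
  have "w x \<oplus>\<^bsub>G\<^esub> v x = (\<Oplus>\<^bsub>G\<^esub>i\<in>{..<m + n}. q i x)" if x: "x \<in> D" for x
  proof -
    have qx: "q i x \<in> carrier G" if "i < m + n" for i
      using q S that x by (auto simp: Pi_iff subset_iff)
    have "(\<Oplus>\<^bsub>G\<^esub>i\<in>{..<m}. q i x) = w x"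
      unfolding s(2)[OF x] using s(1) S x
      by (intro G.finsum_cong') (auto simp: q_def Pi_iff subset_iff)
    moreover have "(\<Oplus>\<^bsub>G\<^esub>i\<in>{..<n}. q (m + i) x) = v x"
      unfolding r(2)[OF x] using r(1) S x
      by (intro G.finsum_cong') (auto simp: q_def Pi_iff subset_iff)
    ultimately show ?thesis using qx by (simp add: G.finsum_lessThan_add)
  qed
  with q show ?thesis unfolding finite_sum_of_def by blast
qed

lemma finite_sum_of_finsum:
  assumes "finite I" "\<And>i. i \<in> I \<Longrightarrow> finite_sum_of G D S (w i)"
  shows "finite_sum_of G D S (\<lambda>x. \<Oplus>\<^bsub>G\<^esub>i\<in>I. w i x)"
  using assms
proof (induction I rule: finite_induct)
  case empty
  show ?case unfolding finite_sum_of_def by (intro exI[of _ 0]) simp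
next
  case (insert i I)
  have "finite_sum_of G D S (\<lambda>x. w i x \<oplus>\<^bsub>G\<^esub> (\<Oplus>\<^bsub>G\<^esub>i\<in>I. w i x))"
    using insert by (intro finite_sum_of_add) auto
  moreover have "(\<Oplus>\<^bsub>G\<^esub>i\<in>insert i I. w i x) = w i x \<oplus>\<^bsub>G\<^esub> (\<Oplus>\<^bsub>G\<^esub>i\<in>I. w i x)" if "x \<in> D" for x
    using insert that finite_sum_of_closed by (subst G.finsum_insert) auto
  ultimately show ?case unfolding finite_sum_of_def by auto
qed

end

lemma finite_sum_of_cong:
  "\<lbrakk>finite_sum_of G D S w; \<And>x. x \<in> D \<Longrightarrow> v x = w x\<rbrakk> \<Longrightarrow> finite_sum_of G D S v"
  unfolding finite_sum_of_def by metis

section \<open>Tensor products\<close>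

definition balanced ::
    "('r, 'c) ring_scheme \<Rightarrow> ('q, 'r, 'm, 'x) bimod_scheme \<Rightarrow> ('r, 's, 'n, 'y) bimod_scheme
      \<Rightarrow> ('t, 'z) ring_scheme \<Rightarrow> ('m \<Rightarrow> 'n \<Rightarrow> 't) \<Rightarrow> bool"
  where "balanced R M N G \<phi> \<longleftrightarrow>
    (\<forall>m\<in>carrier M. \<phi> m \<in> add_hom N G) \<and>
    (\<forall>n\<in>carrier N. (\<lambda>m. \<phi> m n) \<in> add_hom M G) \<and>
    (\<forall>m\<in>carrier M. \<forall>r\<in>carrier R. \<forall>n\<in>carrier N. \<phi> (m \<triangleleft>\<^bsub>M\<^esub> r) n = \<phi> m (r \<triangleright>\<^bsub>N\<^esub> n))"

text \<open>The group \<open>T\<close> depends only on the two inner actions of \<open>R\<close>.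
  The outer actions, which may come from different rings, are added in
  \<open>tensor_bimodules\<close>.\<close>

locale tensor_data = M: right_module R M + N: left_module R N
  for R :: "('r, 'c) ring_scheme" and M :: "('q, 'r, 'm, 'x) bimod_scheme"
    and N :: "('r, 's, 'n, 'y) bimod_scheme"
begin

abbreviation "F \<equiv> free_Abelian_group (carrier M \<times> carrier N)"
abbreviation "T \<equiv> tensor R M N"
abbreviation "cl \<equiv> tensor_class R M N"
abbreviation "pure \<equiv> pure_tensor R M N"
abbreviation "null \<equiv> tensor_null R M N"

lemma comm_group_F: "comm_group F"
  by (rule abelian_free_Abelian_group)

lemma frag_closed [simp]: "(m, n) \<in> carrier M \<times> carrier N \<Longrightarrow> frag_of (m, n) \<in> carrier F"
  by simp

lemma diff_in_F: "\<lbrakk>a \<in> carrier F; b \<in> carrier F\<rbrakk> \<Longrightarrow> a - b \<in> carrier F"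
  by (simp add: order_trans[OF keys_diff])

lemma relators_in_F: "tensor_relators R M N \<subseteq> carrier F"
  unfolding tensor_relators_def
  by (auto simp del: carrier_free_Abelian_group_iff
      intro!: diff_in_F frag_closed M.ract_closed N.lact_closed)

lemma null_subgroup: "subgroup null F"
  unfolding tensor_null_def
  by (rule group.generate_is_subgroup[OF group_free_Abelian_group relators_in_F])

lemma null_normal: "null \<lhd> F"
  by (simp add: comm_group.normal_iff_subgroup[OF comm_group_F] null_subgroup)

lemma tensor_eqs: "carrier T = carrier (F Mod null)" "(\<oplus>\<^bsub>T\<^esub>) = (\<otimes>\<^bsub>F Mod null\<^esub>)" "\<zero>\<^bsub>T\<^esub> = \<one>\<^bsub>F Mod null\<^esub>"
  by (simp_all add: tensor_def Let_def)

lemma tensor_abelian_group: "abelian_group T"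
proof -
  interpret Q: comm_group "F Mod null"
    by (rule comm_group.abelian_FactGroup[OF comm_group_F null_subgroup])
  show ?thesis
    by (rule abelian_groupI)
       (simp_all add: tensor_eqs Q.m_assoc Q.l_inv_ex del: mult_FactGroup one_FactGroup,
         rule Q.m_comm)
qed

sublocale T: abelian_group T by (rule tensor_abelian_group)

lemma carrier_tensor: "carrier T = cl ` carrier F"
  by (auto simp: tensor_def Let_def FactGroup_def RCOSETS_def tensor_class_def)

lemma class_hom: "cl \<in> hom F (add_monoid T)"
  using normal.r_coset_hom_Mod[OF null_normal] by (simp add: hom_def tensor_eqs tensor_class_def[abs_def])

lemma class_closed: "w \<in> carrier F \<Longrightarrow> cl w \<in> carrier T"
  by (simp add: carrier_tensor)

lemma class_add: "\<lbrakk>v \<in> carrier F; w \<in> carrier F\<rbrakk> \<Longrightarrow> cl (v + w) = cl v \<oplus>\<^bsub>T\<^esub> cl w"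
  using hom_mult[OF class_hom, of v w] by simp

lemma class_null: "v \<in> null \<Longrightarrow> cl v = \<zero>\<^bsub>T\<^esub>"
proof -
  assume v: "v \<in> null"
  have "cl v = null" unfolding tensor_class_def
    using group.coset_join2[OF group_free_Abelian_group _ null_subgroup v]
      subgroup.mem_carrier[OF null_subgroup v] by blast
  then show ?thesis by (simp add: tensor_def Let_def FactGroup_def)
qed

lemma class_eq_iff_mem: "v \<in> cl w \<longleftrightarrow> (\<exists>u\<in>null. v = u + w)"
  by (auto simp: tensor_class_def r_coset_def)

lemma class_diff: "\<lbrakk>v \<in> carrier F; w \<in> carrier F\<rbrakk> \<Longrightarrow> cl (v - w) = cl v \<ominus>\<^bsub>T\<^esub> cl w"
  using class_add[of "v - w" w] diff_in_F[of v w]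
  by (simp add: class_closed T.minus_eq T.a_assoc T.r_neg del: carrier_free_Abelian_group_iff)

lemma pure_closed [simp, intro]: "\<lbrakk>m \<in> carrier M; n \<in> carrier N\<rbrakk> \<Longrightarrow> pure m n \<in> carrier T"
  unfolding pure_tensor_def by (rule class_closed) simp

text \<open>A relator read as a difference \<open>a - b\<close> becomes an equation of classes. The
  biadditivity relators fit this pattern once the two subtracted generators are regrouped into one
  sum.\<close>

lemma class_relator:
  assumes "a - b \<in> tensor_relators R M N" "a \<in> carrier F" "b \<in> carrier F"
  shows "cl a = cl b"
proof -
  have "a - b \<in> null" unfolding tensor_null_def by (rule generate.incl) fact
  then have "cl (a - b) = \<zero>\<^bsub>T\<^esub>" by (rule class_null)
  then show ?thesis using class_add[of "a - b" b] assms diff_in_F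
    by (simp add: class_closed del: carrier_free_Abelian_group_iff)
qed

lemma pure_add_left:
  assumes "m \<in> carrier M" "m' \<in> carrier M" "n \<in> carrier N"
  shows "pure (m \<oplus>\<^bsub>M\<^esub> m') n = pure m n \<oplus>\<^bsub>T\<^esub> pure m' n"
proof -
  have "frag_of (m \<oplus>\<^bsub>M\<^esub> m', n) - (frag_of (m, n) + frag_of (m', n)) \<in> tensor_relators R M N"
    unfolding tensor_relators_def using assms by (auto simp: algebra_simps)
  then have "pure (m \<oplus>\<^bsub>M\<^esub> m') n = cl (frag_of (m, n) + frag_of (m', n))"
    unfolding pure_tensor_def using assms
    by (intro class_relator) (auto intro!: order_trans[OF keys_add])
  then show ?thesis using assms by (simp add: pure_tensor_def class_add)
qed

lemma pure_add_right:
  assumes "m \<in> carrier M" "n \<in> carrier N" "n' \<in> carrier N"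
  shows "pure m (n \<oplus>\<^bsub>N\<^esub> n') = pure m n \<oplus>\<^bsub>T\<^esub> pure m n'"
proof -
  have "frag_of (m, n \<oplus>\<^bsub>N\<^esub> n') - (frag_of (m, n) + frag_of (m, n')) \<in> tensor_relators R M N"
    unfolding tensor_relators_def using assms by (auto simp: algebra_simps)
  then have "pure m (n \<oplus>\<^bsub>N\<^esub> n') = cl (frag_of (m, n) + frag_of (m, n'))"
    unfolding pure_tensor_def using assms
    by (intro class_relator) (auto intro!: order_trans[OF keys_add])
  then show ?thesis using assms by (simp add: pure_tensor_def class_add)
qed

lemma pure_move:
  assumes "m \<in> carrier M" "r \<in> carrier R" "n \<in> carrier N"
  shows "pure (m \<triangleleft>\<^bsub>M\<^esub> r) n = pure m (r \<triangleright>\<^bsub>N\<^esub> n)"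
  unfolding pure_tensor_def using assms
  by (intro class_relator) (auto simp: tensor_relators_def M.ract_closed N.lact_closed)

lemma pure_hom_right: "m \<in> carrier M \<Longrightarrow> pure m \<in> add_hom N T"
  by (rule add_homI) (auto simp: pure_add_right)

lemma pure_hom_left: "n \<in> carrier N \<Longrightarrow> (\<lambda>m. pure m n) \<in> add_hom M T"
  by (rule add_homI) (auto simp: pure_add_left)

text \<open>Pure tensors are the classes of the generators of the free group and hence generate
  \<open>T\<close>. The induction rule for the free group builds elements by differences, which is
  why \<open>f\<close> and \<open>g\<close> are first shown to respect subtraction.\<close>

lemma tensor_hom_eqI:
  assumes "abelian_group G" "f \<in> add_hom T G" "g \<in> add_hom T G"
    and "\<And>m n. \<lbrakk>m \<in> carrier M; n \<in> carrier N\<rbrakk> \<Longrightarrow> f (pure m n) = g (pure m n)"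
    and t: "t \<in> carrier T"
  shows "f t = g t"
proof -
  interpret G: abelian_group G by fact
  have minus: "k (a \<ominus>\<^bsub>T\<^esub> b) = k a \<ominus>\<^bsub>G\<^esub> k b"
    if k: "k \<in> add_hom T G" and ab: "a \<in> carrier T" "b \<in> carrier T" for k a b
  proof -
    have "k a = k (a \<ominus>\<^bsub>T\<^esub> b) \<oplus>\<^bsub>G\<^esub> k b"
      using add_hom_add[OF k, of "a \<ominus>\<^bsub>T\<^esub> b" b] ab by (simp add: T.minus_eq T.a_assoc T.l_neg)
    then show ?thesis
      using ab by (simp add: G.minus_eq G.a_assoc G.r_neg add_hom_closed[OF k])
  qed
  obtain w where w: "Poly_Mapping.keys w \<subseteq> carrier M \<times> carrier N" "t = cl w"
    using t by (auto simp: carrier_tensor)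
  from w(1) have "f (cl w) = g (cl w)"
  proof (induction w rule: free_Abelian_group_induct[consumes 1, case_names zero diff of])
    case zero
    have "cl 0 = \<zero>\<^bsub>T\<^esub>" using class_null subgroup.one_closed[OF null_subgroup] by simp
    then show ?case
      by (simp add: add_hom_zero[OF T.abelian_group_axioms assms(1)] assms(2,3))
  next
    case (diff x y)
    then show ?case using assms(2,3) by (simp add: class_diff minus class_closed)
  next
    case (of a)
    then show ?case using assms(4) by (cases a) (auto simp: pure_tensor_def)
  qed
  with w show ?thesis by simp
qed

text \<open>The universal property: \<open>\<phi>\<close> extends to the free group on pairs, the
  extension kills each of the three kinds of relators precisely because \<open>\<phi>\<close> is
  balanced, hence kills the subgroup they generate and factors through the quotient.\<close>

lemma tensor_lift_exists:
  assumes "abelian_group G" "balanced R M N G \<phi>"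
  shows "\<exists>f\<in>add_hom T G. \<forall>m\<in>carrier M. \<forall>n\<in>carrier N. f (pure m n) = \<phi> m n"
proof -
  interpret G: abelian_group G by fact
  have clos: "\<phi> m n \<in> carrier G" if "m \<in> carrier M" "n \<in> carrier N" for m n
    using assms(2) that by (auto simp: balanced_def add_hom_def)
  have "(\<lambda>(m, n). \<phi> m n) ` (carrier M \<times> carrier N) \<subseteq> carrier (add_monoid G)"
    using clos by auto
  then obtain k where k: "k \<in> hom F (add_monoid G)"
    and kf: "\<And>p. p \<in> carrier M \<times> carrier N \<Longrightarrow> k (frag_of p) = (\<lambda>(m, n). \<phi> m n) p"
    using comm_group.free_Abelian_group_universal[OF G.a_comm_group] by blast
  interpret k: group_hom F "add_monoid G" k
    using k G.a_group by (simp add: group_hom_def group_hom_axioms_def)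
  have k_diff: "k (a - b) = k a \<ominus>\<^bsub>G\<^esub> k b" if "a \<in> carrier F" "b \<in> carrier F" for a b
  proof -
    have "k a = k (a - b) \<oplus>\<^bsub>G\<^esub> k b"
      using k.hom_mult[of "a - b" b] that diff_in_F[OF that]
      by (simp del: carrier_free_Abelian_group_iff)
    then show ?thesis using k.hom_closed that diff_in_F[OF that]
      by (simp add: G.minus_eq G.a_assoc G.r_neg del: carrier_free_Abelian_group_iff)
  qed
  have cancel: "p \<oplus>\<^bsub>G\<^esub> q \<ominus>\<^bsub>G\<^esub> p \<ominus>\<^bsub>G\<^esub> q = \<zero>\<^bsub>G\<^esub>"
    if "p \<in> carrier G" "q \<in> carrier G" for p q
    using that by (simp add: G.a_comm[of p q] G.minus_eq G.a_assoc G.r_neg)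
  have rel: "tensor_relators R M N \<subseteq> kernel F (add_monoid G) k"
  proof
    fix u assume u: "u \<in> tensor_relators R M N"
    then have uF: "u \<in> carrier F" using relators_in_F by blast
    have "k u = \<zero>\<^bsub>G\<^esub>"
      using u unfolding tensor_relators_def
    proof (elim UnE CollectE exE conjE)
      fix m m' n
      assume *: "m \<in> carrier M" "m' \<in> carrier M" "n \<in> carrier N"
        "u = frag_of (m \<oplus>\<^bsub>M\<^esub> m', n) - frag_of (m, n) - frag_of (m', n)"
      then have "\<phi> (m \<oplus>\<^bsub>M\<^esub> m') n = \<phi> m n \<oplus>\<^bsub>G\<^esub> \<phi> m' n"
        using assms(2) by (auto simp: balanced_def add_hom_def)
      then show ?thesis using * clos
        by (simp add: k_diff diff_in_F kf cancel del: carrier_free_Abelian_group_iff)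
    next
      fix m n n'
      assume *: "m \<in> carrier M" "n \<in> carrier N" "n' \<in> carrier N"
        "u = frag_of (m, n \<oplus>\<^bsub>N\<^esub> n') - frag_of (m, n) - frag_of (m, n')"
      then have "\<phi> m (n \<oplus>\<^bsub>N\<^esub> n') = \<phi> m n \<oplus>\<^bsub>G\<^esub> \<phi> m n'"
        using assms(2) by (auto simp: balanced_def add_hom_def)
      then show ?thesis using * clos
        by (simp add: k_diff diff_in_F kf cancel del: carrier_free_Abelian_group_iff)
    next
      fix m r n
      assume *: "m \<in> carrier M" "r \<in> carrier R" "n \<in> carrier N"
        "u = frag_of (m \<triangleleft>\<^bsub>M\<^esub> r, n) - frag_of (m, r \<triangleright>\<^bsub>N\<^esub> n)"
      then have "\<phi> (m \<triangleleft>\<^bsub>M\<^esub> r) n = \<phi> m (r \<triangleright>\<^bsub>N\<^esub> n)"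
        using assms(2) by (auto simp: balanced_def)
      then show ?thesis using * clos
        by (simp add: k_diff kf G.minus_eq G.r_neg M.ract_closed N.lact_closed
            del: carrier_free_Abelian_group_iff)
    qed
    with uF show "u \<in> kernel F (add_monoid G) k" by (simp add: kernel_def)
  qed
  have "null \<subseteq> kernel F (add_monoid G) k"
    unfolding tensor_null_def
    by (rule group.generate_subgroup_incl[OF group_free_Abelian_group rel k.subgroup_kernel])
  from k.FactGroup_universal_kernel[OF null_normal this]
  obtain f where f: "f \<in> hom (F Mod null) (add_monoid G)"
    and fk: "\<And>w. w \<in> carrier F \<Longrightarrow> f (cl w) = k w"
    by (auto simp: tensor_class_def)
  have "f \<in> add_hom T G"
    using f by (auto simp: hom_def add_hom_def tensor_eqs)
  moreover have "f (pure m n) = \<phi> m n" if "m \<in> carrier M" "n \<in> carrier N" for m n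
    using that by (simp add: pure_tensor_def fk kf)
  ultimately show ?thesis by blast
qed

text \<open>The common form of the two actions on the tensor product.\<close>

lemma tensor_induced_map:
  assumes d: "\<And>m n. \<lbrakk>m \<in> carrier M; n \<in> carrier N\<rbrakk> \<Longrightarrow> d (m, n) \<in> carrier M \<times> carrier N"
    and bal: "balanced R M N T (\<lambda>m n. cl (frag_of (d (m, n))))"
  defines "f \<equiv> \<lambda>c. \<Union>w\<in>c. cl (frag_extend (\<lambda>p. frag_of (d p)) w)"
  shows "f \<in> add_hom T T"
    and "\<And>m n. \<lbrakk>m \<in> carrier M; n \<in> carrier N\<rbrakk> \<Longrightarrow> f (pure m n) = cl (frag_of (d (m, n)))"
proof -
  let ?D = "frag_extend (\<lambda>p. frag_of (d p))"
  obtain g where g: "g \<in> add_hom T T"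
    and gp: "\<And>m n. \<lbrakk>m \<in> carrier M; n \<in> carrier N\<rbrakk> \<Longrightarrow> g (pure m n) = cl (frag_of (d (m, n)))"
    using tensor_lift_exists[OF tensor_abelian_group bal] by auto
  have DF: "?D w \<in> carrier F" if "w \<in> carrier F" for w
  proof -
    have "Poly_Mapping.keys (?D w) \<subseteq> (\<Union>p\<in>Poly_Mapping.keys w. {d p})"
      using keys_frag_extend[of "\<lambda>p. frag_of (d p)" w] by simp
    also have "\<dots> \<subseteq> carrier M \<times> carrier N"
    proof -
      have "d p \<in> carrier M \<times> carrier N" if "p \<in> Poly_Mapping.keys w" for p
        using d[of "fst p" "snd p"] \<open>w \<in> carrier F\<close> that by fastforce
      then show ?thesis by blast
    qed
    finally show ?thesis by simp
  qed
  have gD: "g (cl w) = cl (?D w)" if "w \<in> carrier F" for w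
  proof -
    have "Poly_Mapping.keys w \<subseteq> carrier M \<times> carrier N" using that by simp
    then show ?thesis
    proof (induction w rule: free_Abelian_group_induct[consumes 1, case_names zero diff of])
      case zero
      have "cl 0 = \<zero>\<^bsub>T\<^esub>" using class_null subgroup.one_closed[OF null_subgroup] by simp
      then show ?case
        by (simp add: add_hom_zero[OF tensor_abelian_group tensor_abelian_group g])
    next
      case (diff x y)
      have *: "x - y \<in> carrier F" "?D x \<in> carrier F" "?D y \<in> carrier F" "?D (x - y) \<in> carrier F"
        using diff DF diff_in_F by auto
      have "g (cl (x - y)) \<oplus>\<^bsub>T\<^esub> g (cl y) = g (cl x)"
        using add_hom_add[OF g, of "cl (x - y)" "cl y"] class_add[of "x - y" y] diff *(1)
        by (simp add: class_closed)
      moreover have "cl (?D (x - y)) \<oplus>\<^bsub>T\<^esub> cl (?D y) = cl (?D x)"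
        using class_add[of "?D (x - y)" "?D y"] * by (simp add: frag_extend_diff)
      ultimately show ?case
        using diff(3,4) *(1,3,4) T.add.right_cancel[OF class_closed[OF *(3)],
            of "g (cl (x - y))" "cl (?D (x - y))"]
        by (simp add: add_hom_closed[OF g] class_closed del: carrier_free_Abelian_group_iff)
    next
      case (of a)
      then show ?case using gp by (cases a) (simp add: pure_tensor_def)
    qed
  qed
  \<comment> \<open>By \<open>gD\<close> the class of \<open>?D w\<close> is \<open>g\<close> of the
    class of \<open>w\<close>, so all representatives of \<open>c\<close> contribute the same set
    and the union in \<open>f\<close> collapses to the value of the lifted map
    \<open>g\<close>.\<close>
  have fg: "f c = g c" if "c \<in> carrier T" for c
  proof -
    obtain w where w: "w \<in> carrier F" "c = cl w"
      using \<open>c \<in> carrier T\<close> by (auto simp: carrier_tensor)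
    have "cl (?D v) = g c" if v: "v \<in> c" for v
    proof -
      obtain u where u: "u \<in> null" "v = u + w" using v w by (auto simp: class_eq_iff_mem)
      have uF: "u \<in> carrier F" using subgroup.mem_carrier[OF null_subgroup u(1)] .
      have vF: "v \<in> carrier F" using u(2) uF w(1) group.is_monoid[OF group_free_Abelian_group]
        by (metis monoid.m_closed mult_free_Abelian_group)
      have "cl v = c" unfolding u(2) w(2) using class_add[OF uF w(1)] class_null[OF u(1)] w(1)
        by (simp add: class_closed del: carrier_free_Abelian_group_iff)
      then show ?thesis using gD[OF vF] by simp
    qed
    moreover have "w \<in> c"
      using w by (simp add: class_eq_iff_mem) (use subgroup.one_closed[OF null_subgroup] in force)
    ultimately show ?thesis unfolding f_def by blast
  qed
  show "f \<in> add_hom T T"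
    using g fg by (auto simp: add_hom_def)
  show "\<And>m n. \<lbrakk>m \<in> carrier M; n \<in> carrier N\<rbrakk> \<Longrightarrow> f (pure m n) = cl (frag_of (d (m, n)))"
    by (simp add: fg gp)
qed

end

locale tensor_bimodules = M: bimodule Q R M + N: bimodule R S N
  for Q :: "('q, 'u) ring_scheme" and R :: "('r, 'c) ring_scheme" and S :: "('s, 'v) ring_scheme"
    and M :: "('q, 'r, 'm, 'x) bimod_scheme" and N :: "('r, 's, 'n, 'y) bimod_scheme"
begin

sublocale tensor_data R M N ..

text \<open>Unfolding the action exhibits it as the map of \<open>tensor_induced_map\<close> for
  \<open>?d\<close>. The balance condition over \<open>R\<close> is the compatibility of the two
  actions on \<open>M\<close>, followed by \<open>pure_move\<close>.\<close>

lemma lact_hom_pure: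
  assumes q: "q \<in> carrier Q"
  shows "(\<lambda>t. q \<triangleright>\<^bsub>T\<^esub> t) \<in> add_hom T T"
    and "\<lbrakk>m \<in> carrier M; n \<in> carrier N\<rbrakk> \<Longrightarrow> q \<triangleright>\<^bsub>T\<^esub> pure m n = pure (q \<triangleright>\<^bsub>M\<^esub> m) n"
proof -
  let ?d = "\<lambda>(m, n). (q \<triangleright>\<^bsub>M\<^esub> m, n)"
  have d: "?d (m, n) \<in> carrier M \<times> carrier N" if "m \<in> carrier M" "n \<in> carrier N" for m n
    using that q by (simp add: M.lact_closed)
  have "balanced R M N T (\<lambda>m n. pure (q \<triangleright>\<^bsub>M\<^esub> m) n)"
    unfolding balanced_def
  proof (intro conjI ballI)
    fix n assume "n \<in> carrier N"
    then show "(\<lambda>m. pure (q \<triangleright>\<^bsub>M\<^esub> m) n) \<in> add_hom M T"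
      using q by (intro add_homI) (auto simp: M.lact_closed M.lact_r_distr pure_add_left)
  qed (use q in \<open>auto simp: M.lact_closed M.lact_ract[symmetric] pure_move intro: pure_hom_right\<close>)
  then have bal: "balanced R M N T (\<lambda>m n. cl (frag_of (?d (m, n))))"
    by (simp add: pure_tensor_def)
  have eq: "(\<lambda>t. q \<triangleright>\<^bsub>T\<^esub> t) = (\<lambda>c. \<Union>w\<in>c. cl (frag_extend (\<lambda>p. frag_of (?d p)) w))"
    by (simp add: tensor_def Let_def fun_eq_iff case_prod_beta')
  show "(\<lambda>t. q \<triangleright>\<^bsub>T\<^esub> t) \<in> add_hom T T"
    unfolding eq by (rule tensor_induced_map(1)[of ?d, OF d bal])
  show "q \<triangleright>\<^bsub>T\<^esub> pure m n = pure (q \<triangleright>\<^bsub>M\<^esub> m) n" if "m \<in> carrier M" "n \<in> carrier N"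
    using tensor_induced_map(2)[of ?d, OF d bal that] fun_cong[OF eq, of "pure m n"]
    by (simp add: pure_tensor_def)
qed

lemma ract_hom_pure:
  assumes s: "s \<in> carrier S"
  shows "(\<lambda>t. t \<triangleleft>\<^bsub>T\<^esub> s) \<in> add_hom T T"
    and "\<lbrakk>m \<in> carrier M; n \<in> carrier N\<rbrakk> \<Longrightarrow> pure m n \<triangleleft>\<^bsub>T\<^esub> s = pure m (n \<triangleleft>\<^bsub>N\<^esub> s)"
proof -
  let ?d = "\<lambda>(m, n). (m, n \<triangleleft>\<^bsub>N\<^esub> s)"
  have d: "?d (m, n) \<in> carrier M \<times> carrier N" if "m \<in> carrier M" "n \<in> carrier N" for m n
    using that s by (simp add: N.ract_closed)
  have "balanced R M N T (\<lambda>m n. pure m (n \<triangleleft>\<^bsub>N\<^esub> s))"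
    unfolding balanced_def
  proof (intro conjI ballI)
    fix m assume "m \<in> carrier M"
    then show "(\<lambda>n. pure m (n \<triangleleft>\<^bsub>N\<^esub> s)) \<in> add_hom N T"
      using s by (intro add_homI) (auto simp: N.ract_closed N.ract_l_distr pure_add_right)
  qed (use s in \<open>auto simp: N.ract_closed N.lact_ract pure_move intro: pure_hom_left\<close>)
  then have bal: "balanced R M N T (\<lambda>m n. cl (frag_of (?d (m, n))))"
    by (simp add: pure_tensor_def)
  have eq: "(\<lambda>t. t \<triangleleft>\<^bsub>T\<^esub> s) = (\<lambda>c. \<Union>w\<in>c. cl (frag_extend (\<lambda>p. frag_of (?d p)) w))"
    by (simp add: tensor_def Let_def fun_eq_iff case_prod_beta')
  show "(\<lambda>t. t \<triangleleft>\<^bsub>T\<^esub> s) \<in> add_hom T T"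
    unfolding eq by (rule tensor_induced_map(1)[of ?d, OF d bal])
  show "pure m n \<triangleleft>\<^bsub>T\<^esub> s = pure m (n \<triangleleft>\<^bsub>N\<^esub> s)" if "m \<in> carrier M" "n \<in> carrier N"
    using tensor_induced_map(2)[of ?d, OF d bal that] fun_cong[OF eq, of "pure m n"]
    by (simp add: pure_tensor_def)
qed

lemmas lact_hom = lact_hom_pure(1)
lemmas lact_pure = lact_hom_pure(2)
lemmas ract_hom = ract_hom_pure(1)
lemmas ract_pure = ract_hom_pure(2)
lemmas T_eqI = tensor_hom_eqI[OF tensor_abelian_group]

text \<open>In each axiom that is not mere additivity or closure, both sides are additive in
  \<open>t\<close>, so \<open>T_eqI\<close> reduces the axiom to pure tensors, where it becomes the
  same axiom of \<open>M\<close> or of \<open>N\<close>.\<close>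

lemma tensor_bimodule: "bimodule Q S T"
proof unfold_locales
  fix q q' t assume q: "q \<in> carrier Q" "q' \<in> carrier Q" and t: "t \<in> carrier T"
  have sum_hom: "(\<lambda>t. q \<triangleright>\<^bsub>T\<^esub> t \<oplus>\<^bsub>T\<^esub> q' \<triangleright>\<^bsub>T\<^esub> t) \<in> add_hom T T"
    using lact_hom[OF q(1)] lact_hom[OF q(2)]
    by (intro add_homI) (auto simp: add_hom_def Pi_iff T.a_ac)
  show "(q \<oplus>\<^bsub>Q\<^esub> q') \<triangleright>\<^bsub>T\<^esub> t = q \<triangleright>\<^bsub>T\<^esub> t \<oplus>\<^bsub>T\<^esub> q' \<triangleright>\<^bsub>T\<^esub> t"
    by (rule T_eqI[OF lact_hom sum_hom _ t])
       (use q in \<open>auto simp: lact_pure M.lact_l_distr pure_add_left M.lact_closed\<close>)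
  show "(q \<otimes>\<^bsub>Q\<^esub> q') \<triangleright>\<^bsub>T\<^esub> t = q \<triangleright>\<^bsub>T\<^esub> (q' \<triangleright>\<^bsub>T\<^esub> t)"
    by (rule T_eqI[OF lact_hom add_hom_comp[OF lact_hom lact_hom] _ t])
       (use q in \<open>auto simp: lact_pure M.lact_assoc M.lact_closed\<close>)
next
  fix s s' t assume s: "s \<in> carrier S" "s' \<in> carrier S" and t: "t \<in> carrier T"
  have sum_hom: "(\<lambda>t. t \<triangleleft>\<^bsub>T\<^esub> s \<oplus>\<^bsub>T\<^esub> t \<triangleleft>\<^bsub>T\<^esub> s') \<in> add_hom T T"
    using ract_hom[OF s(1)] ract_hom[OF s(2)]
    by (intro add_homI) (auto simp: add_hom_def Pi_iff T.a_ac)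
  show "t \<triangleleft>\<^bsub>T\<^esub> (s \<oplus>\<^bsub>S\<^esub> s') = t \<triangleleft>\<^bsub>T\<^esub> s \<oplus>\<^bsub>T\<^esub> t \<triangleleft>\<^bsub>T\<^esub> s'"
    by (rule T_eqI[OF ract_hom sum_hom _ t])
       (use s in \<open>auto simp: ract_pure N.ract_r_distr pure_add_right N.ract_closed\<close>)
  show "t \<triangleleft>\<^bsub>T\<^esub> (s \<otimes>\<^bsub>S\<^esub> s') = (t \<triangleleft>\<^bsub>T\<^esub> s) \<triangleleft>\<^bsub>T\<^esub> s'"
    by (rule T_eqI[OF ract_hom add_hom_comp[OF ract_hom ract_hom] _ t])
       (use s in \<open>auto simp: ract_pure N.ract_assoc N.ract_closed\<close>)
next
  fix q s t assume qs: "q \<in> carrier Q" "s \<in> carrier S" and t: "t \<in> carrier T"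
  show "(q \<triangleright>\<^bsub>T\<^esub> t) \<triangleleft>\<^bsub>T\<^esub> s = q \<triangleright>\<^bsub>T\<^esub> (t \<triangleleft>\<^bsub>T\<^esub> s)"
    by (rule T_eqI[OF add_hom_comp[OF lact_hom ract_hom] add_hom_comp[OF ract_hom lact_hom] _ t])
       (use qs in \<open>auto simp: ract_pure lact_pure M.lact_closed N.ract_closed\<close>)
next
  fix t assume t: "t \<in> carrier T"
  have id: "(\<lambda>t. t) \<in> add_hom T T" by (simp add: add_hom_def)
  show "\<one>\<^bsub>Q\<^esub> \<triangleright>\<^bsub>T\<^esub> t = t"
    by (rule T_eqI[OF lact_hom id _ t]) (auto simp: lact_pure M.lact_one)
  show "t \<triangleleft>\<^bsub>T\<^esub> \<one>\<^bsub>S\<^esub> = t"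
    by (rule T_eqI[OF ract_hom id _ t]) (auto simp: ract_pure N.ract_one)
qed (use lact_hom ract_hom in \<open>auto simp: add_hom_def Pi_iff\<close>)

lemma tensor_left_linear:
  assumes "left_module Q P" "f \<in> add_hom T P"
    and "\<And>q m n. \<lbrakk>q \<in> carrier Q; m \<in> carrier M; n \<in> carrier N\<rbrakk> \<Longrightarrow>
      f (pure (q \<triangleright>\<^bsub>M\<^esub> m) n) = q \<triangleright>\<^bsub>P\<^esub> f (pure m n)"
    and "q \<in> carrier Q" "t \<in> carrier T"
  shows "f (q \<triangleright>\<^bsub>T\<^esub> t) = q \<triangleright>\<^bsub>P\<^esub> f t"
proof -
  interpret P: left_module Q P by fact
  have act: "(\<lambda>x. q \<triangleright>\<^bsub>P\<^esub> x) \<in> add_hom P P"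
    using assms(4) by (auto simp: add_hom_def P.lact_closed P.lact_r_distr)
  show ?thesis
    by (rule tensor_hom_eqI[OF P.abelian_group_axioms add_hom_comp[OF lact_hom assms(2)]
          add_hom_comp[OF assms(2) act] _ assms(5)])
       (use assms(3,4) in \<open>auto simp: lact_pure\<close>)
qed

lemma tensor_right_linear:
  assumes "right_module S P" "f \<in> add_hom T P"
    and "\<And>s m n. \<lbrakk>s \<in> carrier S; m \<in> carrier M; n \<in> carrier N\<rbrakk> \<Longrightarrow>
      f (pure m (n \<triangleleft>\<^bsub>N\<^esub> s)) = f (pure m n) \<triangleleft>\<^bsub>P\<^esub> s"
    and "s \<in> carrier S" "t \<in> carrier T"
  shows "f (t \<triangleleft>\<^bsub>T\<^esub> s) = f t \<triangleleft>\<^bsub>P\<^esub> s"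
proof -
  interpret P: right_module S P by fact
  have act: "(\<lambda>x. x \<triangleleft>\<^bsub>P\<^esub> s) \<in> add_hom P P"
    using assms(4) by (auto simp: add_hom_def P.ract_closed P.ract_l_distr)
  show ?thesis
    by (rule tensor_hom_eqI[OF P.abelian_group_axioms add_hom_comp[OF ract_hom assms(2)]
          add_hom_comp[OF assms(2) act] _ assms(5)])
       (use assms(3,4) in \<open>auto simp: ract_pure\<close>)
qed

end

section \<open>Direct summands\<close>

abbreviation bimod_hom where "bimod_hom R S M N \<equiv> left_hom R M N \<inter> right_hom S M N"

lemma left_hom_iff:
  "f \<in> left_hom R M N \<longleftrightarrow> f \<in> add_hom M N \<and>
    (\<forall>r\<in>carrier R. \<forall>x\<in>carrier M. f (r \<triangleright>\<^bsub>M\<^esub> x) = r \<triangleright>\<^bsub>N\<^esub> f x)"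
  by (simp add: left_hom_def additive_maps_eq_add_hom)

lemma right_hom_iff:
  "f \<in> right_hom S M N \<longleftrightarrow> f \<in> add_hom M N \<and>
    (\<forall>s\<in>carrier S. \<forall>x\<in>carrier M. f (x \<triangleleft>\<^bsub>M\<^esub> s) = f x \<triangleleft>\<^bsub>N\<^esub> s)"
  by (simp add: right_hom_def additive_maps_eq_add_hom)

context left_module
begin

lemma lact_hom: "r \<in> carrier R \<Longrightarrow> (\<lambda>m. r \<triangleright>\<^bsub>M\<^esub> m) \<in> add_hom M M"
  by (auto simp: add_hom_def lact_closed lact_r_distr)

lemma lact_scalar_hom: "m \<in> carrier M \<Longrightarrow> (\<lambda>r. r \<triangleright>\<^bsub>M\<^esub> m) \<in> add_hom R M"
  by (auto simp: add_hom_def lact_closed lact_l_distr)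

lemma lact_zero [simp]: "r \<in> carrier R \<Longrightarrow> r \<triangleright>\<^bsub>M\<^esub> \<zero>\<^bsub>M\<^esub> = \<zero>\<^bsub>M\<^esub>"
  using add_hom_zero[OF M.abelian_group_axioms M.abelian_group_axioms lact_hom] .

lemma lact_finsum:
  "\<lbrakk>r \<in> carrier R; \<And>i. i \<in> I \<Longrightarrow> x i \<in> carrier M\<rbrakk> \<Longrightarrow>
    r \<triangleright>\<^bsub>M\<^esub> (\<Oplus>\<^bsub>M\<^esub>i\<in>I. x i) = (\<Oplus>\<^bsub>M\<^esub>i\<in>I. r \<triangleright>\<^bsub>M\<^esub> x i)"
  by (rule add_hom_finsum[OF M.abelian_group_axioms M.abelian_group_axioms lact_hom])

lemma scalar_lact_finsum:
  "\<lbrakk>m \<in> carrier M; \<And>i. i \<in> I \<Longrightarrow> r i \<in> carrier R\<rbrakk> \<Longrightarrow>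
    (\<Oplus>\<^bsub>R\<^esub>i\<in>I. r i) \<triangleright>\<^bsub>M\<^esub> m = (\<Oplus>\<^bsub>M\<^esub>i\<in>I. r i \<triangleright>\<^bsub>M\<^esub> m)"
  by (rule add_hom_finsum[OF R.abelian_group_axioms M.abelian_group_axioms lact_scalar_hom])

end

context right_module
begin

lemma ract_hom: "s \<in> carrier S \<Longrightarrow> (\<lambda>m. m \<triangleleft>\<^bsub>M\<^esub> s) \<in> add_hom M M"
  by (auto simp: add_hom_def ract_closed ract_l_distr)

lemma ract_scalar_hom: "m \<in> carrier M \<Longrightarrow> (\<lambda>s. m \<triangleleft>\<^bsub>M\<^esub> s) \<in> add_hom S M"
  by (auto simp: add_hom_def ract_closed ract_r_distr)

lemma ract_zero [simp]: "s \<in> carrier S \<Longrightarrow> \<zero>\<^bsub>M\<^esub> \<triangleleft>\<^bsub>M\<^esub> s = \<zero>\<^bsub>M\<^esub>"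
  using add_hom_zero[OF M.abelian_group_axioms M.abelian_group_axioms ract_hom] .

lemma ract_finsum:
  "\<lbrakk>s \<in> carrier S; \<And>i. i \<in> I \<Longrightarrow> x i \<in> carrier M\<rbrakk> \<Longrightarrow>
    (\<Oplus>\<^bsub>M\<^esub>i\<in>I. x i) \<triangleleft>\<^bsub>M\<^esub> s = (\<Oplus>\<^bsub>M\<^esub>i\<in>I. x i \<triangleleft>\<^bsub>M\<^esub> s)"
  by (rule add_hom_finsum[OF M.abelian_group_axioms M.abelian_group_axioms ract_hom])

end

lemma direct_sum_simps:
  "carrier (direct_sum M N) = carrier M \<times> carrier N"
  "\<zero>\<^bsub>direct_sum M N\<^esub> = (\<zero>\<^bsub>M\<^esub>, \<zero>\<^bsub>N\<^esub>)"
  "(m, n) \<oplus>\<^bsub>direct_sum M N\<^esub> (m', n') = (m \<oplus>\<^bsub>M\<^esub> m', n \<oplus>\<^bsub>N\<^esub> n')"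
  "r \<triangleright>\<^bsub>direct_sum M N\<^esub> (m, n) = (r \<triangleright>\<^bsub>M\<^esub> m, r \<triangleright>\<^bsub>N\<^esub> n)"
  "(m, n) \<triangleleft>\<^bsub>direct_sum M N\<^esub> s = (m \<triangleleft>\<^bsub>M\<^esub> s, n \<triangleleft>\<^bsub>N\<^esub> s)"
  by (simp_all add: direct_sum_def)

section \<open>Direct sums of copies of a bimodule, and splittings\<close>

lemma copower_simps:
  "carrier (copower M I) = {f \<in> I \<rightarrow>\<^sub>E carrier M. finite {i \<in> I. f i \<noteq> \<zero>\<^bsub>M\<^esub>}}"
  "\<zero>\<^bsub>copower M I\<^esub> = (\<lambda>i\<in>I. \<zero>\<^bsub>M\<^esub>)"
  "f \<oplus>\<^bsub>copower M I\<^esub> g = (\<lambda>i\<in>I. f i \<oplus>\<^bsub>M\<^esub> g i)"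
  "r \<triangleright>\<^bsub>copower M I\<^esub> f = (\<lambda>i\<in>I. r \<triangleright>\<^bsub>M\<^esub> f i)"
  "f \<triangleleft>\<^bsub>copower M I\<^esub> s = (\<lambda>i\<in>I. f i \<triangleleft>\<^bsub>M\<^esub> s)"
  by (simp_all add: copower_def)

text \<open>The condition on \<open>k\<close> at zero confines the support of the result to the
  union of the two supports, which keeps it finite. Unary operations are covered by letting
  \<open>k\<close> ignore an argument.\<close>

lemma copower_closed_map:
  assumes "f \<in> carrier (copower M I)" "g \<in> carrier (copower M I)"
    and "\<And>x y. \<lbrakk>x \<in> carrier M; y \<in> carrier M\<rbrakk> \<Longrightarrow> k x y \<in> carrier N"
    and "k \<zero>\<^bsub>M\<^esub> \<zero>\<^bsub>M\<^esub> = \<zero>\<^bsub>N\<^esub>"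
  shows "(\<lambda>i\<in>I. k (f i) (g i)) \<in> carrier (copower N I)"
proof -
  have "{i \<in> I. k (f i) (g i) \<noteq> \<zero>\<^bsub>N\<^esub>} \<subseteq> {i \<in> I. f i \<noteq> \<zero>\<^bsub>M\<^esub>} \<union> {i \<in> I. g i \<noteq> \<zero>\<^bsub>M\<^esub>}"
    using assms(4) by force
  then have "finite {i \<in> I. k (f i) (g i) \<noteq> \<zero>\<^bsub>N\<^esub>}"
    using assms(1,2) by (auto simp: copower_simps elim: finite_subset)
  then show ?thesis using assms(1-3) by (auto simp: copower_simps PiE_iff cong: conj_cong)
qed

lemma copower_abelian_group:
  assumes "abelian_group M" shows "abelian_group (copower M I)"
proof -
  interpret M: abelian_group M by fact
  let ?C = "copower M I"
  have ext: "f = g" if "f \<in> carrier ?C" "g \<in> carrier ?C" "\<And>i. i \<in> I \<Longrightarrow> f i = g i" for f g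
    using that by (auto simp: copower_simps intro: PiE_ext)
  have in_M: "f i \<in> carrier M" if "f \<in> carrier ?C" "i \<in> I" for f i
    using that by (auto simp: copower_simps)
  have add: "f \<oplus>\<^bsub>?C\<^esub> g \<in> carrier ?C" if "f \<in> carrier ?C" "g \<in> carrier ?C" for f g
    unfolding copower_simps(3) using that by (rule copower_closed_map) auto
  have zero: "\<zero>\<^bsub>?C\<^esub> \<in> carrier ?C" by (simp add: copower_simps)
  show ?thesis
  proof (rule abelian_groupI)
    fix f assume f: "f \<in> carrier ?C"
    let ?g = "\<lambda>i\<in>I. \<ominus>\<^bsub>M\<^esub> f i"
    have g: "?g \<in> carrier ?C"
      using copower_closed_map[OF f f, of "\<lambda>x y. \<ominus>\<^bsub>M\<^esub> x" M] by simp
    moreover have "?g \<oplus>\<^bsub>?C\<^esub> f = \<zero>\<^bsub>?C\<^esub>"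
      by (rule ext[OF add[OF g f] zero]) (use in_M[OF f] in \<open>simp add: copower_simps M.l_neg\<close>)
    ultimately show "\<exists>g\<in>carrier ?C. g \<oplus>\<^bsub>?C\<^esub> f = \<zero>\<^bsub>?C\<^esub>" by blast
    show "\<zero>\<^bsub>?C\<^esub> \<oplus>\<^bsub>?C\<^esub> f = f"
      by (rule ext[OF add[OF zero f] f]) (use in_M[OF f] in \<open>simp add: copower_simps\<close>)
    fix g assume g: "g \<in> carrier ?C"
    show "f \<oplus>\<^bsub>?C\<^esub> g = g \<oplus>\<^bsub>?C\<^esub> f"
      by (rule ext[OF add[OF f g] add[OF g f]])
         (use in_M[OF f] in_M[OF g] in \<open>simp add: copower_simps M.a_comm\<close>)
    fix k assume k: "k \<in> carrier ?C"
    show "f \<oplus>\<^bsub>?C\<^esub> g \<oplus>\<^bsub>?C\<^esub> k = f \<oplus>\<^bsub>?C\<^esub> (g \<oplus>\<^bsub>?C\<^esub> k)"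
      by (rule ext[OF add[OF add[OF f g] k] add[OF f add[OF g k]]])
         (use in_M[OF f] in_M[OF g] in_M[OF k] in \<open>simp add: copower_simps M.a_assoc\<close>)
  qed (use add zero in auto)
qed

lemma (in left_module) copower_left_module: "left_module R (copower M I)"
proof -
  interpret C: abelian_group "copower M I"
    by (rule copower_abelian_group[OF M.abelian_group_axioms])
  show ?thesis
  proof unfold_locales
    fix r m assume "r \<in> carrier R" "m \<in> carrier (copower M I)"
    then show "r \<triangleright>\<^bsub>copower M I\<^esub> m \<in> carrier (copower M I)"
      unfolding copower_simps(4) using copower_closed_map[of m M I m "\<lambda>x y. r \<triangleright>\<^bsub>M\<^esub> x" M]
      by (simp add: lact_closed)
  next
    fix m assume "m \<in> carrier (copower M I)"
    then show "\<one>\<^bsub>R\<^esub> \<triangleright>\<^bsub>copower M I\<^esub> m = m"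
      by (auto simp: copower_simps fun_eq_iff lact_one PiE_iff extensional_def)
  qed (auto simp: copower_simps fun_eq_iff restrict_def PiE_iff lact_l_distr lact_r_distr lact_assoc)
qed

lemma (in right_module) copower_right_module: "right_module S (copower M I)"
proof -
  interpret C: abelian_group "copower M I"
    by (rule copower_abelian_group[OF M.abelian_group_axioms])
  show ?thesis
  proof unfold_locales
    fix r m assume "r \<in> carrier S" "m \<in> carrier (copower M I)"
    then show "m \<triangleleft>\<^bsub>copower M I\<^esub> r \<in> carrier (copower M I)"
      unfolding copower_simps(5) using copower_closed_map[of m M I m "\<lambda>x y. x \<triangleleft>\<^bsub>M\<^esub> r" M]
      by (simp add: ract_closed)
  next
    fix m assume "m \<in> carrier (copower M I)"
    then show "m \<triangleleft>\<^bsub>copower M I\<^esub> \<one>\<^bsub>S\<^esub> = m"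
      by (auto simp: copower_simps fun_eq_iff ract_one PiE_iff extensional_def)
  qed (auto simp: copower_simps fun_eq_iff restrict_def PiE_iff ract_l_distr ract_r_distr ract_assoc)
qed

lemma (in bimodule) copower_bimodule: "bimodule R S (copower M I)"
proof -
  interpret L: left_module R "copower M I" by (rule copower_left_module)
  interpret R: right_module S "copower M I" by (rule copower_right_module)
  show ?thesis
    by unfold_locales (auto simp: copower_simps fun_eq_iff restrict_def PiE_iff lact_ract)
qed

definition unit_vec :: "('m, 'c) ring_scheme \<Rightarrow> 'i set \<Rightarrow> 'i \<Rightarrow> 'm \<Rightarrow> 'i \<Rightarrow> 'm"
  where "unit_vec M I i v = (\<lambda>j\<in>I. if j = i then v else \<zero>\<^bsub>M\<^esub>)"

context
  fixes M :: "('r, 's, 'm, 'x) bimod_scheme" and I :: "'i set"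
  assumes M: "abelian_group M"
begin

interpretation M: abelian_group M by (rule M)
interpretation C: abelian_group "copower M I" by (rule copower_abelian_group[OF M])

lemma copower_proj_hom: "i \<in> I \<Longrightarrow> (\<lambda>w. w i) \<in> add_hom (copower M I) M"
  by (auto simp: add_hom_def copower_simps)

lemma unit_vec_closed: "v \<in> carrier M \<Longrightarrow> unit_vec M I i v \<in> carrier (copower M I)"
  by (auto simp: unit_vec_def copower_simps)

lemma unit_vec_hom: "unit_vec M I i \<in> add_hom M (copower M I)"
  by (rule add_homI[OF unit_vec_closed]) (auto simp: unit_vec_def copower_simps)

text \<open>The index set \<open>I\<close> may be infinite, as it is for the free modules in the
  definition of projectivity; the sum therefore runs over a finite \<open>J\<close> containing the
  support.\<close>

lemma copower_expand:
  assumes w: "w \<in> carrier (copower M I)" and J: "finite J" "J \<subseteq> I"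
    and supp: "\<And>i. i \<in> I - J \<Longrightarrow> w i = \<zero>\<^bsub>M\<^esub>"
  shows "w = (\<Oplus>\<^bsub>copower M I\<^esub>i\<in>J. unit_vec M I i (w i))"
proof -
  have wi: "w i \<in> carrier M" if "i \<in> I" for i using w that by (auto simp: copower_simps)
  have uv: "unit_vec M I i (w i) \<in> carrier (copower M I)" if "i \<in> J" for i
    using that J wi by (auto intro: unit_vec_closed)
  have "(\<Oplus>\<^bsub>copower M I\<^esub>i\<in>J. unit_vec M I i (w i)) j = w j" if j: "j \<in> I" for j
  proof -
    have "(\<Oplus>\<^bsub>copower M I\<^esub>i\<in>J. unit_vec M I i (w i)) j = (\<Oplus>\<^bsub>M\<^esub>i\<in>J. unit_vec M I i (w i) j)"
      by (rule add_hom_finsum[OF C.abelian_group_axioms M copower_proj_hom[OF j] uv])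
    also have "\<dots> = (\<Oplus>\<^bsub>M\<^esub>i\<in>J. if j = i then w i else \<zero>\<^bsub>M\<^esub>)"
      using j J wi by (intro M.finsum_cong') (auto simp: unit_vec_def)
    also have "\<dots> = w j"
    proof (cases "j \<in> J")
      case True
      then show ?thesis using J wi by (intro M.finsum_singleton) auto
    next
      case False
      then have "(\<Oplus>\<^bsub>M\<^esub>i\<in>J. if j = i then w i else \<zero>\<^bsub>M\<^esub>) = (\<Oplus>\<^bsub>M\<^esub>i\<in>J. \<zero>\<^bsub>M\<^esub>)"
        by (intro M.finsum_cong') auto
      then show ?thesis using False j supp by simp
    qed
    finally show ?thesis .
  qed
  moreover have "(\<Oplus>\<^bsub>copower M I\<^esub>i\<in>J. unit_vec M I i (w i)) \<in> carrier (copower M I)"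
    using uv by (intro C.finsum_closed) auto
  ultimately show ?thesis
    using w PiE_ext[of w I "\<lambda>_. carrier M"] by (simp add: copower_simps)
qed

end

lemma (in left_module) lact_unit_vec:
  "r \<in> carrier R \<Longrightarrow> r \<triangleright>\<^bsub>copower M I\<^esub> unit_vec M I i v = unit_vec M I i (r \<triangleright>\<^bsub>M\<^esub> v)"
  by (auto simp: copower_simps unit_vec_def)

lemma (in right_module) ract_unit_vec:
  "s \<in> carrier S \<Longrightarrow> unit_vec M I i v \<triangleleft>\<^bsub>copower M I\<^esub> s = unit_vec M I i (v \<triangleleft>\<^bsub>M\<^esub> s)"
  by (auto simp: copower_simps unit_vec_def)

text \<open>Extracts the section and the retraction from an isomorphism of
  \<open>U \<oplus> P\<close> with \<open>C\<close>. Only additivity is assumed of the isomorphism,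
  so that divisibility of bimodules and left or right projectivity can share the construction and
  add linearity on the side they need.\<close>

locale direct_decomposition =
  fixes U :: "('r, 's, 'm, 'x) bimod_scheme" and P :: "('r, 's, 'p, 'y) bimod_scheme"
    and C :: "('r, 's, 'n, 'z) bimod_scheme" and \<phi>
  assumes U: "abelian_group U" and P: "abelian_group P" and C: "abelian_group C"
    and \<phi>: "\<phi> \<in> add_hom (direct_sum U P) C"
    and bij: "bij_betw \<phi> (carrier (direct_sum U P)) (carrier C)"
begin

sublocale U: abelian_group U by (rule U)
sublocale P: abelian_group P by (rule P)
sublocale C: abelian_group C by (rule C)

definition "sect u = \<phi> (u, \<zero>\<^bsub>P\<^esub>)"
definition "retr c = fst (inv_into (carrier (direct_sum U P)) \<phi> c)"

lemma sect_hom: "sect \<in> add_hom U C"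
proof (rule add_homI)
  show "sect x \<in> carrier C" if "x \<in> carrier U" for x
    using add_hom_closed[OF \<phi>, of "(x, \<zero>\<^bsub>P\<^esub>)"] that by (simp add: sect_def direct_sum_simps)
  fix x y assume "x \<in> carrier U" "y \<in> carrier U"
  then show "sect (x \<oplus>\<^bsub>U\<^esub> y) = sect x \<oplus>\<^bsub>C\<^esub> sect y"
    using add_hom_add[OF \<phi>, of "(x, \<zero>\<^bsub>P\<^esub>)" "(y, \<zero>\<^bsub>P\<^esub>)"] by (simp add: sect_def direct_sum_simps)
qed

lemma retr_\<phi>: "\<lbrakk>u \<in> carrier U; p \<in> carrier P\<rbrakk> \<Longrightarrow> retr (\<phi> (u, p)) = u"
  unfolding retr_def by (subst bij_betw_inv_into_left[OF bij]) (auto simp: direct_sum_simps)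

lemma \<phi>_surj:
  assumes "c \<in> carrier C"
  obtains u p where "u \<in> carrier U" "p \<in> carrier P" "c = \<phi> (u, p)"
proof -
  have "c \<in> \<phi> ` (carrier U \<times> carrier P)"
    using assms bij unfolding bij_betw_def direct_sum_simps by blast
  then show thesis using that by blast
qed

lemma retr_hom: "retr \<in> add_hom C U"
proof (rule add_homI)
  show "retr c \<in> carrier U" if "c \<in> carrier C" for c
    using that by (metis \<phi>_surj retr_\<phi>)
  fix c d assume "c \<in> carrier C" "d \<in> carrier C"
  then obtain u p v q where *: "u \<in> carrier U" "p \<in> carrier P" "c = \<phi> (u, p)"
    "v \<in> carrier U" "q \<in> carrier P" "d = \<phi> (v, q)"
    by (metis \<phi>_surj)
  then have "c \<oplus>\<^bsub>C\<^esub> d = \<phi> (u \<oplus>\<^bsub>U\<^esub> v, p \<oplus>\<^bsub>P\<^esub> q)"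
    using add_hom_add[OF \<phi>, of "(u, p)" "(v, q)"] by (simp add: direct_sum_simps)
  with * show "retr (c \<oplus>\<^bsub>C\<^esub> d) = retr c \<oplus>\<^bsub>U\<^esub> retr d" by (simp add: retr_\<phi>)
qed

lemma retr_sect: "u \<in> carrier U \<Longrightarrow> retr (sect u) = u"
  by (simp add: sect_def retr_\<phi>)

lemma left_linear:
  assumes "left_module R U" "left_module R P" "\<phi> \<in> left_hom R (direct_sum U P) C"
  shows "sect \<in> left_hom R U C" "retr \<in> left_hom R C U"
proof -
  interpret U': left_module R U by fact
  interpret P': left_module R P by fact
  have lin: "r \<triangleright>\<^bsub>C\<^esub> \<phi> (u, p) = \<phi> (r \<triangleright>\<^bsub>U\<^esub> u, r \<triangleright>\<^bsub>P\<^esub> p)"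
    if "r \<in> carrier R" "u \<in> carrier U" "p \<in> carrier P" for r u p
    using assms(3) that by (auto simp: left_hom_iff direct_sum_simps)
  show "sect \<in> left_hom R U C"
    using sect_hom lin by (auto simp: left_hom_iff sect_def)
  have "retr (r \<triangleright>\<^bsub>C\<^esub> c) = r \<triangleright>\<^bsub>U\<^esub> retr c" if "r \<in> carrier R" "c \<in> carrier C" for r c
  proof -
    obtain u p where "u \<in> carrier U" "p \<in> carrier P" "c = \<phi> (u, p)"
      using \<phi>_surj[OF \<open>c \<in> carrier C\<close>] .
    then show ?thesis using that by (simp add: lin retr_\<phi> U'.lact_closed P'.lact_closed)
  qed
  then show "retr \<in> left_hom R C U" using retr_hom by (simp add: left_hom_iff)
qed

lemma right_linear:
  assumes "right_module S U" "right_module S P" "\<phi> \<in> right_hom S (direct_sum U P) C"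
  shows "sect \<in> right_hom S U C" "retr \<in> right_hom S C U"
proof -
  interpret U': right_module S U by fact
  interpret P': right_module S P by fact
  have lin: "\<phi> (u, p) \<triangleleft>\<^bsub>C\<^esub> s = \<phi> (u \<triangleleft>\<^bsub>U\<^esub> s, p \<triangleleft>\<^bsub>P\<^esub> s)"
    if "s \<in> carrier S" "u \<in> carrier U" "p \<in> carrier P" for s u p
    using assms(3) that by (auto simp: right_hom_iff direct_sum_simps)
  show "sect \<in> right_hom S U C"
    using sect_hom lin by (auto simp: right_hom_iff sect_def)
  have "retr (c \<triangleleft>\<^bsub>C\<^esub> s) = retr c \<triangleleft>\<^bsub>U\<^esub> s" if "s \<in> carrier S" "c \<in> carrier C" for s c
  proof -
    obtain u p where "u \<in> carrier U" "p \<in> carrier P" "c = \<phi> (u, p)"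
      using \<phi>_surj[OF \<open>c \<in> carrier C\<close>] .
    then show ?thesis using that by (simp add: lin retr_\<phi> U'.ract_closed P'.ract_closed)
  qed
  then show "retr \<in> right_hom S C U" using retr_hom by (simp add: right_hom_iff)
qed

end

text \<open>\<open>f i\<close> is the i-th coordinate of the section \<open>D.sect\<close>, and
  \<open>g i\<close> is the retraction \<open>D.retr\<close> on the i-th copy of \<open>V\<close>.
  Writing \<open>D.sect u\<close> as a sum of unit vectors turns
  \<open>D.retr (D.sect u) = u\<close> into the stated sum.\<close>

lemma bimod_dividesE:
  fixes U :: "('r, 's, 'm, 'x) bimod_scheme" and V :: "('r, 's, 'n, 'y) bimod_scheme"
  assumes "bimodule R S U" "bimodule R S V" "bimod_divides R S U V"
  obtains n f g where
    "f \<in> {..<n::nat} \<rightarrow> bimod_hom R S U V" "g \<in> {..<n} \<rightarrow> bimod_hom R S V U"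
    "\<And>u. u \<in> carrier U \<Longrightarrow> u = (\<Oplus>\<^bsub>U\<^esub>i\<in>{..<n}. g i (f i u))"
proof -
  interpret U: bimodule R S U by fact
  interpret V: bimodule R S V by fact
  obtain P :: "('r, 's, nat \<Rightarrow> 'n) bimod" and n :: nat and \<phi> where P: "bimodule R S P"
    and \<phi>: "\<phi> \<in> bimod_hom R S (direct_sum U P) (copower V {..<n})"
    and bij: "bij_betw \<phi> (carrier (direct_sum U P)) (carrier (copower V {..<n}))"
    using assms(3) unfolding bimod_divides_def bimod_isomorphic_def by blast
  let ?C = "copower V {..<n}"
  interpret P: bimodule R S P by (rule P)
  interpret C: bimodule R S ?C by (rule V.copower_bimodule)
  interpret D: direct_decomposition U P ?C \<phi>
    using \<phi> bij by unfold_locales (auto simp: left_hom_iff)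
  have sect: "D.sect \<in> bimod_hom R S U ?C" and retr: "D.retr \<in> bimod_hom R S ?C U"
    using D.left_linear[OF U.left_module_axioms P.left_module_axioms]
      D.right_linear[OF U.right_module_axioms P.right_module_axioms] \<phi> by auto
  show thesis
  proof
    show "(\<lambda>i u. D.sect u i) \<in> {..<n} \<rightarrow> bimod_hom R S U V"
      using sect by (auto simp: left_hom_iff right_hom_iff copower_simps
          intro!: add_hom_comp[OF D.sect_hom copower_proj_hom] V.M.abelian_group_axioms)
    show "(\<lambda>i v. D.retr (unit_vec V {..<n} i v)) \<in> {..<n} \<rightarrow> bimod_hom R S V U"
    proof
      fix i
      have "(\<lambda>v. D.retr (unit_vec V {..<n} i v)) \<in> add_hom V U"
        by (rule add_hom_comp[OF unit_vec_hom[OF V.M.abelian_group_axioms] D.retr_hom])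
      then show "(\<lambda>v. D.retr (unit_vec V {..<n} i v)) \<in> bimod_hom R S V U"
        using retr
        by (simp add: left_hom_iff right_hom_iff unit_vec_closed[OF V.M.abelian_group_axioms] V.lact_unit_vec[symmetric] V.ract_unit_vec[symmetric])
    qed
    fix u assume u: "u \<in> carrier U"
    have su: "D.sect u \<in> carrier ?C" using u by (rule add_hom_closed[OF D.sect_hom])
    have "D.sect u = (\<Oplus>\<^bsub>?C\<^esub>i\<in>{..<n}. unit_vec V {..<n} i (D.sect u i))"
      by (rule copower_expand[OF V.M.abelian_group_axioms su]) auto
    then have "u = D.retr (\<Oplus>\<^bsub>?C\<^esub>i\<in>{..<n}. unit_vec V {..<n} i (D.sect u i))"
      using D.retr_sect[OF u] by simp
    also have "\<dots> = (\<Oplus>\<^bsub>U\<^esub>i\<in>{..<n}. D.retr (unit_vec V {..<n} i (D.sect u i)))"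
      using su by (intro add_hom_finsum[OF D.C D.U D.retr_hom] unit_vec_closed)
        (auto simp: copower_simps V.M.abelian_group_axioms)
    finally show "u = (\<Oplus>\<^bsub>U\<^esub>i\<in>{..<n}. D.retr (unit_vec V {..<n} i (D.sect u i)))" .
  qed
qed

text \<open>Supplies the complement in \<open>bimod_dividesI\<close>. A kernel keeps the element
  type of \<open>C\<close>, which is what the type of the complement in \<open>bimod_divides\<close>
  demands.\<close>

lemma kernel_bimodule:
  fixes C :: "('r, 's, 'n) bimod"
  assumes "bimodule R S C" "bimodule R S U" "q \<in> bimod_hom R S C U"
  shows "bimodule R S (C\<lparr>carrier := {c \<in> carrier C. q c = \<zero>\<^bsub>U\<^esub>}\<rparr>)" (is "bimodule R S ?K")
proof -
  interpret C: bimodule R S C by fact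
  interpret U: bimodule R S U by fact
  have q: "q \<in> add_hom C U" using assms(3) by (simp add: left_hom_iff)
  have q0: "q \<zero>\<^bsub>C\<^esub> = \<zero>\<^bsub>U\<^esub>"
    by (rule add_hom_zero[OF C.M.abelian_group_axioms U.M.abelian_group_axioms q])
  interpret K: abelian_group ?K
  proof (rule abelian_groupI)
    fix x assume x: "x \<in> carrier ?K"
    have "q (\<ominus>\<^bsub>C\<^esub> x) = \<zero>\<^bsub>U\<^esub>"
      using add_hom_add[OF q, of x "\<ominus>\<^bsub>C\<^esub> x"] x add_hom_closed[OF q, of "\<ominus>\<^bsub>C\<^esub> x"]
      by (simp add: q0 C.M.r_neg)
    then show "\<exists>y\<in>carrier ?K. y \<oplus>\<^bsub>?K\<^esub> x = \<zero>\<^bsub>?K\<^esub>"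
      using x by (intro bexI[of _ "\<ominus>\<^bsub>C\<^esub> x"]) (auto simp: C.M.l_neg)
  qed (auto simp: add_hom_add[OF q] q0 C.M.a_assoc intro: C.M.a_comm)
  show ?thesis
    using assms(3)
    by unfold_locales
       (auto simp: left_hom_iff right_hom_iff C.lact_closed C.ract_closed C.lact_l_distr
        C.lact_r_distr C.ract_l_distr C.ract_r_distr C.lact_assoc C.ract_assoc C.lact_one C.ract_one
        C.lact_ract)
qed

text \<open>The \<open>f i\<close> assemble into a map \<open>\<iota>\<close> from \<open>U\<close>
  to \<open>n\<close> copies of \<open>V\<close>, the \<open>g i\<close> into a map \<open>q\<close>
  back, and the hypothesis says that \<open>q\<close> splits \<open>\<iota>\<close>. Hence the power
  of \<open>V\<close> is the direct sum of the image of \<open>\<iota>\<close> and the kernel of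
  \<open>q\<close>.\<close>

lemma bimod_dividesI:
  fixes U :: "('r, 's, 'm, 'x) bimod_scheme" and V :: "('r, 's, 'n, 'y) bimod_scheme"
  assumes "bimodule R S U" "bimodule R S V"
    and f: "f \<in> {..<n::nat} \<rightarrow> bimod_hom R S U V" and g: "g \<in> {..<n} \<rightarrow> bimod_hom R S V U"
    and id: "\<And>u. u \<in> carrier U \<Longrightarrow> u = (\<Oplus>\<^bsub>U\<^esub>i\<in>{..<n}. g i (f i u))"
  shows "bimod_divides R S U V"
proof -
  interpret U: bimodule R S U by fact
  interpret V: bimodule R S V by fact
  let ?C = "copower V {..<n}"
  interpret C: bimodule R S ?C by (rule V.copower_bimodule)
  define \<iota> where "\<iota> u = (\<lambda>i\<in>{..<n}. f i u)" for u
  define q where "q w = (\<Oplus>\<^bsub>U\<^esub>i\<in>{..<n}. g i (w i))" for w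
  have fV: "f i u \<in> carrier V" if "i < n" "u \<in> carrier U" for i u
    using f that by (auto simp: left_hom_iff Pi_iff add_hom_def)
  have gU: "g i v \<in> carrier U" if "i < n" "v \<in> carrier V" for i v
    using g that by (auto simp: left_hom_iff Pi_iff add_hom_def)
  have \<iota>: "\<iota> \<in> bimod_hom R S U ?C"
    using f fV by (auto simp: left_hom_iff right_hom_iff Pi_iff \<iota>_def copower_simps add_hom_add
        fun_eq_iff restrict_def PiE_iff extensional_def intro!: add_homI)
  have q_add: "q \<in> add_hom ?C U"
    unfolding q_def
  proof (rule add_hom_sum[OF U.M.abelian_group_axioms])
    fix i assume i: "i \<in> {..<n}"
    then have "g i \<in> add_hom V U" using g by (auto simp: left_hom_iff)
    then show "(\<lambda>w. g i (w i)) \<in> add_hom ?C U"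
      by (rule add_hom_comp[OF copower_proj_hom[OF V.M.abelian_group_axioms i]])
  qed
  have CV: "w i \<in> carrier V" if "w \<in> carrier ?C" "i < n" for w i
    using that by (auto simp: copower_simps)
  have q_l: "q (r \<triangleright>\<^bsub>?C\<^esub> w) = r \<triangleright>\<^bsub>U\<^esub> q w" if "r \<in> carrier R" "w \<in> carrier ?C" for r w
  proof -
    have "q (r \<triangleright>\<^bsub>?C\<^esub> w) = (\<Oplus>\<^bsub>U\<^esub>i\<in>{..<n}. r \<triangleright>\<^bsub>U\<^esub> g i (w i))"
      unfolding q_def using that g CV gU
      by (intro U.M.finsum_cong') (auto simp: copower_simps(4) left_hom_iff Pi_iff U.lact_closed)
    also have "\<dots> = r \<triangleright>\<^bsub>U\<^esub> q w"
      unfolding q_def using that CV gU by (intro U.lact_finsum[symmetric]) auto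
    finally show ?thesis .
  qed
  have q_r: "q (w \<triangleleft>\<^bsub>?C\<^esub> s) = q w \<triangleleft>\<^bsub>U\<^esub> s" if "s \<in> carrier S" "w \<in> carrier ?C" for s w
  proof -
    have "q (w \<triangleleft>\<^bsub>?C\<^esub> s) = (\<Oplus>\<^bsub>U\<^esub>i\<in>{..<n}. g i (w i) \<triangleleft>\<^bsub>U\<^esub> s)"
      unfolding q_def using that g CV gU
      by (intro U.M.finsum_cong') (auto simp: copower_simps(5) right_hom_iff Pi_iff U.ract_closed)
    also have "\<dots> = q w \<triangleleft>\<^bsub>U\<^esub> s"
      unfolding q_def using that CV gU by (intro U.ract_finsum[symmetric]) auto
    finally show ?thesis .
  qed
  have q: "q \<in> bimod_hom R S ?C U"
    using q_add q_l q_r by (simp add: left_hom_iff right_hom_iff)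
  have q\<iota>: "q (\<iota> u) = u" if "u \<in> carrier U" for u
  proof -
    have "q (\<iota> u) = (\<Oplus>\<^bsub>U\<^esub>i\<in>{..<n}. g i (f i u))"
      unfolding q_def \<iota>_def using that fV gU by (intro U.M.finsum_cong') auto
    then show ?thesis using id[OF that] by simp
  qed
  define P where "P = ?C\<lparr>carrier := {c \<in> carrier ?C. q c = \<zero>\<^bsub>U\<^esub>}\<rparr>"
  have P: "bimodule R S P"
    unfolding P_def by (rule kernel_bimodule[OF C.bimodule_axioms assms(1) q])
  interpret P: bimodule R S P by (rule P)
  have P_simps: "carrier P = {c \<in> carrier ?C. q c = \<zero>\<^bsub>U\<^esub>}" "(\<oplus>\<^bsub>P\<^esub>) = (\<oplus>\<^bsub>?C\<^esub>)"
    "(\<triangleright>\<^bsub>P\<^esub>) = (\<triangleright>\<^bsub>?C\<^esub>)" "(\<triangleleft>\<^bsub>P\<^esub>) = (\<triangleleft>\<^bsub>?C\<^esub>)"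
    by (simp_all add: P_def)
  have \<iota>_add: "\<iota> \<in> add_hom U ?C" using \<iota> by (simp add: left_hom_iff)
  note \<iota>C = add_hom_closed[OF \<iota>_add]
  define \<phi> where "\<phi> = (\<lambda>(u, p). \<iota> u \<oplus>\<^bsub>?C\<^esub> p)"
  have \<phi>_add: "\<phi> \<in> add_hom (direct_sum U P) ?C"
    by (rule add_homI)
       (auto simp: direct_sum_simps \<phi>_def P_simps \<iota>C add_hom_add[OF \<iota>_add] C.M.a_ac)
  have \<phi>: "\<phi> \<in> bimod_hom R S (direct_sum U P) ?C"
    unfolding left_hom_iff right_hom_iff Int_iff
    using \<phi>_add \<iota> by (auto simp: \<phi>_def direct_sum_simps P_simps C.lact_r_distr C.ract_l_distr \<iota>C
        left_hom_iff right_hom_iff)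
  have q\<phi>: "q (\<phi> (u, p)) = u" if "u \<in> carrier U" "p \<in> carrier P" for u p
    using that by (simp add: \<phi>_def P_simps add_hom_add[OF q_add] \<iota>C q\<iota>)
  have "bij_betw \<phi> (carrier (direct_sum U P)) (carrier ?C)"
    unfolding bij_betw_def
  proof (intro conjI inj_onI subset_antisym subsetI)
    fix a b assume ab: "a \<in> carrier (direct_sum U P)" "b \<in> carrier (direct_sum U P)" "\<phi> a = \<phi> b"
    obtain u p v r where *: "a = (u, p)" "b = (v, r)" by fastforce
    with ab have "u = v" using q\<phi>[of u p] q\<phi>[of v r] by (simp add: direct_sum_simps)
    with ab * show "a = b"
      by (auto simp: direct_sum_simps \<phi>_def P_simps \<iota>C)
  next
    fix c assume "c \<in> \<phi> ` carrier (direct_sum U P)"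
    then show "c \<in> carrier ?C" using add_hom_closed[OF \<phi>_add] by auto
  next
    fix c assume c: "c \<in> carrier ?C"
    have qc: "q c \<in> carrier U" using c by (rule add_hom_closed[OF q_add])
    \<comment> \<open>The component of \<open>c\<close> in the kernel of \<open>q\<close>:
      subtracting \<open>\<iota> (q c)\<close> removes exactly what \<open>q\<close> sees.\<close>
    let ?p = "\<ominus>\<^bsub>?C\<^esub> \<iota> (q c) \<oplus>\<^bsub>?C\<^esub> c"
    have pC: "?p \<in> carrier ?C" using c qc by (simp add: \<iota>C)
    have c_eq: "c = \<iota> (q c) \<oplus>\<^bsub>?C\<^esub> ?p"
      using c qc by (simp add: \<iota>C C.M.r_neg2)
    then have "q c = q (\<iota> (q c)) \<oplus>\<^bsub>U\<^esub> q ?p"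
      using add_hom_add[OF q_add \<iota>C[OF qc] pC] by simp
    then have "q ?p = \<zero>\<^bsub>U\<^esub>"
      using qc add_hom_closed[OF q_add pC] by (simp add: q\<iota>)
    with pC have "?p \<in> carrier P" by (simp add: P_simps)
    with qc c_eq show "c \<in> \<phi> ` carrier (direct_sum U P)"
      by (intro image_eqI[of _ _ "(q c, ?p)"]) (auto simp: direct_sum_simps \<phi>_def)
  qed
  with \<phi> P show ?thesis
    unfolding bimod_divides_def bimod_isomorphic_def by blast
qed

section \<open>Depth conditions in terms of quasi-bases\<close>

lemma ring_bimod_simps [simp]:
  "carrier (ring_bimod f A g) = carrier A"
  "\<zero>\<^bsub>ring_bimod f A g\<^esub> = \<zero>\<^bsub>A\<^esub>"
  "(\<oplus>\<^bsub>ring_bimod f A g\<^esub>) = (\<oplus>\<^bsub>A\<^esub>)"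
  "r \<triangleright>\<^bsub>ring_bimod f A g\<^esub> x = f r \<otimes>\<^bsub>A\<^esub> x"
  "x \<triangleleft>\<^bsub>ring_bimod f A g\<^esub> s = x \<otimes>\<^bsub>A\<^esub> g s"
  by (simp_all add: ring_bimod_def)

text \<open>\<open>finsum\<close> consults only carrier, zero and addition, which
  \<open>ring_bimod\<close> copies from \<open>A\<close>.\<close>

lemma finsum_ring_bimod [simp]: "finsum (ring_bimod f A g) = finsum A"
  by (simp add: finsum_def fun_eq_iff finprod_def cong: if_cong)

lemma add_hom_ring_bimod [simp]:
  "add_hom (ring_bimod f A g) H = add_hom A H"
  "add_hom G (ring_bimod f A g) = add_hom G A"
  by (simp_all add: add_hom_def)

lemma ring_hom_ring_id: "ring A \<Longrightarrow> ring_hom_ring A A id"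
  by (intro ring_hom_ringI2) (auto simp: ring_hom_def)

lemma ring_hom_ring_comp:
  assumes "ring_hom_ring C B k" "ring_hom_ring B A h"
  shows "ring_hom_ring C A (h \<circ> k)"
proof -
  interpret k: ring_hom_ring C B k by fact
  interpret h: ring_hom_ring B A h by fact
  show ?thesis
    using ring_hom_trans[OF k.homh h.homh]
    by (intro ring_hom_ringI2 k.R.ring_axioms h.S.ring_axioms)
qed

lemma ring_bimod_bimodule:
  assumes "ring_hom_ring R A f" "ring_hom_ring S A g"
  shows "bimodule R S (ring_bimod f A g)"
proof -
  interpret f: ring_hom_ring R A f by fact
  interpret g: ring_hom_ring S A g by fact
  have "abelian_group (ring_bimod f A g)"
    by (rule abelian_groupI)
       (auto simp: f.S.a_ac intro: f.S.add.l_inv_ex)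
  then interpret M: abelian_group "ring_bimod f A g" .
  show ?thesis
    by unfold_locales
       (auto simp: f.S.l_distr f.S.r_distr f.S.m_assoc)
qed

text \<open>\<open>f\<close> and \<open>g\<close> carry \<open>C\<close> into the rings acting on
  the left and on the right of \<open>P\<close>. For \<open>t\<close> in this set, acting on
  \<open>t\<close> by elements of a ring above \<open>C\<close> gives a map from that ring to
  \<open>P\<close> that is also \<open>C\<close>-linear on the other side.\<close>

definition central ::
    "('c, 'e) ring_scheme \<Rightarrow> ('c \<Rightarrow> 'q) \<Rightarrow> ('c \<Rightarrow> 's) \<Rightarrow> ('q, 's, 'm, 'x) bimod_scheme \<Rightarrow> 'm set"
  where "central C f g P = {t \<in> carrier P. \<forall>c\<in>carrier C. f c \<triangleright>\<^bsub>P\<^esub> t = t \<triangleleft>\<^bsub>P\<^esub> g c}"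

lemma centralD: "t \<in> central C f g P \<Longrightarrow> t \<in> carrier P"
  "\<lbrakk>t \<in> central C f g P; c \<in> carrier C\<rbrakk> \<Longrightarrow> f c \<triangleright>\<^bsub>P\<^esub> t = t \<triangleleft>\<^bsub>P\<^esub> g c"
  by (auto simp: central_def)

definition bimod_end where
  "bimod_end B C A f g = bimod_hom B C (ring_bimod f A g) (ring_bimod f A g)"

lemma bimod_end_iff:
  "\<gamma> \<in> bimod_end B C A f g \<longleftrightarrow> \<gamma> \<in> add_hom A A \<and>
    (\<forall>b\<in>carrier B. \<forall>x\<in>carrier A. \<gamma> (f b \<otimes>\<^bsub>A\<^esub> x) = f b \<otimes>\<^bsub>A\<^esub> \<gamma> x) \<and>
    (\<forall>c\<in>carrier C. \<forall>x\<in>carrier A. \<gamma> (x \<otimes>\<^bsub>A\<^esub> g c) = \<gamma> x \<otimes>\<^bsub>A\<^esub> g c)"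
  by (auto simp: bimod_end_def left_hom_iff right_hom_iff)

lemma bimod_endD:
  assumes "\<gamma> \<in> bimod_end B C A f g"
  shows "\<gamma> \<in> add_hom A A"
    and "x \<in> carrier A \<Longrightarrow> \<gamma> x \<in> carrier A"
    and "\<lbrakk>b \<in> carrier B; x \<in> carrier A\<rbrakk> \<Longrightarrow> \<gamma> (f b \<otimes>\<^bsub>A\<^esub> x) = f b \<otimes>\<^bsub>A\<^esub> \<gamma> x"
    and "\<lbrakk>c \<in> carrier C; x \<in> carrier A\<rbrakk> \<Longrightarrow> \<gamma> (x \<otimes>\<^bsub>A\<^esub> g c) = \<gamma> x \<otimes>\<^bsub>A\<^esub> g c"
  using assms by (auto simp: bimod_end_iff add_hom_closed)

section \<open>Right quasi-bases of a tower\<close>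

locale tower = k: ring_hom_ring C B k + h: ring_hom_ring B A h
  for C :: "('c, 'e) ring_scheme" and B :: "('b, 'd) ring_scheme"
    and A :: "('a, 'f) ring_scheme" (structure) and k h
begin

sublocale hk: ring_hom_ring C A "h \<circ> k"
  by (rule ring_hom_ring_comp[OF k.ring_hom_ring_axioms h.ring_hom_ring_axioms])
sublocale tensor_bimodules A B C "ring_bimod id A h" "ring_bimod h A (h \<circ> k)"
  by (intro tensor_bimodules.intro ring_bimod_bimodule ring_hom_ring_id h.S.ring_axioms
      h.ring_hom_ring_axioms hk.ring_hom_ring_axioms)
sublocale TB: bimodule A C T by (rule tensor_bimodule)
sublocale V: bimodule A C "ring_bimod id A (h \<circ> k)"
  by (intro ring_bimod_bimodule ring_hom_ring_id h.S.ring_axioms hk.ring_hom_ring_axioms)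

lemma pure_lact: "\<lbrakk>a \<in> carrier A; x \<in> carrier A; y \<in> carrier A\<rbrakk> \<Longrightarrow>
    a \<triangleright>\<^bsub>T\<^esub> pure x y = pure (a \<otimes> x) y"
  by (simp add: lact_pure)

lemma pure_ract: "\<lbrakk>c \<in> carrier C; x \<in> carrier A; y \<in> carrier A\<rbrakk> \<Longrightarrow>
    pure x y \<triangleleft>\<^bsub>T\<^esub> c = pure x (y \<otimes> h (k c))"
  by (simp add: ract_pure)

lemma pure_mid: "\<lbrakk>b \<in> carrier B; x \<in> carrier A; y \<in> carrier A\<rbrakk> \<Longrightarrow>
    pure (x \<otimes> h b) y = pure x (h b \<otimes> y)"
  using pure_move[of x b y] by simp

text \<open>The \<open>\<gamma>\<close> stand for the \<open>A\<close>-\<open>C\<close>-bimodule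
  maps from \<open>T\<close> to \<open>A\<close>, by
  \<open>x \<otimes> y \<mapsto> x \<gamma>(y)\<close>, and the central \<open>t\<close> for those
  from \<open>A\<close> to \<open>T\<close>, by \<open>a \<mapsto> a t\<close>. A term is the
  composite of two such maps evaluated at \<open>1 \<otimes> y\<close>; as \<open>T\<close> is
  generated by these elements over \<open>A\<close>, nothing is lost by looking there.\<close>

definition "right_terms =
  {\<lambda>y. \<gamma> y \<triangleright>\<^bsub>T\<^esub> t | \<gamma> t. \<gamma> \<in> bimod_end B C A h (h \<circ> k) \<and> t \<in> central C (h \<circ> k) id T}"

lemma right_terms_closed: "right_terms \<subseteq> carrier A \<rightarrow> carrier T"
  by (auto simp: right_terms_def intro!: TB.lact_closed dest: centralD bimod_endD)

definition "right_quasibasis \<longleftrightarrow> finite_sum_of T (carrier A) right_terms (pure \<one>)"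

lemma balanced_mult:
  assumes "\<gamma> \<in> add_hom A A"
    and "\<And>b x. \<lbrakk>b \<in> carrier B; x \<in> carrier A\<rbrakk> \<Longrightarrow> \<gamma> (h b \<otimes> x) = h b \<otimes> \<gamma> x"
  shows "balanced B (ring_bimod id A h) (ring_bimod h A (h \<circ> k)) A (\<lambda>x y. x \<otimes> \<gamma> y)"
  using assms(2) add_hom_closed[OF assms(1)] unfolding balanced_def
  by (intro conjI ballI add_homI)
     (simp_all add: h.S.r_distr h.S.l_distr h.S.m_assoc add_hom_add[OF assms(1)])

lemma mult_lift:
  assumes "\<gamma> \<in> add_hom A A"
    and "\<And>b x. \<lbrakk>b \<in> carrier B; x \<in> carrier A\<rbrakk> \<Longrightarrow> \<gamma> (h b \<otimes> x) = h b \<otimes> \<gamma> x"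
  shows "\<exists>f\<in>add_hom T A. \<forall>x\<in>carrier A. \<forall>y\<in>carrier A. f (pure x y) = x \<otimes> \<gamma> y"
  using tensor_lift_exists[OF h.S.is_abelian_group balanced_mult[OF assms]]
  unfolding ring_bimod_simps .

text \<open>Divisibility gives bimodule maps \<open>f i\<close> from \<open>T\<close> to
  \<open>A\<close> and \<open>g i\<close> back whose composites sum to the identity. The quasi-basis
  consists of \<open>y \<mapsto> f i (1 \<otimes> y)\<close> and \<open>g i 1\<close>.\<close>

lemma right_D3_tower_imp_quasibasis:
  assumes "right_D3_tower C B A k h"
  shows right_quasibasis
proof -
  let ?V = "ring_bimod id A (h \<circ> k)"
  have div: "bimod_divides A C T ?V"
    using assms by (simp add: right_D3_tower_def bimod_similar_def)
  obtain n f g where f: "f \<in> {..<n::nat} \<rightarrow> bimod_hom A C T ?V"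
    and g: "g \<in> {..<n} \<rightarrow> bimod_hom A C ?V T"
    and id: "\<And>u. u \<in> carrier T \<Longrightarrow> u = (\<Oplus>\<^bsub>T\<^esub>i\<in>{..<n}. g i (f i u))"
    by (rule bimod_dividesE[OF tensor_bimodule V.bimodule_axioms div]) (rule that)
  define s where "s i = (\<lambda>y. f i (pure \<one> y) \<triangleright>\<^bsub>T\<^esub> g i \<one>)" for i
  have fA: "f i \<in> add_hom T A" "\<And>a t. \<lbrakk>a \<in> carrier A; t \<in> carrier T\<rbrakk> \<Longrightarrow> f i (a \<triangleright>\<^bsub>T\<^esub> t) = a \<otimes> f i t"
    "\<And>c t. \<lbrakk>c \<in> carrier C; t \<in> carrier T\<rbrakk> \<Longrightarrow> f i (t \<triangleleft>\<^bsub>T\<^esub> c) = f i t \<otimes> h (k c)" if "i < n" for i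
    using f that by (auto simp: left_hom_iff right_hom_iff Pi_iff)
  have gA: "g i \<in> add_hom A T" "\<And>a x. \<lbrakk>a \<in> carrier A; x \<in> carrier A\<rbrakk> \<Longrightarrow> g i (a \<otimes> x) = a \<triangleright>\<^bsub>T\<^esub> g i x"
    "\<And>c x. \<lbrakk>c \<in> carrier C; x \<in> carrier A\<rbrakk> \<Longrightarrow> g i (x \<otimes> h (k c)) = g i x \<triangleleft>\<^bsub>T\<^esub> c" if "i < n" for i
  proof -
    have "g i \<in> bimod_hom A C ?V T" using g that by auto
    then show "g i \<in> add_hom A T"
      "\<And>a x. \<lbrakk>a \<in> carrier A; x \<in> carrier A\<rbrakk> \<Longrightarrow> g i (a \<otimes> x) = a \<triangleright>\<^bsub>T\<^esub> g i x"
      "\<And>c x. \<lbrakk>c \<in> carrier C; x \<in> carrier A\<rbrakk> \<Longrightarrow> g i (x \<otimes> h (k c)) = g i x \<triangleleft>\<^bsub>T\<^esub> c"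
      unfolding Int_iff left_hom_iff right_hom_iff ring_bimod_simps add_hom_ring_bimod comp_apply id_apply
      by blast+
  qed
  have "s i \<in> right_terms" if i: "i < n" for i
  proof -
    have "(\<lambda>y. f i (pure \<one> y)) \<in> add_hom A A"
      using add_hom_comp[OF pure_hom_right fA(1)[OF i]] by simp
    \<comment> \<open>An element of \<open>B\<close> crosses the tensor sign to the left factor
      \<open>\<one>\<close> and then acts from outside.\<close>
    moreover have "f i (pure \<one> (h b \<otimes> y)) = h b \<otimes> f i (pure \<one> y)"
      if "b \<in> carrier B" "y \<in> carrier A" for b y
      using that pure_mid[of b "\<one>" y] pure_lact[of "h b" "\<one>" y] fA(2)[OF i, of "h b" "pure \<one> y"]
      by simp
    moreover have "f i (pure \<one> (y \<otimes> h (k c))) = f i (pure \<one> y) \<otimes> h (k c)"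
      if "c \<in> carrier C" "y \<in> carrier A" for c y
      using that pure_ract[of c "\<one>" y] fA(3)[OF i, of c "pure \<one> y"] by simp
    ultimately have "(\<lambda>y. f i (pure \<one> y)) \<in> bimod_end B C A h (h \<circ> k)"
      by (simp add: bimod_end_iff)
    moreover have "g i \<one> \<in> central C (h \<circ> k) id T"
    proof -
      have "h (k c) \<triangleright>\<^bsub>T\<^esub> g i \<one> = g i \<one> \<triangleleft>\<^bsub>T\<^esub> c" if "c \<in> carrier C" for c
        using gA(2)[OF i, of "h (k c)" "\<one>"] gA(3)[OF i, of c "\<one>"] that by simp
      then show ?thesis using add_hom_closed[OF gA(1)[OF i]] by (simp add: central_def)
    qed
    ultimately show ?thesis
      unfolding right_terms_def s_def
      by (intro CollectI exI[of _ "\<lambda>y. f i (pure \<one> y)"] exI[of _ "g i \<one>"] conjI refl)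
  qed
  moreover have "pure \<one> y = (\<Oplus>\<^bsub>T\<^esub>i\<in>{..<n}. s i y)" if y: "y \<in> carrier A" for y
  proof -
    have p: "pure \<one> y \<in> carrier T" using y by simp
    have fp: "f i (pure \<one> y) \<in> carrier A" if "i < n" for i
      using add_hom_closed[OF fA(1)[OF that] p] .
    have "(\<Oplus>\<^bsub>T\<^esub>i\<in>{..<n}. g i (f i (pure \<one> y))) = (\<Oplus>\<^bsub>T\<^esub>i\<in>{..<n}. s i y)"
    proof (rule T.finsum_cong'[OF refl])
      show "(\<lambda>i. s i y) \<in> {..<n} \<rightarrow> carrier T"
        using fp add_hom_closed[OF gA(1)] by (auto simp: s_def intro!: TB.lact_closed)
      fix i assume "i \<in> {..<n}"
      then show "g i (f i (pure \<one> y)) = s i y"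
        using gA(2)[of i "f i (pure \<one> y)" "\<one>"] fp by (simp add: s_def)
    qed
    then show ?thesis using id[OF p] by simp
  qed
  ultimately show ?thesis
    unfolding right_quasibasis_def finite_sum_of_def by (intro exI[of _ n] exI[of _ s]) auto
qed

lemma right_quasibasis_E:
  assumes right_quasibasis
  obtains n :: nat and \<gamma> t where
    "\<And>i. i \<in> {..<n} \<Longrightarrow> \<gamma> i \<in> bimod_end B C A h (h \<circ> k)"
    "\<And>i. i \<in> {..<n} \<Longrightarrow> t i \<in> central C (h \<circ> k) id T"
    "\<And>y. y \<in> carrier A \<Longrightarrow> pure \<one> y = (\<Oplus>\<^bsub>T\<^esub>i\<in>{..<n}. \<gamma> i y \<triangleright>\<^bsub>T\<^esub> t i)"
proof -
  obtain n s where s: "s \<in> {..<n::nat} \<rightarrow> right_terms"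
    and sum: "\<And>y. y \<in> carrier A \<Longrightarrow> pure \<one> y = (\<Oplus>\<^bsub>T\<^esub>i\<in>{..<n}. s i y)"
    using assms by (auto simp: right_quasibasis_def finite_sum_of_def)
  have "\<forall>i\<in>{..<n}. \<exists>\<gamma> t. \<gamma> \<in> bimod_end B C A h (h \<circ> k) \<and> t \<in> central C (h \<circ> k) id T \<and>
      s i = (\<lambda>y. \<gamma> y \<triangleright>\<^bsub>T\<^esub> t)"
    using s by (auto simp: right_terms_def Pi_iff)
  then obtain \<gamma> t where \<gamma>: "\<And>i. i \<in> {..<n} \<Longrightarrow> \<gamma> i \<in> bimod_end B C A h (h \<circ> k)"
    and t: "\<And>i. i \<in> {..<n} \<Longrightarrow> t i \<in> central C (h \<circ> k) id T"
    and s_eq: "\<And>i. i \<in> {..<n} \<Longrightarrow> s i = (\<lambda>y. \<gamma> i y \<triangleright>\<^bsub>T\<^esub> t i)"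
    by metis
  have "pure \<one> y = (\<Oplus>\<^bsub>T\<^esub>i\<in>{..<n}. \<gamma> i y \<triangleright>\<^bsub>T\<^esub> t i)" if y: "y \<in> carrier A" for y
    unfolding sum[OF y] using y s_eq bimod_endD(2)[OF \<gamma>] centralD(1)[OF t]
    by (intro T.finsum_cong') (auto intro!: TB.lact_closed)
  with \<gamma> t that show thesis by blast
qed

text \<open>Each pair \<open>\<gamma> i, t i\<close> is turned back into bimodule maps
  \<open>T \<rightarrow> A\<close> and \<open>A \<rightarrow> T\<close>. That the composites sum to
  the identity is the quasi-basis equation multiplied by \<open>x\<close> from the left, checked on
  \<open>x \<otimes> y\<close>.\<close>

lemma quasibasis_imp_right_D3_tower:
  assumes right_quasibasis
  shows "right_D3_tower C B A k h"
proof -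
  let ?V = "ring_bimod id A (h \<circ> k)"
  obtain n :: nat and \<gamma> t where \<gamma>': "\<And>i. i \<in> {..<n} \<Longrightarrow> \<gamma> i \<in> bimod_end B C A h (h \<circ> k)"
    and t': "\<And>i. i \<in> {..<n} \<Longrightarrow> t i \<in> central C (h \<circ> k) id T"
    and sum: "\<And>y. y \<in> carrier A \<Longrightarrow> pure \<one> y = (\<Oplus>\<^bsub>T\<^esub>i\<in>{..<n}. \<gamma> i y \<triangleright>\<^bsub>T\<^esub> t i)"
    by (rule right_quasibasis_E[OF assms]) (rule that)
  have \<gamma>: "\<gamma> i \<in> bimod_end B C A h (h \<circ> k)" and t: "t i \<in> central C (h \<circ> k) id T" if "i < n" for i
    using \<gamma>' t' that by simp_all
  have "\<forall>i\<in>{..<n}. \<exists>f\<in>add_hom T A. \<forall>x\<in>carrier A. \<forall>y\<in>carrier A. f (pure x y) = x \<otimes> \<gamma> i y"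
    using mult_lift[OF bimod_endD(1,3)[OF \<gamma>]] by simp
  then obtain f where f: "\<And>i. i < n \<Longrightarrow> f i \<in> add_hom T A"
    and f_pure: "\<And>i x y. \<lbrakk>i < n; x \<in> carrier A; y \<in> carrier A\<rbrakk> \<Longrightarrow> f i (pure x y) = x \<otimes> \<gamma> i y"
    by (metis lessThan_iff)
  have f_hom: "f i \<in> bimod_hom A C T ?V" if i: "i < n" for i
  proof -
    have fV: "f i \<in> add_hom T ?V" using f i by simp
    have "f i (a \<triangleright>\<^bsub>T\<^esub> u) = a \<triangleright>\<^bsub>?V\<^esub> f i u" if "a \<in> carrier A" "u \<in> carrier T" for a u
      by (rule tensor_left_linear[OF V.left_module_axioms fV _ that])
         (use i bimod_endD[OF \<gamma>[OF i]] in \<open>auto simp: f_pure h.S.m_assoc\<close>)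
    moreover have "f i (u \<triangleleft>\<^bsub>T\<^esub> c) = f i u \<triangleleft>\<^bsub>?V\<^esub> c" if "c \<in> carrier C" "u \<in> carrier T" for c u
      by (rule tensor_right_linear[OF V.right_module_axioms fV _ that])
         (use i bimod_endD[OF \<gamma>[OF i]] in \<open>auto simp: f_pure h.S.m_assoc\<close>)
    ultimately show ?thesis using fV by (simp add: left_hom_iff right_hom_iff)
  qed
  define g where "g i = (\<lambda>a. a \<triangleright>\<^bsub>T\<^esub> t i)" for i
  have g_hom: "g i \<in> bimod_hom A C ?V T" if i: "i < n" for i
  proof -
    have ti: "t i \<in> carrier T" "\<And>c. c \<in> carrier C \<Longrightarrow> h (k c) \<triangleright>\<^bsub>T\<^esub> t i = t i \<triangleleft>\<^bsub>T\<^esub> c"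
      using centralD[OF t[OF i]] by auto
    have "g i \<in> add_hom A T" using TB.lact_scalar_hom[OF ti(1)] by (simp add: g_def)
    then show ?thesis using ti
      by (auto simp: left_hom_iff right_hom_iff g_def TB.lact_assoc TB.lact_ract)
  qed
  have gi: "g i \<in> add_hom A T" if "i < n" for i using g_hom[OF that] by (simp add: left_hom_iff)
  have "u = (\<Oplus>\<^bsub>T\<^esub>i\<in>{..<n}. g i (f i u))" if u: "u \<in> carrier T" for u
  proof (rule T_eqI[of "\<lambda>u. u" _ u])
    show "(\<lambda>u. \<Oplus>\<^bsub>T\<^esub>i\<in>{..<n}. g i (f i u)) \<in> add_hom T T"
      by (intro add_hom_sum T.abelian_group_axioms add_hom_comp[OF f gi]) auto
    fix x y assume xy: "x \<in> carrier (ring_bimod id A h)" "y \<in> carrier (ring_bimod h A (h \<circ> k))"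
    have "pure x y = x \<triangleright>\<^bsub>T\<^esub> pure \<one> y" using xy by (simp add: lact_pure)
    also have "\<dots> = (\<Oplus>\<^bsub>T\<^esub>i\<in>{..<n}. x \<triangleright>\<^bsub>T\<^esub> (\<gamma> i y \<triangleright>\<^bsub>T\<^esub> t i))"
      unfolding sum[OF xy(2)[simplified]] using xy bimod_endD(2)[OF \<gamma>] centralD(1)[OF t]
      by (intro TB.lact_finsum TB.lact_closed) auto
    also have "\<dots> = (\<Oplus>\<^bsub>T\<^esub>i\<in>{..<n}. g i (f i (pure x y)))"
      using xy bimod_endD(2)[OF \<gamma>] centralD(1)[OF t]
      by (intro T.finsum_cong') (auto simp: g_def f_pure TB.lact_assoc TB.lact_closed)
    finally show "pure x y = (\<Oplus>\<^bsub>T\<^esub>i\<in>{..<n}. g i (f i (pure x y)))" .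
  qed (use u in \<open>auto simp: add_hom_def\<close>)
  moreover have "f \<in> {..<n} \<rightarrow> bimod_hom A C T ?V" "g \<in> {..<n} \<rightarrow> bimod_hom A C ?V T"
    using f_hom g_hom by blast+
  ultimately have TV: "bimod_divides A C T ?V"
    by (intro bimod_dividesI[OF tensor_bimodule V.bimodule_axioms, of f n g])
  \<comment> \<open>The reverse divisibility holds with a single copy: multiplication
    \<open>\<mu>\<close> is a bimodule map that splits
    \<open>a \<mapsto> a \<otimes> 1\<close>.\<close>
  obtain \<mu> where \<mu>: "\<mu> \<in> add_hom T A"
    and \<mu>_pure: "\<And>x y. \<lbrakk>x \<in> carrier A; y \<in> carrier A\<rbrakk> \<Longrightarrow> \<mu> (pure x y) = x \<otimes> y"
    using mult_lift[of "\<lambda>y. y"] by (auto simp: add_hom_def[of A A])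
  have \<mu>V: "\<mu> \<in> add_hom T ?V" using \<mu> by simp
  have \<mu>_hom: "\<mu> \<in> bimod_hom A C T ?V"
  proof -
    have "\<mu> (a \<triangleright>\<^bsub>T\<^esub> u) = a \<triangleright>\<^bsub>?V\<^esub> \<mu> u" if "a \<in> carrier A" "u \<in> carrier T" for a u
      by (rule tensor_left_linear[OF V.left_module_axioms \<mu>V _ that]) (auto simp: \<mu>_pure h.S.m_assoc)
    moreover have "\<mu> (u \<triangleleft>\<^bsub>T\<^esub> c) = \<mu> u \<triangleleft>\<^bsub>?V\<^esub> c" if "c \<in> carrier C" "u \<in> carrier T" for c u
      by (rule tensor_right_linear[OF V.right_module_axioms \<mu>V _ that]) (auto simp: \<mu>_pure h.S.m_assoc)
    ultimately show ?thesis using \<mu>V by (simp add: left_hom_iff right_hom_iff)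
  qed
  have \<iota>_hom: "(\<lambda>a. pure a \<one>) \<in> bimod_hom A C ?V T"
    using pure_hom_left[of "\<one>"] pure_mid[of "k c" for c]
    by (auto simp: left_hom_iff right_hom_iff lact_pure ract_pure)
  have "bimod_divides A C ?V T"
    by (rule bimod_dividesI[OF V.bimodule_axioms tensor_bimodule,
          of "\<lambda>_ a. pure a \<one>" 1 "\<lambda>_. \<mu>"])
       (use \<mu>_hom \<iota>_hom in \<open>auto simp: \<mu>_pure lessThan_Suc\<close>)
  with TV show ?thesis by (simp add: right_D3_tower_def bimod_similar_def)
qed

end

text \<open>Makes the quasi-basis theory of towers available for depth two, by taking an identity as
  the lower map of the tower.\<close>

lemma right_D2_eq_tower: "right_D2 B A h = right_D3_tower B B A id h"
  by (simp add: right_D2_def right_D3_tower_def)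

section \<open>Left quasi-bases of a ring extension\<close>

locale extension = h: ring_hom_ring B A h
  for B :: "('b, 'd) ring_scheme" and A :: "('a, 'f) ring_scheme" (structure) and h
begin

sublocale tensor_bimodules B B A "ring_bimod h A h" "ring_bimod h A id"
  by (intro tensor_bimodules.intro ring_bimod_bimodule ring_hom_ring_id h.S.ring_axioms
      h.ring_hom_ring_axioms)
sublocale TB: bimodule B A T by (rule tensor_bimodule)

lemma pure_mid: "\<lbrakk>b \<in> carrier B; x \<in> carrier A; y \<in> carrier A\<rbrakk> \<Longrightarrow>
    pure (x \<otimes> h b) y = pure x (h b \<otimes> y)"
  using pure_move[of x b y] by simp

definition "left_terms =
  {\<lambda>y. t \<triangleleft>\<^bsub>T\<^esub> \<gamma> y | \<gamma> t. \<gamma> \<in> bimod_end B B A h h \<and> t \<in> central B id h T}"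

lemma left_terms_closed: "left_terms \<subseteq> carrier A \<rightarrow> carrier T"
  by (auto simp: left_terms_def intro!: TB.ract_closed dest: centralD bimod_endD)

definition "left_quasibasis \<longleftrightarrow>
  finite_sum_of T (carrier A) left_terms (\<lambda>y. pure y \<one>)"

lemma balanced_mult:
  assumes "\<gamma> \<in> add_hom A A"
    and "\<And>b x. \<lbrakk>b \<in> carrier B; x \<in> carrier A\<rbrakk> \<Longrightarrow> \<gamma> (x \<otimes> h b) = \<gamma> x \<otimes> h b"
  shows "balanced B (ring_bimod h A h) (ring_bimod h A id) A (\<lambda>x y. \<gamma> x \<otimes> y)"
  using assms(2) add_hom_closed[OF assms(1)] unfolding balanced_def
  by (intro conjI ballI add_homI)
     (simp_all add: h.S.r_distr h.S.l_distr h.S.m_assoc add_hom_add[OF assms(1)])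

lemma mult_lift:
  assumes "\<gamma> \<in> add_hom A A"
    and "\<And>b x. \<lbrakk>b \<in> carrier B; x \<in> carrier A\<rbrakk> \<Longrightarrow> \<gamma> (x \<otimes> h b) = \<gamma> x \<otimes> h b"
  shows "\<exists>f\<in>add_hom T A. \<forall>x\<in>carrier A. \<forall>y\<in>carrier A. f (pure x y) = \<gamma> x \<otimes> y"
  using tensor_lift_exists[OF h.S.is_abelian_group balanced_mult[OF assms]]
  unfolding ring_bimod_simps .

text \<open>Mirror image of the right-hand case: \<open>f i\<close> sends
  \<open>x \<otimes> y\<close> to \<open>\<gamma>_i(x) y\<close>, \<open>g i\<close> sends
  \<open>a\<close> to \<open>t_i a\<close>, and the identity is the quasi-basis equation multiplied
  by \<open>y\<close> from the right. The reverse divisibility is again multiplication, now split by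
  \<open>a \<mapsto> 1 \<otimes> a\<close>.\<close>

lemma left_quasibasis_imp_left_D2:
  assumes left_quasibasis
  shows "left_D2 B A h"
proof -
  let ?V = "ring_bimod h A id"
  obtain n s where s: "s \<in> {..<n::nat} \<rightarrow> left_terms"
    and sum: "\<And>y. y \<in> carrier A \<Longrightarrow> pure y \<one> = (\<Oplus>\<^bsub>T\<^esub>i\<in>{..<n}. s i y)"
    using assms by (auto simp: left_quasibasis_def finite_sum_of_def)
  have "\<forall>i\<in>{..<n}. \<exists>\<gamma> t. \<gamma> \<in> bimod_end B B A h h \<and> t \<in> central B id h T \<and>
      s i = (\<lambda>y. t \<triangleleft>\<^bsub>T\<^esub> \<gamma> y)"
    using s by (auto simp: left_terms_def Pi_iff)
  then obtain \<gamma> t where \<gamma>: "\<And>i. i < n \<Longrightarrow> \<gamma> i \<in> bimod_end B B A h h"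
    and t: "\<And>i. i < n \<Longrightarrow> t i \<in> central B id h T"
    and s_eq: "\<And>i. i < n \<Longrightarrow> s i = (\<lambda>y. t i \<triangleleft>\<^bsub>T\<^esub> \<gamma> i y)"
    by (metis lessThan_iff)
  have "\<forall>i\<in>{..<n}. \<exists>f\<in>add_hom T A. \<forall>x\<in>carrier A. \<forall>y\<in>carrier A. f (pure x y) = \<gamma> i x \<otimes> y"
    using mult_lift[OF bimod_endD(1,4)[OF \<gamma>]] by simp
  then obtain f where f: "\<And>i. i < n \<Longrightarrow> f i \<in> add_hom T A"
    and f_pure: "\<And>i x y. \<lbrakk>i < n; x \<in> carrier A; y \<in> carrier A\<rbrakk> \<Longrightarrow> f i (pure x y) = \<gamma> i x \<otimes> y"
    by (metis lessThan_iff)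
  have f_hom: "f i \<in> bimod_hom B A T ?V" if i: "i < n" for i
  proof -
    have fV: "f i \<in> add_hom T ?V" using f i by simp
    have "f i (a \<triangleright>\<^bsub>T\<^esub> u) = a \<triangleright>\<^bsub>?V\<^esub> f i u" if "a \<in> carrier B" "u \<in> carrier T" for a u
      by (rule tensor_left_linear[OF N.left_module_axioms fV _ that])
         (use i bimod_endD[OF \<gamma>[OF i]] in \<open>auto simp: f_pure h.S.m_assoc\<close>)
    moreover have "f i (u \<triangleleft>\<^bsub>T\<^esub> c) = f i u \<triangleleft>\<^bsub>?V\<^esub> c" if "c \<in> carrier A" "u \<in> carrier T" for c u
      by (rule tensor_right_linear[OF N.right_module_axioms fV _ that])
         (use i bimod_endD[OF \<gamma>[OF i]] in \<open>auto simp: f_pure h.S.m_assoc\<close>)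
    ultimately show ?thesis using fV by (simp add: left_hom_iff right_hom_iff)
  qed
  define g where "g i = (\<lambda>a. t i \<triangleleft>\<^bsub>T\<^esub> a)" for i
  have g_hom: "g i \<in> bimod_hom B A ?V T" if i: "i < n" for i
  proof -
    have ti: "t i \<in> carrier T" "\<And>b. b \<in> carrier B \<Longrightarrow> t i \<triangleleft>\<^bsub>T\<^esub> h b = b \<triangleright>\<^bsub>T\<^esub> t i"
      using centralD[OF t[OF i]] by auto
    have "g i \<in> add_hom A T" using TB.ract_scalar_hom[OF ti(1)] by (simp add: g_def)
    then show ?thesis using ti
      by (auto simp: left_hom_iff right_hom_iff g_def TB.ract_assoc TB.lact_ract)
  qed
  have gi: "g i \<in> add_hom A T" if "i < n" for i using g_hom[OF that] by (simp add: left_hom_iff)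
  have "u = (\<Oplus>\<^bsub>T\<^esub>i\<in>{..<n}. g i (f i u))" if u: "u \<in> carrier T" for u
  proof (rule T_eqI[of "\<lambda>u. u" _ u])
    show "(\<lambda>u. \<Oplus>\<^bsub>T\<^esub>i\<in>{..<n}. g i (f i u)) \<in> add_hom T T"
      by (intro add_hom_sum T.abelian_group_axioms add_hom_comp[OF f gi]) auto
    fix x y assume xy: "x \<in> carrier (ring_bimod h A h)" "y \<in> carrier (ring_bimod h A id)"
    have "pure x y = pure x \<one> \<triangleleft>\<^bsub>T\<^esub> y" using xy by (simp add: ract_pure)
    also have "\<dots> = (\<Oplus>\<^bsub>T\<^esub>i\<in>{..<n}. (t i \<triangleleft>\<^bsub>T\<^esub> \<gamma> i x) \<triangleleft>\<^bsub>T\<^esub> y)"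
    proof -
      have "pure x \<one> = (\<Oplus>\<^bsub>T\<^esub>i\<in>{..<n}. t i \<triangleleft>\<^bsub>T\<^esub> \<gamma> i x)"
        unfolding sum[OF xy(1)[simplified]] using xy(1) s_eq bimod_endD(2)[OF \<gamma>] centralD(1)[OF t]
        by (intro T.finsum_cong') (auto intro!: TB.ract_closed)
      then show ?thesis
        using xy bimod_endD(2)[OF \<gamma>] centralD(1)[OF t]
        by (simp only:, intro TB.ract_finsum TB.ract_closed) auto
    qed
    also have "\<dots> = (\<Oplus>\<^bsub>T\<^esub>i\<in>{..<n}. g i (f i (pure x y)))"
      using xy bimod_endD(2)[OF \<gamma>] centralD(1)[OF t]
      by (intro T.finsum_cong') (auto simp: g_def f_pure TB.ract_assoc TB.ract_closed)
    finally show "pure x y = (\<Oplus>\<^bsub>T\<^esub>i\<in>{..<n}. g i (f i (pure x y)))" .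
  qed (use u in \<open>auto simp: add_hom_def\<close>)
  moreover have "f \<in> {..<n} \<rightarrow> bimod_hom B A T ?V" "g \<in> {..<n} \<rightarrow> bimod_hom B A ?V T"
    using f_hom g_hom by blast+
  ultimately have TV: "bimod_divides B A T ?V"
    by (intro bimod_dividesI[OF tensor_bimodule N.bimodule_axioms, of f n g])
  obtain \<mu> where \<mu>: "\<mu> \<in> add_hom T A"
    and \<mu>_pure: "\<And>x y. \<lbrakk>x \<in> carrier A; y \<in> carrier A\<rbrakk> \<Longrightarrow> \<mu> (pure x y) = x \<otimes> y"
    using mult_lift[of "\<lambda>y. y"] by (auto simp: add_hom_def[of A A])
  have \<mu>V: "\<mu> \<in> add_hom T ?V" using \<mu> by simp
  have \<mu>_hom: "\<mu> \<in> bimod_hom B A T ?V"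
  proof -
    have "\<mu> (a \<triangleright>\<^bsub>T\<^esub> u) = a \<triangleright>\<^bsub>?V\<^esub> \<mu> u" if "a \<in> carrier B" "u \<in> carrier T" for a u
      by (rule tensor_left_linear[OF N.left_module_axioms \<mu>V _ that]) (auto simp: \<mu>_pure h.S.m_assoc)
    moreover have "\<mu> (u \<triangleleft>\<^bsub>T\<^esub> c) = \<mu> u \<triangleleft>\<^bsub>?V\<^esub> c" if "c \<in> carrier A" "u \<in> carrier T" for c u
      by (rule tensor_right_linear[OF N.right_module_axioms \<mu>V _ that]) (auto simp: \<mu>_pure h.S.m_assoc)
    ultimately show ?thesis using \<mu>V by (simp add: left_hom_iff right_hom_iff)
  qed
  have \<iota>_hom: "(\<lambda>a. pure \<one> a) \<in> bimod_hom B A ?V T"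
    using pure_hom_right[of "\<one>"]
    by (auto simp: left_hom_iff right_hom_iff lact_pure ract_pure pure_mid[symmetric])
  have "bimod_divides B A ?V T"
    by (rule bimod_dividesI[OF N.bimodule_axioms tensor_bimodule,
          of "\<lambda>_ a. pure \<one> a" 1 "\<lambda>_. \<mu>"])
       (use \<mu>_hom \<iota>_hom in \<open>auto simp: \<mu>_pure lessThan_Suc\<close>)
  with TV show ?thesis by (simp add: left_D2_def bimod_similar_def)
qed

end

section \<open>Depth two and depth three for general towers\<close>

context tower
begin

lemma right_term_sum:
  assumes "finite I" "\<And>i. i \<in> I \<Longrightarrow> finite_sum_of T (carrier A) right_terms (w i)"
    and "\<And>y. y \<in> carrier A \<Longrightarrow> v y = (\<Oplus>\<^bsub>T\<^esub>i\<in>I. w i y)"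
  shows "finite_sum_of T (carrier A) right_terms v"
  by (rule finite_sum_of_cong[OF finite_sum_of_finsum[OF T.abelian_group_axioms right_terms_closed
          assms(1,2)] assms(3)])

lemma right_term_base:
  "\<lbrakk>\<gamma> \<in> bimod_end B C A h (h \<circ> k); t \<in> central C (h \<circ> k) id T\<rbrakk> \<Longrightarrow>
    finite_sum_of T (carrier A) right_terms (\<lambda>y. \<gamma> y \<triangleright>\<^bsub>T\<^esub> t)"
  by (rule finite_sum_of_base[OF T.abelian_group_axioms right_terms_closed])
     (unfold right_terms_def, intro CollectI exI[of _ \<gamma>] exI[of _ t] conjI refl)

end

context tower
begin

text \<open>Two tensor products are in play from here on: \<open>T\<close> is taken over
  \<open>B\<close> and \<open>R.T\<close> over the smaller ring \<open>C\<close>, and likewise for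
  \<open>pure\<close> and \<open>R.pure\<close>.\<close>

interpretation R: tower C C A id "h \<circ> k" rewrites "h \<circ> k \<circ> id = h \<circ> k"
  by (intro tower.intro ring_hom_ring_id k.R.ring_axioms hk.ring_hom_ring_axioms) simp

lemma right_D2_iff_quasibasis: "right_D2 C A (h \<circ> k) \<longleftrightarrow> R.right_quasibasis"
  unfolding right_D2_eq_tower
  using R.right_D3_tower_imp_quasibasis R.quasibasis_imp_right_D3_tower by blast

text \<open>A depth two quasi-basis lives over \<open>C\<close> and must be made linear over
  \<open>B\<close>. Its tensors are pushed along the canonical surjection from
  \<open>A \<otimes> A\<close> over \<open>C\<close> onto that over \<open>B\<close>; its
  endomorphisms are averaged with the separability element, as in the averaging proof of Maschke's
  theorem.\<close>

theorem separable_right_D2_imp_right_D3: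
  assumes sep: "separable_extension C B k" and D2: "right_D2 C A (h \<circ> k)"
  shows "right_D3_tower C B A k h"
proof (rule quasibasis_imp_right_D3_tower)
  interpret S: tensor_bimodules B C B "ring_bimod id B k" "ring_bimod k B id"
    by (intro tensor_bimodules.intro ring_bimod_bimodule ring_hom_ring_id k.S.ring_axioms
        k.ring_hom_ring_axioms)
  interpret SB: bimodule B B S.T by (rule S.tensor_bimodule)
  obtain n :: nat and \<gamma> t where
    \<gamma>: "\<And>i. i \<in> {..<n} \<Longrightarrow> \<gamma> i \<in> bimod_end C C A (h \<circ> k) (h \<circ> k)" and
    t: "\<And>i. i \<in> {..<n} \<Longrightarrow> t i \<in> central C (h \<circ> k) id R.T" and
    D2_sum: "\<And>y. y \<in> carrier A \<Longrightarrow> R.pure \<one> y = (\<Oplus>\<^bsub>R.T\<^esub>i\<in>{..<n}. \<gamma> i y \<triangleright>\<^bsub>R.T\<^esub> t i)"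
    by (rule R.right_quasibasis_E[OF D2[unfolded right_D2_iff_quasibasis]]) (rule that)
  obtain m :: nat and x y where x: "x \<in> {..<m} \<rightarrow> carrier B" and y: "y \<in> {..<m} \<rightarrow> carrier B"
    and xy: "(\<Oplus>\<^bsub>B\<^esub>q\<in>{..<m}. x q \<otimes>\<^bsub>B\<^esub> y q) = \<one>\<^bsub>B\<^esub>"
    and comm: "\<And>b. b \<in> carrier B \<Longrightarrow> b \<triangleright>\<^bsub>S.T\<^esub> (\<Oplus>\<^bsub>S.T\<^esub>q\<in>{..<m}. S.pure (x q) (y q)) =
      (\<Oplus>\<^bsub>S.T\<^esub>q\<in>{..<m}. S.pure (x q) (y q)) \<triangleleft>\<^bsub>S.T\<^esub> b"
    using sep unfolding separable_extension_def Let_def by blast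
  have xB: "x q \<in> carrier B" and yB: "y q \<in> carrier B" if "q \<in> {..<m}" for q
    using that x y by auto
  \<comment> \<open>A tensor sign over \<open>B\<close> is in particular balanced over
    \<open>C\<close>; this yields the canonical map \<open>\<pi>\<close>.\<close>
  have "balanced C (ring_bimod id A (h \<circ> k)) (ring_bimod (h \<circ> k) A (h \<circ> k)) T pure"
    using pure_hom_left pure_hom_right by (auto simp: balanced_def pure_mid)
  then obtain \<pi> where \<pi>: "\<pi> \<in> add_hom R.T T"
    and \<pi>_pure: "\<And>u v. \<lbrakk>u \<in> carrier A; v \<in> carrier A\<rbrakk> \<Longrightarrow> \<pi> (R.pure u v) = pure u v"
    using R.tensor_lift_exists[OF T.abelian_group_axioms, of pure] by auto
  have \<pi>_l: "\<pi> (a \<triangleright>\<^bsub>R.T\<^esub> u) = a \<triangleright>\<^bsub>T\<^esub> \<pi> u" if "a \<in> carrier A" "u \<in> carrier R.T" for a u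
    by (rule R.tensor_left_linear[OF TB.left_module_axioms \<pi> _ that]) (auto simp: \<pi>_pure lact_pure)
  have \<pi>_r: "\<pi> (u \<triangleleft>\<^bsub>R.T\<^esub> c) = \<pi> u \<triangleleft>\<^bsub>T\<^esub> c" if "c \<in> carrier C" "u \<in> carrier R.T" for c u
    by (rule R.tensor_right_linear[OF TB.right_module_axioms \<pi> _ that]) (auto simp: \<pi>_pure ract_pure)
  have tT: "t i \<in> carrier R.T" if "i \<in> {..<n}" for i using centralD(1)[OF t[OF that]] .
  have \<pi>t: "\<pi> (t i) \<in> carrier T" if "i \<in> {..<n}" for i using add_hom_closed[OF \<pi> tT[OF that]] .
  have central: "\<pi> (t i) \<in> central C (h \<circ> k) id T" if i: "i \<in> {..<n}" for i
  proof -
    have "h (k c) \<triangleright>\<^bsub>T\<^esub> \<pi> (t i) = \<pi> (t i) \<triangleleft>\<^bsub>T\<^esub> c" if "c \<in> carrier C" for c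
      using \<pi>_l[of "h (k c)" "t i"] \<pi>_r[of c "t i"] centralD(2)[OF t[OF i] that] that tT[OF i] by simp
    with \<pi>t[OF i] show ?thesis by (simp add: central_def)
  qed
  note \<gamma>D = bimod_endD[OF \<gamma>]
  \<comment> \<open>The average of \<open>\<gamma> i\<close> over the separability element: left
    \<open>C\<close>-linearity of \<open>\<gamma> i\<close> makes the expression balanced over
    \<open>C\<close>, and centrality of the element makes the sum left
    \<open>B\<close>-linear.\<close>
  define \<beta> where "\<beta> i a = (\<Oplus>q\<in>{..<m}. h (x q) \<otimes> \<gamma> i (h (y q) \<otimes> a))" for i a
  have \<beta>: "\<beta> i \<in> bimod_end B C A h (h \<circ> k)" if i: "i \<in> {..<n}" for i
  proof -
    note [simp] = \<gamma>D(2)[OF i] xB yB add_hom_add[OF \<gamma>D(1)[OF i]]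
    have "\<beta> i \<in> add_hom A A"
      unfolding \<beta>_def
      by (intro add_hom_sum h.S.is_abelian_group add_homI) (simp_all add: h.S.r_distr)
    moreover have "\<beta> i (h b \<otimes> a) = h b \<otimes> \<beta> i a" if b: "b \<in> carrier B" and a: "a \<in> carrier A" for b a
    proof -
      have c_move: "h q \<otimes> (h (k c) \<otimes> \<gamma> i (h r \<otimes> a)) = h q \<otimes> \<gamma> i (h (k c) \<otimes> (h r \<otimes> a))"
        if "q \<in> carrier B" "r \<in> carrier B" "c \<in> carrier C" for q r c
        using \<gamma>D(3)[OF i, of c "h r \<otimes> a"] that a by simp
      \<comment> \<open>For fixed \<open>a\<close> the summands of \<open>\<beta> i a\<close> are
        values of one additive map \<open>\<Phi>\<close> on \<open>B \<otimes> B\<close> over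
        \<open>C\<close>. Through \<open>\<Phi>\<close> the relation \<open>b e = e b\<close>, known
        only inside that tensor product, becomes an equation in \<open>A\<close>.\<close>
      have bal: "balanced C (ring_bimod id B k) (ring_bimod k B id) A
          (\<lambda>p q. h p \<otimes> \<gamma> i (h q \<otimes> a))"
        using a unfolding balanced_def
        by (intro conjI ballI add_homI)
           (simp_all add: h.S.r_distr h.S.l_distr h.S.m_assoc c_move)
      obtain \<Phi> where \<Phi>: "\<Phi> \<in> add_hom S.T A"
        and \<Phi>_pure: "\<And>p q. \<lbrakk>p \<in> carrier B; q \<in> carrier B\<rbrakk> \<Longrightarrow>
          \<Phi> (S.pure p q) = h p \<otimes> \<gamma> i (h q \<otimes> a)"
        using S.tensor_lift_exists[OF h.S.is_abelian_group bal] unfolding ring_bimod_simps by blast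
      have "h b \<otimes> \<beta> i a = (\<Oplus>q\<in>{..<m}. h b \<otimes> (h (x q) \<otimes> \<gamma> i (h (y q) \<otimes> a)))"
        unfolding \<beta>_def using a b by (intro h.S.finsum_rdistr) auto
      also have "\<dots> = (\<Oplus>q\<in>{..<m}. \<Phi> (b \<triangleright>\<^bsub>S.T\<^esub> S.pure (x q) (y q)))"
        using a b by (intro h.S.finsum_cong')
          (auto simp: S.lact_pure \<Phi>_pure h.S.m_assoc)
      also have "\<dots> = \<Phi> (\<Oplus>\<^bsub>S.T\<^esub>q\<in>{..<m}. b \<triangleright>\<^bsub>S.T\<^esub> S.pure (x q) (y q))"
        using b by (intro add_hom_finsum[symmetric, OF S.T.abelian_group_axioms h.S.is_abelian_group \<Phi>])
          (auto simp: SB.lact_closed)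
      also have "(\<Oplus>\<^bsub>S.T\<^esub>q\<in>{..<m}. b \<triangleright>\<^bsub>S.T\<^esub> S.pure (x q) (y q))
          = (\<Oplus>\<^bsub>S.T\<^esub>q\<in>{..<m}. S.pure (x q) (y q) \<triangleleft>\<^bsub>S.T\<^esub> b)"
        using comm[OF b] b by (subst (asm) SB.lact_finsum, simp_all,
            subst (asm) SB.ract_finsum) simp_all
      also have "\<Phi> \<dots> = (\<Oplus>q\<in>{..<m}. \<Phi> (S.pure (x q) (y q) \<triangleleft>\<^bsub>S.T\<^esub> b))"
        using b by (intro add_hom_finsum[OF S.T.abelian_group_axioms h.S.is_abelian_group \<Phi>])
          (auto simp: SB.ract_closed)
      also have "\<dots> = \<beta> i (h b \<otimes> a)"
        unfolding \<beta>_def using a b by (intro h.S.finsum_cong')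
          (auto simp: S.ract_pure \<Phi>_pure h.S.m_assoc)
      finally show ?thesis by simp
    qed
    moreover have "\<beta> i (a \<otimes> h (k c)) = \<beta> i a \<otimes> h (k c)" if c: "c \<in> carrier C" and a: "a \<in> carrier A" for c a
    proof -
      have r: "\<gamma> i (h q \<otimes> (a \<otimes> h (k c))) = \<gamma> i (h q \<otimes> a) \<otimes> h (k c)"
        if "q \<in> carrier B" for q
        using that a c \<gamma>D(4)[OF i, of c "h q \<otimes> a"] by (simp add: h.S.m_assoc)
      have "\<beta> i (a \<otimes> h (k c))
          = (\<Oplus>q\<in>{..<m}. h (x q) \<otimes> \<gamma> i (h (y q) \<otimes> a) \<otimes> h (k c))"
        unfolding \<beta>_def using a c
        by (intro h.S.finsum_cong') (auto simp: h.S.m_assoc r)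
      also have "\<dots> = \<beta> i a \<otimes> h (k c)"
        unfolding \<beta>_def using a c by (intro h.S.finsum_ldistr[symmetric]) auto
      finally show ?thesis .
    qed
    ultimately show ?thesis by (simp add: bimod_end_iff)
  qed
  show right_quasibasis
    unfolding right_quasibasis_def
  proof (rule right_term_sum)
    show "finite {..<n}" by simp
    show "finite_sum_of T (carrier A) right_terms (\<lambda>a. \<beta> i a \<triangleright>\<^bsub>T\<^esub> \<pi> (t i))" if "i \<in> {..<n}" for i
      by (rule right_term_base[OF \<beta>[OF that] central[OF that]])
    fix a assume a: "a \<in> carrier A"
    note [simp] = xB yB \<gamma>D(2)
    \<comment> \<open>The unit is replaced by \<open>\<Sum>q. x_q y_q\<close>, the other property of
      the separability element.\<close>
    have "pure \<one> a = pure (h (\<Oplus>\<^bsub>B\<^esub>q\<in>{..<m}. x q \<otimes>\<^bsub>B\<^esub> y q)) a" by (simp add: xy)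
    also have "h (\<Oplus>\<^bsub>B\<^esub>q\<in>{..<m}. x q \<otimes>\<^bsub>B\<^esub> y q) = (\<Oplus>q\<in>{..<m}. h (x q \<otimes>\<^bsub>B\<^esub> y q))"
      by (intro add_hom_finsum[OF k.S.is_abelian_group h.S.is_abelian_group])
         (auto simp: add_hom_def)
    also have "pure \<dots> a = (\<Oplus>\<^bsub>T\<^esub>q\<in>{..<m}. pure (h (x q \<otimes>\<^bsub>B\<^esub> y q)) a)"
      using a pure_hom_left[of a]
      by (intro add_hom_finsum[of A T "\<lambda>u. pure u a"] h.S.is_abelian_group T.abelian_group_axioms)
         simp_all
    also have "\<dots> = (\<Oplus>\<^bsub>T\<^esub>q\<in>{..<m}. \<Oplus>\<^bsub>T\<^esub>i\<in>{..<n}.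
        (h (x q) \<otimes> \<gamma> i (h (y q) \<otimes> a)) \<triangleright>\<^bsub>T\<^esub> \<pi> (t i))"
    proof (rule T.finsum_cong'[OF refl])
      show "(\<lambda>q. \<Oplus>\<^bsub>T\<^esub>i\<in>{..<n}. (h (x q) \<otimes> \<gamma> i (h (y q) \<otimes> a)) \<triangleright>\<^bsub>T\<^esub> \<pi> (t i)) \<in> {..<m} \<rightarrow> carrier T"
        using a \<pi>t by (auto intro!: T.finsum_closed TB.lact_closed)
      fix q assume q: "q \<in> {..<m}"
      let ?z = "h (y q) \<otimes> a"
      have z: "?z \<in> carrier A" using q a by (simp)
      \<comment> \<open>Over \<open>B\<close> the factor \<open>h (y q)\<close> may cross to
        \<open>a\<close>, while \<open>h (x q)\<close> stays as an outer left action. The depth two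
        equation is then applied to \<open>h (y q) \<otimes> a\<close> and carried over by
        \<open>\<pi>\<close>.\<close>
      have "pure (h (x q \<otimes>\<^bsub>B\<^esub> y q)) a = h (x q) \<triangleright>\<^bsub>T\<^esub> pure \<one> ?z"
        using q a by (simp add: pure_mid lact_pure)
      also have "pure \<one> ?z = \<pi> (R.pure \<one> ?z)" using z by (simp add: \<pi>_pure)
      also have "\<dots> = (\<Oplus>\<^bsub>T\<^esub>i\<in>{..<n}. \<pi> (\<gamma> i ?z \<triangleright>\<^bsub>R.T\<^esub> t i))"
        unfolding D2_sum[OF z] using z tT
        by (intro add_hom_finsum[OF R.T.abelian_group_axioms T.abelian_group_axioms \<pi>] R.TB.lact_closed)
           (auto)
      also have "h (x q) \<triangleright>\<^bsub>T\<^esub> \<dots> = (\<Oplus>\<^bsub>T\<^esub>i\<in>{..<n}. h (x q) \<triangleright>\<^bsub>T\<^esub> \<pi> (\<gamma> i ?z \<triangleright>\<^bsub>R.T\<^esub> t i))"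
        using q z tT add_hom_closed[OF \<pi>]
        by (intro TB.lact_finsum) (auto simp: R.TB.lact_closed)
      also have "\<dots> = (\<Oplus>\<^bsub>T\<^esub>i\<in>{..<n}. (h (x q) \<otimes> \<gamma> i ?z) \<triangleright>\<^bsub>T\<^esub> \<pi> (t i))"
        using q z tT \<pi>t
        by (intro T.finsum_cong') (auto simp: \<pi>_l TB.lact_assoc TB.lact_closed)
      finally show "pure (h (x q \<otimes>\<^bsub>B\<^esub> y q)) a = \<dots>" .
    qed
    also have "\<dots> = (\<Oplus>\<^bsub>T\<^esub>i\<in>{..<n}. \<Oplus>\<^bsub>T\<^esub>q\<in>{..<m}.
        (h (x q) \<otimes> \<gamma> i (h (y q) \<otimes> a)) \<triangleright>\<^bsub>T\<^esub> \<pi> (t i))"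
      using a \<pi>t by (intro T.finsum_swap TB.lact_closed) (auto)
    also have "\<dots> = (\<Oplus>\<^bsub>T\<^esub>i\<in>{..<n}. \<beta> i a \<triangleright>\<^bsub>T\<^esub> \<pi> (t i))"
    proof (rule T.finsum_cong'[OF refl])
      show "(\<lambda>i. \<beta> i a \<triangleright>\<^bsub>T\<^esub> \<pi> (t i)) \<in> {..<n} \<rightarrow> carrier T"
        using a \<pi>t bimod_endD(2)[OF \<beta>] by (auto intro!: TB.lact_closed)
      fix i assume i: "i \<in> {..<n}"
      show "(\<Oplus>\<^bsub>T\<^esub>q\<in>{..<m}. (h (x q) \<otimes> \<gamma> i (h (y q) \<otimes> a)) \<triangleright>\<^bsub>T\<^esub> \<pi> (t i)) = \<beta> i a \<triangleright>\<^bsub>T\<^esub> \<pi> (t i)"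
        unfolding \<beta>_def using i a \<pi>t
        by (intro TB.scalar_lact_finsum[symmetric]) (auto)
    qed
    finally show "pure \<one> a = (\<Oplus>\<^bsub>T\<^esub>i\<in>{..<n}. \<beta> i a \<triangleright>\<^bsub>T\<^esub> \<pi> (t i))" .
  qed
qed

text \<open>The data say that \<open>A \<otimes> A\<close> over \<open>C\<close> divides the
  threefold tensor product of \<open>A\<close> over \<open>B\<close>, without forming the latter:
  \<open>u \<otimes> y \<mapsto> u \<otimes> e_j \<otimes> y\<close> is well defined over
  \<open>C\<close> by \<open>e_comm\<close>, \<open>u \<otimes> t \<mapsto> u \<theta>_j(t)\<close>
  is well defined over \<open>B\<close> by \<open>\<theta>_l\<close>, and \<open>sum\<close> says
  that the composites add up to the identity. Two applications of depth three then reduce the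
  threefold product to \<open>A\<close>.\<close>

theorem right_D3_imp_right_D2:
  assumes D3: "right_D3_tower C B A k h"
    and J: "finite J" and e: "\<And>j. j \<in> J \<Longrightarrow> e j \<in> carrier A"
    and e_comm: "\<And>j c. \<lbrakk>j \<in> J; c \<in> carrier C\<rbrakk> \<Longrightarrow> e j \<otimes> h (k c) = h (k c) \<otimes> e j"
    and \<theta>: "\<And>j. j \<in> J \<Longrightarrow> \<theta> j \<in> add_hom T R.T"
    and \<theta>_l: "\<And>j b u. \<lbrakk>j \<in> J; b \<in> carrier B; u \<in> carrier T\<rbrakk> \<Longrightarrow>
      \<theta> j (h b \<triangleright>\<^bsub>T\<^esub> u) = h b \<triangleright>\<^bsub>R.T\<^esub> \<theta> j u"
    and \<theta>_r: "\<And>j c u. \<lbrakk>j \<in> J; c \<in> carrier C; u \<in> carrier T\<rbrakk> \<Longrightarrow>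
      \<theta> j (u \<triangleleft>\<^bsub>T\<^esub> c) = \<theta> j u \<triangleleft>\<^bsub>R.T\<^esub> c"
    and sum: "\<And>y. y \<in> carrier A \<Longrightarrow> R.pure \<one> y = (\<Oplus>\<^bsub>R.T\<^esub>j\<in>J. \<theta> j (pure (e j) y))"
  shows "right_D2 C A (h \<circ> k)"
  unfolding right_D2_iff_quasibasis R.right_quasibasis_def
proof -
  obtain n :: nat and \<gamma> t where
    \<gamma>: "\<And>i. i \<in> {..<n} \<Longrightarrow> \<gamma> i \<in> bimod_end B C A h (h \<circ> k)" and
    t: "\<And>i. i \<in> {..<n} \<Longrightarrow> t i \<in> central C (h \<circ> k) id T" and
    D3_sum: "\<And>y. y \<in> carrier A \<Longrightarrow> pure \<one> y = (\<Oplus>\<^bsub>T\<^esub>i\<in>{..<n}. \<gamma> i y \<triangleright>\<^bsub>T\<^esub> t i)"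
    by (rule right_quasibasis_E[OF right_D3_tower_imp_quasibasis[OF D3]]) (rule that)
  let ?I = "{..<n}"
  note \<gamma>D = bimod_endD[OF \<gamma>]
  have tT: "t i \<in> carrier T" if "i \<in> ?I" for i using centralD(1)[OF t[OF that]] .
  note \<theta>_closed = add_hom_closed[OF \<theta>]
  \<comment> \<open>The first use of depth three replaces the last two factors of the threefold
    product by multiples of \<open>t i\<close>. What remains of the retraction is the map
    \<open>u \<otimes> z \<mapsto> u \<theta>_j(z t_i)\<close> on a twofold product, and that is
    where the second use applies.\<close>
  have "\<exists>\<Psi>\<in>add_hom T R.T. \<forall>u\<in>carrier A. \<forall>z\<in>carrier A.
      \<Psi> (pure u z) = u \<triangleright>\<^bsub>R.T\<^esub> \<theta> j (z \<triangleright>\<^bsub>T\<^esub> t i)" if j: "j \<in> J" and i: "i \<in> ?I" for j i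
  proof -
    let ?\<phi> = "\<lambda>u z. u \<triangleright>\<^bsub>R.T\<^esub> \<theta> j (z \<triangleright>\<^bsub>T\<^esub> t i)"
    have clos: "\<theta> j (z \<triangleright>\<^bsub>T\<^esub> t i) \<in> carrier R.T" if "z \<in> carrier A" for z
      using j that tT[OF i] by (simp add: \<theta>_closed TB.lact_closed)
    have "balanced B (ring_bimod id A h) (ring_bimod h A (h \<circ> k)) R.T ?\<phi>"
      unfolding balanced_def add_hom_ring_bimod ring_bimod_simps
    proof (intro conjI ballI)
      fix u assume u: "u \<in> carrier A"
      have "(\<lambda>z. \<theta> j (z \<triangleright>\<^bsub>T\<^esub> t i)) \<in> add_hom A R.T"
        by (rule add_hom_comp[OF TB.lact_scalar_hom[OF tT[OF i]] \<theta>[OF j]])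
      from add_hom_comp[OF this R.TB.lact_hom[OF u]] show "?\<phi> u \<in> add_hom A R.T" .
    next
      fix z assume "z \<in> carrier A"
      then show "(\<lambda>u. ?\<phi> u z) \<in> add_hom A R.T"
        by (intro R.TB.lact_scalar_hom clos)
    next
      fix u b z assume "u \<in> carrier A" "b \<in> carrier B" "z \<in> carrier A"
      then show "?\<phi> (u \<otimes> h b) z = ?\<phi> u (h b \<otimes> z)"
        using j tT[OF i] clos by (simp add: TB.lact_assoc R.TB.lact_assoc \<theta>_l TB.lact_closed)
    qed
    from tensor_lift_exists[OF R.T.abelian_group_axioms this] show ?thesis
      unfolding ring_bimod_simps .
  qed
  then obtain \<Psi> where \<Psi>: "\<And>j i. \<lbrakk>j \<in> J; i \<in> ?I\<rbrakk> \<Longrightarrow> \<Psi> j i \<in> add_hom T R.T"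
    and \<Psi>_pure: "\<And>j i u z. \<lbrakk>j \<in> J; i \<in> ?I; u \<in> carrier A; z \<in> carrier A\<rbrakk> \<Longrightarrow>
      \<Psi> j i (pure u z) = u \<triangleright>\<^bsub>R.T\<^esub> \<theta> j (z \<triangleright>\<^bsub>T\<^esub> t i)"
    by metis
  note \<Psi>_closed = add_hom_closed[OF \<Psi>]
  have \<Psi>_l: "\<Psi> j i (a \<triangleright>\<^bsub>T\<^esub> u) = a \<triangleright>\<^bsub>R.T\<^esub> \<Psi> j i u"
    if ji: "j \<in> J" "i \<in> ?I" and au: "a \<in> carrier A" "u \<in> carrier T" for j i a u
    by (rule tensor_left_linear[OF R.TB.left_module_axioms \<Psi>[OF ji] _ au])
       (use ji tT in \<open>auto simp: \<Psi>_pure R.TB.lact_assoc \<theta>_closed TB.lact_closed\<close>)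
  have \<Psi>_r: "\<Psi> j i (u \<triangleleft>\<^bsub>T\<^esub> c) = \<Psi> j i u \<triangleleft>\<^bsub>R.T\<^esub> c"
    if ji: "j \<in> J" "i \<in> ?I" and cu: "c \<in> carrier C" "u \<in> carrier T" for j i c u
  proof (rule tensor_right_linear[OF R.TB.right_module_axioms \<Psi>[OF ji] _ cu])
    fix c u z assume *: "c \<in> carrier C" "u \<in> carrier (ring_bimod id A h)"
      "z \<in> carrier (ring_bimod h A (h \<circ> k))"
    \<comment> \<open>Centrality of \<open>t i\<close> brings the scalar of \<open>C\<close> to the
      far right, where \<open>\<theta>_r\<close> applies.\<close>
    have "(z \<otimes> h (k c)) \<triangleright>\<^bsub>T\<^esub> t i = (z \<triangleright>\<^bsub>T\<^esub> t i) \<triangleleft>\<^bsub>T\<^esub> c"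
      using * tT[OF ji(2)] centralD(2)[OF t[OF ji(2)] *(1)]
      by (simp add: TB.lact_assoc TB.lact_ract)
    then show "\<Psi> j i (pure u (z \<triangleleft>\<^bsub>ring_bimod h A (h \<circ> k)\<^esub> c)) = \<Psi> j i (pure u z) \<triangleleft>\<^bsub>R.T\<^esub> c"
      using * ji tT[OF ji(2)]
      by (simp add: \<Psi>_pure \<theta>_r TB.lact_closed R.TB.lact_ract \<theta>_closed)
  qed
  have \<Psi>_central: "\<Psi> j i (t l) \<in> central C (h \<circ> k) id R.T" if "j \<in> J" "i \<in> ?I" "l \<in> ?I" for j i l
  proof -
    have "h (k c) \<triangleright>\<^bsub>R.T\<^esub> \<Psi> j i (t l) = \<Psi> j i (t l) \<triangleleft>\<^bsub>R.T\<^esub> c" if c: "c \<in> carrier C" for c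
      using \<Psi>_l[of j i "h (k c)" "t l"] \<Psi>_r[of j i c "t l"] centralD(2)[OF t[OF \<open>l \<in> ?I\<close>] c]
        c tT[OF \<open>l \<in> ?I\<close>] \<open>j \<in> J\<close> \<open>i \<in> ?I\<close> by simp
    then show ?thesis using \<Psi>_closed that tT by (simp add: central_def)
  qed
  \<comment> \<open>The endomorphisms of the two applications, with multiplication by
    \<open>e j\<close> between them. The partner of \<open>\<beta> j i l\<close> will be the tensor
    \<open>\<Psi> j i (t l)\<close>.\<close>
  define \<beta> where "\<beta> j i l y = \<gamma> l (e j \<otimes> \<gamma> i y)" for j i l y
  have \<beta>: "\<beta> j i l \<in> bimod_end C C A (h \<circ> k) (h \<circ> k)" if ijl: "j \<in> J" "i \<in> ?I" "l \<in> ?I" for j i l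
  proof -
    note [simp] = e[OF ijl(1)] \<gamma>D(2)[OF ijl(2)] \<gamma>D(2)[OF ijl(3)]
      add_hom_add[OF \<gamma>D(1)[OF ijl(2)]] add_hom_add[OF \<gamma>D(1)[OF ijl(3)]]
    have "\<beta> j i l \<in> add_hom A A"
      unfolding \<beta>_def by (rule add_homI) (simp_all add: h.S.r_distr)
    moreover have "\<beta> j i l (h (k c) \<otimes> y) = h (k c) \<otimes> \<beta> j i l y"
      if c: "c \<in> carrier C" and y: "y \<in> carrier A" for c y
    proof -
      \<comment> \<open>Left multiplication by \<open>e j\<close> is left \<open>C\<close>-linear
        because \<open>e j\<close> commutes with the image of \<open>C\<close>.\<close>
      have "e j \<otimes> \<gamma> i (h (k c) \<otimes> y) = h (k c) \<otimes> (e j \<otimes> \<gamma> i y)"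
        using c y \<gamma>D(3)[OF ijl(2), of "k c" y] e_comm[OF ijl(1) c]
        by (simp add: h.S.m_assoc[symmetric])
      then show ?thesis
        using c y \<gamma>D(3)[OF ijl(3), of "k c" "e j \<otimes> \<gamma> i y"] by (simp add: \<beta>_def)
    qed
    moreover have "\<beta> j i l (y \<otimes> h (k c)) = \<beta> j i l y \<otimes> h (k c)"
      if c: "c \<in> carrier C" and y: "y \<in> carrier A" for c y
      using c y \<gamma>D(4)[OF ijl(2) c y] \<gamma>D(4)[OF ijl(3) c, of "e j \<otimes> \<gamma> i y"]
      by (simp add: \<beta>_def h.S.m_assoc)
    ultimately show ?thesis by (simp add: bimod_end_iff)
  qed
  note \<beta>_closed = bimod_endD(2)[OF \<beta>]
  have term_closed: "\<beta> j i l y \<triangleright>\<^bsub>R.T\<^esub> \<Psi> j i (t l) \<in> carrier R.T"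
    if "j \<in> J" "i \<in> ?I" "l \<in> ?I" "y \<in> carrier A" for j i l y
    using that \<beta>_closed \<Psi>_closed tT by (intro R.TB.lact_closed) auto
  \<comment> \<open>Second use of depth three, on \<open>1 \<otimes> z\<close> and carried over by
    the left \<open>A\<close>-linear map \<open>\<Psi> j i\<close>.\<close>
  have \<Psi>_one: "\<Psi> j i (pure \<one> z) = (\<Oplus>\<^bsub>R.T\<^esub>l\<in>?I. \<gamma> l z \<triangleright>\<^bsub>R.T\<^esub> \<Psi> j i (t l))"
    if ji: "j \<in> J" "i \<in> ?I" and z: "z \<in> carrier A" for j i z
  proof -
    have "\<Psi> j i (pure \<one> z) = (\<Oplus>\<^bsub>R.T\<^esub>l\<in>?I. \<Psi> j i (\<gamma> l z \<triangleright>\<^bsub>T\<^esub> t l))"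
      unfolding D3_sum[OF z] using z \<gamma>D(2) tT
      by (intro add_hom_finsum[OF T.abelian_group_axioms R.T.abelian_group_axioms \<Psi>[OF ji]]
          TB.lact_closed) auto
    also have "\<dots> = (\<Oplus>\<^bsub>R.T\<^esub>l\<in>?I. \<gamma> l z \<triangleright>\<^bsub>R.T\<^esub> \<Psi> j i (t l))"
      using z ji \<gamma>D(2) tT \<Psi>_closed[OF ji]
      by (intro R.T.finsum_cong' refl) (auto simp: \<Psi>_l intro!: R.TB.lact_closed)
    finally show ?thesis .
  qed
  show "finite_sum_of R.T (carrier A) R.right_terms (R.pure \<one>)"
  proof (rule R.right_term_sum[OF J])
    fix j assume j: "j \<in> J"
    show "finite_sum_of R.T (carrier A) R.right_terms
      (\<lambda>y. \<Oplus>\<^bsub>R.T\<^esub>i\<in>?I. \<Oplus>\<^bsub>R.T\<^esub>l\<in>?I. \<beta> j i l y \<triangleright>\<^bsub>R.T\<^esub> \<Psi> j i (t l))"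
    proof (rule R.right_term_sum[of ?I, OF _ _ refl])
      fix i assume i: "i \<in> ?I"
      show "finite_sum_of R.T (carrier A) R.right_terms
        (\<lambda>y. \<Oplus>\<^bsub>R.T\<^esub>l\<in>?I. \<beta> j i l y \<triangleright>\<^bsub>R.T\<^esub> \<Psi> j i (t l))"
      proof (rule R.right_term_sum[of ?I, OF _ _ refl])
        fix l assume l: "l \<in> ?I"
        show "finite_sum_of R.T (carrier A) R.right_terms (\<lambda>y. \<beta> j i l y \<triangleright>\<^bsub>R.T\<^esub> \<Psi> j i (t l))"
          by (rule R.right_term_base[OF \<beta>[OF j i l] \<Psi>_central[OF j i l]])
      qed simp
    qed simp
  next
    fix y assume y: "y \<in> carrier A"
    show "R.pure \<one> y
      = (\<Oplus>\<^bsub>R.T\<^esub>j\<in>J. \<Oplus>\<^bsub>R.T\<^esub>i\<in>?I. \<Oplus>\<^bsub>R.T\<^esub>l\<in>?I. \<beta> j i l y \<triangleright>\<^bsub>R.T\<^esub> \<Psi> j i (t l))"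
      unfolding sum[OF y]
    proof (rule R.T.finsum_cong'[OF refl])
      show "(\<lambda>j. \<Oplus>\<^bsub>R.T\<^esub>i\<in>?I. \<Oplus>\<^bsub>R.T\<^esub>l\<in>?I. \<beta> j i l y \<triangleright>\<^bsub>R.T\<^esub> \<Psi> j i (t l)) \<in> J \<rightarrow> carrier R.T"
        using term_closed y by (auto intro!: R.T.finsum_closed)
      fix j assume j: "j \<in> J"
      have ez: "e j \<otimes> \<gamma> i y \<in> carrier A" if "i \<in> ?I" for i
        using e[OF j] \<gamma>D(2)[OF that y] by simp
      have "pure (e j) y = e j \<triangleright>\<^bsub>T\<^esub> pure \<one> y" using e[OF j] y by (simp add: lact_pure)
      also have "\<dots> = (\<Oplus>\<^bsub>T\<^esub>i\<in>?I. e j \<triangleright>\<^bsub>T\<^esub> (\<gamma> i y \<triangleright>\<^bsub>T\<^esub> t i))"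
        unfolding D3_sum[OF y] using e[OF j] y \<gamma>D(2) tT
        by (intro TB.lact_finsum TB.lact_closed) auto
      also have "\<dots> = (\<Oplus>\<^bsub>T\<^esub>i\<in>?I. (e j \<otimes> \<gamma> i y) \<triangleright>\<^bsub>T\<^esub> t i)"
        using e[OF j] y \<gamma>D(2) tT ez
        by (intro T.finsum_cong' refl) (auto simp: TB.lact_assoc intro!: TB.lact_closed)
      finally have ey: "pure (e j) y = (\<Oplus>\<^bsub>T\<^esub>i\<in>?I. (e j \<otimes> \<gamma> i y) \<triangleright>\<^bsub>T\<^esub> t i)" .
      have "\<theta> j (pure (e j) y) = (\<Oplus>\<^bsub>R.T\<^esub>i\<in>?I. \<theta> j ((e j \<otimes> \<gamma> i y) \<triangleright>\<^bsub>T\<^esub> t i))"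
        unfolding ey using ez tT
        by (intro add_hom_finsum[OF T.abelian_group_axioms R.T.abelian_group_axioms \<theta>[OF j]]
            TB.lact_closed) auto
      also have "\<dots> = (\<Oplus>\<^bsub>R.T\<^esub>i\<in>?I. \<Oplus>\<^bsub>R.T\<^esub>l\<in>?I. \<beta> j i l y \<triangleright>\<^bsub>R.T\<^esub> \<Psi> j i (t l))"
      proof (rule R.T.finsum_cong'[OF refl])
        show "(\<lambda>i. \<Oplus>\<^bsub>R.T\<^esub>l\<in>?I. \<beta> j i l y \<triangleright>\<^bsub>R.T\<^esub> \<Psi> j i (t l)) \<in> ?I \<rightarrow> carrier R.T"
          using term_closed y j by (auto intro!: R.T.finsum_closed)
        fix i assume i: "i \<in> ?I"
        \<comment> \<open>Reading the element as a value of \<open>\<Psi> j i\<close> at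
          \<open>1 \<otimes> z\<close>, with \<open>z\<close> the product
          \<open>e j \<otimes> \<gamma> i y\<close>, prepares for \<open>\<Psi>_one\<close>.\<close>
        have "\<theta> j ((e j \<otimes> \<gamma> i y) \<triangleright>\<^bsub>T\<^esub> t i) = \<Psi> j i (pure \<one> (e j \<otimes> \<gamma> i y))"
          using i j ez[OF i] tT[OF i]
          by (simp add: \<Psi>_pure R.TB.lact_one \<theta>_closed TB.lact_closed)
        then show "\<theta> j ((e j \<otimes> \<gamma> i y) \<triangleright>\<^bsub>T\<^esub> t i)
            = (\<Oplus>\<^bsub>R.T\<^esub>l\<in>?I. \<beta> j i l y \<triangleright>\<^bsub>R.T\<^esub> \<Psi> j i (t l))"
          unfolding \<beta>_def using \<Psi>_one[OF j i ez[OF i]] by simp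
      qed
      finally show "\<theta> j (pure (e j) y) = \<dots>" .
    qed
  qed
qed

end

section \<open>Casimir elements and quasi-Frobenius systems\<close>

text \<open>The family \<open>x k, y k\<close> represents an element \<open>\<Sum>k. x k \<otimes> y k\<close> of \<open>A \<otimes>\<^sub>B A\<close> that commutes with
  every \<open>a\<close>, in the strong sense that a matrix over \<open>B\<close> carries \<open>\<Sum>k. a x k \<otimes> y k\<close>
  to \<open>\<Sum>k. x k \<otimes> y k a\<close>.\<close>

definition casimir ::
    "('b, 'd) ring_scheme \<Rightarrow> ('a, 'c) ring_scheme \<Rightarrow> ('b \<Rightarrow> 'a) \<Rightarrow> 'k set \<Rightarrow> ('k \<Rightarrow> 'a) \<Rightarrow> ('k \<Rightarrow> 'a) \<Rightarrow> bool"
  where "casimir B A h K x y \<longleftrightarrow> x \<in> K \<rightarrow> carrier A \<and> y \<in> K \<rightarrow> carrier A \<and>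
    (\<forall>a\<in>carrier A. \<exists>b. (\<forall>l\<in>K. \<forall>k\<in>K. b l k \<in> carrier B) \<and>
      (\<forall>k\<in>K. a \<otimes>\<^bsub>A\<^esub> x k = (\<Oplus>\<^bsub>A\<^esub>l\<in>K. x l \<otimes>\<^bsub>A\<^esub> h (b l k))) \<and>
      (\<forall>l\<in>K. y l \<otimes>\<^bsub>A\<^esub> a = (\<Oplus>\<^bsub>A\<^esub>k\<in>K. h (b l k) \<otimes>\<^bsub>A\<^esub> y k)))"

lemma casimirD:
  assumes "casimir B A h K x y" "k \<in> K"
  shows "x k \<in> carrier A" "y k \<in> carrier A"
proof -
  have "x \<in> K \<rightarrow> carrier A" "y \<in> K \<rightarrow> carrier A"
    by (rule assms(1)[unfolded casimir_def, THEN conjunct1],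
        rule assms(1)[unfolded casimir_def, THEN conjunct2, THEN conjunct1])
  then show "x k \<in> carrier A" "y k \<in> carrier A"
    using assms(2) by auto
qed

lemma casimirE:
  assumes "casimir B A h K x y" "a \<in> carrier A"
  obtains b where "\<And>l k. \<lbrakk>l \<in> K; k \<in> K\<rbrakk> \<Longrightarrow> b l k \<in> carrier B"
    and "\<And>k. k \<in> K \<Longrightarrow> a \<otimes>\<^bsub>A\<^esub> x k = (\<Oplus>\<^bsub>A\<^esub>l\<in>K. x l \<otimes>\<^bsub>A\<^esub> h (b l k))"
    and "\<And>l. l \<in> K \<Longrightarrow> y l \<otimes>\<^bsub>A\<^esub> a = (\<Oplus>\<^bsub>A\<^esub>k\<in>K. h (b l k) \<otimes>\<^bsub>A\<^esub> y k)"
proof -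
  have "\<forall>a\<in>carrier A. \<exists>b. (\<forall>l\<in>K. \<forall>k\<in>K. b l k \<in> carrier B) \<and>
      (\<forall>k\<in>K. a \<otimes>\<^bsub>A\<^esub> x k = (\<Oplus>\<^bsub>A\<^esub>l\<in>K. x l \<otimes>\<^bsub>A\<^esub> h (b l k))) \<and>
      (\<forall>l\<in>K. y l \<otimes>\<^bsub>A\<^esub> a = (\<Oplus>\<^bsub>A\<^esub>k\<in>K. h (b l k) \<otimes>\<^bsub>A\<^esub> y k))"
    by (rule assms(1)[unfolded casimir_def, THEN conjunct2, THEN conjunct2])
  from bspec[OF this assms(2)] obtain b where
    "\<forall>l\<in>K. \<forall>k\<in>K. b l k \<in> carrier B"
    "\<forall>k\<in>K. a \<otimes>\<^bsub>A\<^esub> x k = (\<Oplus>\<^bsub>A\<^esub>l\<in>K. x l \<otimes>\<^bsub>A\<^esub> h (b l k))"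
    "\<forall>l\<in>K. y l \<otimes>\<^bsub>A\<^esub> a = (\<Oplus>\<^bsub>A\<^esub>k\<in>K. h (b l k) \<otimes>\<^bsub>A\<^esub> y k)"
    by (elim exE conjE)
  then show thesis by (intro that[of b]) (erule bspec, assumption | drule bspec, assumption)+
qed

text \<open>Expanding \<open>a x_k\<close> or \<open>y_l a\<close> by the matrix and letting its
  entries cross the balanced map leads from both sides to the double sum of
  \<open>\<phi> (x_l) (h(b_lk) y_k)\<close>. The maps \<open>f\<close> and \<open>g\<close> are
  arbitrary since the outer actions do not enter balancedness.\<close>

lemma casimir_balanced:
  assumes "ring_hom_ring B A h" "casimir B A h K x y" "abelian_group G"
    and \<phi>: "balanced B (ring_bimod f A h) (ring_bimod h A g) G \<phi>" and a: "a \<in> carrier A"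
  shows "(\<Oplus>\<^bsub>G\<^esub>k\<in>K. \<phi> (a \<otimes>\<^bsub>A\<^esub> x k) (y k)) = (\<Oplus>\<^bsub>G\<^esub>k\<in>K. \<phi> (x k) (y k \<otimes>\<^bsub>A\<^esub> a))"
proof -
  interpret h: ring_hom_ring B A h by fact
  interpret G: abelian_group G by fact
  have xA: "x k \<in> carrier A" and yA: "y k \<in> carrier A" if "k \<in> K" for k
    using casimirD[OF assms(2) that] .
  obtain b where b: "\<And>l k. \<lbrakk>l \<in> K; k \<in> K\<rbrakk> \<Longrightarrow> b l k \<in> carrier B"
    and ax: "\<And>k. k \<in> K \<Longrightarrow> a \<otimes>\<^bsub>A\<^esub> x k = (\<Oplus>\<^bsub>A\<^esub>l\<in>K. x l \<otimes>\<^bsub>A\<^esub> h (b l k))"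
    and ya: "\<And>l. l \<in> K \<Longrightarrow> y l \<otimes>\<^bsub>A\<^esub> a = (\<Oplus>\<^bsub>A\<^esub>k\<in>K. h (b l k) \<otimes>\<^bsub>A\<^esub> y k)"
    by (rule casimirE[OF assms(2) a]) (rule that)
  have r: "\<phi> u \<in> add_hom A G" and l: "(\<lambda>v. \<phi> v u) \<in> add_hom A G" if "u \<in> carrier A" for u
    using \<phi> that by (auto simp: balanced_def)
  have move: "\<phi> (u \<otimes>\<^bsub>A\<^esub> h c) v = \<phi> u (h c \<otimes>\<^bsub>A\<^esub> v)"
    if "u \<in> carrier A" "c \<in> carrier B" "v \<in> carrier A" for u c v
    using \<phi> that by (auto simp: balanced_def)
  have \<phi>_closed: "\<phi> u v \<in> carrier G" if "u \<in> carrier A" "v \<in> carrier A" for u v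
    using add_hom_closed[OF r] that by blast
  have "(\<Oplus>\<^bsub>G\<^esub>k\<in>K. \<phi> (a \<otimes>\<^bsub>A\<^esub> x k) (y k)) = (\<Oplus>\<^bsub>G\<^esub>k\<in>K. \<Oplus>\<^bsub>G\<^esub>l\<in>K. \<phi> (x l) (h (b l k) \<otimes>\<^bsub>A\<^esub> y k))"
  proof (rule G.finsum_cong'[OF refl])
    show "(\<lambda>k. \<Oplus>\<^bsub>G\<^esub>l\<in>K. \<phi> (x l) (h (b l k) \<otimes>\<^bsub>A\<^esub> y k)) \<in> K \<rightarrow> carrier G"
      using xA yA b \<phi>_closed by (auto intro!: G.finsum_closed)
    fix k assume k: "k \<in> K"
    have "\<phi> (a \<otimes>\<^bsub>A\<^esub> x k) (y k) = (\<Oplus>\<^bsub>G\<^esub>l\<in>K. \<phi> (x l \<otimes>\<^bsub>A\<^esub> h (b l k)) (y k))"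
      unfolding ax[OF k] using k xA b
      by (intro add_hom_finsum[OF h.S.is_abelian_group assms(3) l[OF yA[OF k]]]) auto
    also have "\<dots> = (\<Oplus>\<^bsub>G\<^esub>l\<in>K. \<phi> (x l) (h (b l k) \<otimes>\<^bsub>A\<^esub> y k))"
      using k xA yA b \<phi>_closed by (intro G.finsum_cong' refl) (auto simp: move)
    finally show "\<phi> (a \<otimes>\<^bsub>A\<^esub> x k) (y k) = \<dots>" .
  qed
  also have "\<dots> = (\<Oplus>\<^bsub>G\<^esub>l\<in>K. \<Oplus>\<^bsub>G\<^esub>k\<in>K. \<phi> (x l) (h (b l k) \<otimes>\<^bsub>A\<^esub> y k))"
    using xA yA b \<phi>_closed by (intro G.finsum_swap) auto
  also have "\<dots> = (\<Oplus>\<^bsub>G\<^esub>l\<in>K. \<phi> (x l) (y l \<otimes>\<^bsub>A\<^esub> a))"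
  proof (rule G.finsum_cong'[OF refl])
    show "(\<lambda>l. \<phi> (x l) (y l \<otimes>\<^bsub>A\<^esub> a)) \<in> K \<rightarrow> carrier G"
      using xA yA a \<phi>_closed by auto
    fix l assume l: "l \<in> K"
    show "(\<Oplus>\<^bsub>G\<^esub>k\<in>K. \<phi> (x l) (h (b l k) \<otimes>\<^bsub>A\<^esub> y k)) = \<phi> (x l) (y l \<otimes>\<^bsub>A\<^esub> a)"
      unfolding ya[OF l] using l yA b
      by (intro add_hom_finsum[symmetric, OF h.S.is_abelian_group assms(3) r[OF xA[OF l]]]) auto
  qed
  finally show ?thesis .
qed

text \<open>The \<open>B\<close>-\<open>B\<close>-bilinear maps from \<open>A\<close> to
  \<open>B\<close>; the Frobenius homomorphism of a Frobenius extension is an element of this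
  set.\<close>

definition bilinear_forms ::
    "('b, 'd) ring_scheme \<Rightarrow> ('a, 'c) ring_scheme \<Rightarrow> ('b \<Rightarrow> 'a) \<Rightarrow> ('a \<Rightarrow> 'b) set"
  where "bilinear_forms B A h = bimod_hom B B (ring_bimod h A h) (ring_bimod id B id)"

lemma bilinear_forms_iff:
  "F \<in> bilinear_forms B A h \<longleftrightarrow> F \<in> add_hom A B \<and>
    (\<forall>b\<in>carrier B. \<forall>x\<in>carrier A. F (h b \<otimes>\<^bsub>A\<^esub> x) = b \<otimes>\<^bsub>B\<^esub> F x) \<and>
    (\<forall>b\<in>carrier B. \<forall>x\<in>carrier A. F (x \<otimes>\<^bsub>A\<^esub> h b) = F x \<otimes>\<^bsub>B\<^esub> b)"
  by (auto simp: bilinear_forms_def left_hom_iff right_hom_iff)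

lemma bilinear_formsD:
  assumes "F \<in> bilinear_forms B A h"
  shows "F \<in> add_hom A B" and "x \<in> carrier A \<Longrightarrow> F x \<in> carrier B"
    and "\<lbrakk>b \<in> carrier B; x \<in> carrier A\<rbrakk> \<Longrightarrow> F (h b \<otimes>\<^bsub>A\<^esub> x) = b \<otimes>\<^bsub>B\<^esub> F x"
    and "\<lbrakk>b \<in> carrier B; x \<in> carrier A\<rbrakk> \<Longrightarrow> F (x \<otimes>\<^bsub>A\<^esub> h b) = F x \<otimes>\<^bsub>B\<^esub> b"
  using assms by (auto simp: bilinear_forms_iff add_hom_closed)

text \<open>Several forms \<open>F j\<close> with Casimir elements take the place of the Frobenius homomorphism and its
  dual bases.\<close>

definition left_system ::
    "('b, 'd) ring_scheme \<Rightarrow> ('a, 'c) ring_scheme \<Rightarrow> ('b \<Rightarrow> 'a) \<Rightarrow> 'j set \<Rightarrow> 'k set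
      \<Rightarrow> ('j \<Rightarrow> 'k \<Rightarrow> 'a) \<Rightarrow> ('j \<Rightarrow> 'k \<Rightarrow> 'a) \<Rightarrow> ('j \<Rightarrow> 'a \<Rightarrow> 'b) \<Rightarrow> bool"
  where "left_system B A h J K x y F \<longleftrightarrow> finite J \<and> finite K \<and>
    (\<forall>j\<in>J. casimir B A h K (x j) (y j) \<and> F j \<in> bilinear_forms B A h) \<and>
    (\<forall>a\<in>carrier A. (\<Oplus>\<^bsub>A\<^esub>j\<in>J. \<Oplus>\<^bsub>A\<^esub>k\<in>K. x j k \<otimes>\<^bsub>A\<^esub> h (F j (y j k \<otimes>\<^bsub>A\<^esub> a))) = a)"

definition right_system ::
    "('b, 'd) ring_scheme \<Rightarrow> ('a, 'c) ring_scheme \<Rightarrow> ('b \<Rightarrow> 'a) \<Rightarrow> 'j set \<Rightarrow> 'k set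
      \<Rightarrow> ('j \<Rightarrow> 'k \<Rightarrow> 'a) \<Rightarrow> ('j \<Rightarrow> 'k \<Rightarrow> 'a) \<Rightarrow> ('j \<Rightarrow> 'a \<Rightarrow> 'b) \<Rightarrow> bool"
  where "right_system B A h J K x y F \<longleftrightarrow> finite J \<and> finite K \<and>
    (\<forall>j\<in>J. casimir B A h K (x j) (y j) \<and> F j \<in> bilinear_forms B A h) \<and>
    (\<forall>a\<in>carrier A. (\<Oplus>\<^bsub>A\<^esub>j\<in>J. \<Oplus>\<^bsub>A\<^esub>k\<in>K. h (F j (a \<otimes>\<^bsub>A\<^esub> x j k)) \<otimes>\<^bsub>A\<^esub> y j k) = a)"

section \<open>From right to left depth two\<close>

context extension
begin

interpretation R: tower B B A id h rewrites "h \<circ> id = h"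
  by (intro tower.intro ring_hom_ring_id h.R.ring_axioms h.ring_hom_ring_axioms) simp

lemma left_term_sum:
  assumes "finite I" "\<And>i. i \<in> I \<Longrightarrow> finite_sum_of T (carrier A) left_terms (w i)"
    and "\<And>y. y \<in> carrier A \<Longrightarrow> v y = (\<Oplus>\<^bsub>T\<^esub>i\<in>I. w i y)"
  shows "finite_sum_of T (carrier A) left_terms v"
  by (rule finite_sum_of_cong[OF finite_sum_of_finsum[OF T.abelian_group_axioms left_terms_closed
          assms(1,2)] assms(3)])

lemma left_term_base:
  "\<lbrakk>\<gamma> \<in> bimod_end B B A h h; t \<in> central B id h T\<rbrakk> \<Longrightarrow>
    finite_sum_of T (carrier A) left_terms (\<lambda>y. t \<triangleleft>\<^bsub>T\<^esub> \<gamma> y)"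
  by (rule finite_sum_of_base[OF T.abelian_group_axioms left_terms_closed])
     (unfold left_terms_def, intro CollectI exI[of _ \<gamma>] exI[of _ t] conjI refl)

lemma right_D2_E:
  assumes "right_D2 B A h"
  obtains n :: nat and \<gamma> t where
    "\<And>i. i \<in> {..<n} \<Longrightarrow> \<gamma> i \<in> bimod_end B B A h h"
    "\<And>i. i \<in> {..<n} \<Longrightarrow> t i \<in> central B h id R.T"
    "\<And>y. y \<in> carrier A \<Longrightarrow> R.pure \<one> y = (\<Oplus>\<^bsub>R.T\<^esub>i\<in>{..<n}. \<gamma> i y \<triangleright>\<^bsub>R.T\<^esub> t i)"
  by (rule R.right_quasibasis_E[OF R.right_D3_tower_imp_quasibasis[OF assms[unfolded right_D2_eq_tower]]])
     (rule that)

text \<open>The forms transpose the quasi-basis. Contracting the second tensor factor with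
  \<open>\<epsilon> j\<close> against \<open>a\<close> turns the expansion of
  \<open>1 \<otimes> q\<close> into one of \<open>h (\<epsilon> j (q \<otimes> a))\<close>, in which
  \<open>q\<close> and \<open>a\<close> are separated. Inserting this with \<open>q = y j k\<close>
  into the reproducing formula of the system expands \<open>a \<otimes> 1\<close> with coefficients
  on the right.\<close>

theorem right_D2_imp_left_D2:
  assumes D2: "right_D2 B A h" and sys: "left_system B A h J K x y \<epsilon>"
  shows "left_D2 B A h"
proof (rule left_quasibasis_imp_left_D2)
  have J: "finite J" and K: "finite K"
    and cas: "\<And>j. j \<in> J \<Longrightarrow> casimir B A h K (x j) (y j)"
    and \<epsilon>: "\<And>j. j \<in> J \<Longrightarrow> \<epsilon> j \<in> bilinear_forms B A h"
    and sum: "\<And>a. a \<in> carrier A \<Longrightarrow>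
      (\<Oplus>j\<in>J. \<Oplus>k\<in>K. x j k \<otimes> h (\<epsilon> j (y j k \<otimes> a))) = a"
    using sys unfolding left_system_def by blast+
  note xA = casimirD(1)[OF cas] and yA = casimirD(2)[OF cas] and FD = bilinear_formsD[OF \<epsilon>]
  obtain n :: nat and \<gamma> t where
    \<gamma>: "\<And>i. i \<in> {..<n} \<Longrightarrow> \<gamma> i \<in> bimod_end B B A h h" and
    t: "\<And>i. i \<in> {..<n} \<Longrightarrow> t i \<in> central B h id R.T" and
    D2_sum: "\<And>y. y \<in> carrier A \<Longrightarrow> R.pure \<one> y = (\<Oplus>\<^bsub>R.T\<^esub>i\<in>{..<n}. \<gamma> i y \<triangleright>\<^bsub>R.T\<^esub> t i)"
    by (rule right_D2_E[OF D2]) (rule that)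
  let ?I = "{..<n}"
  note \<gamma>D = bimod_endD[OF \<gamma>] and tT = centralD(1)[OF t]
  have Fy_hom: "(\<lambda>q. h (\<epsilon> j (q \<otimes> a))) \<in> add_hom A A" if "j \<in> J" "a \<in> carrier A" for j a
    using that by (intro add_homI) (simp_all add: FD(2) h.S.l_distr add_hom_add[OF FD(1)])
  have Fy_l: "h (\<epsilon> j (h b \<otimes> q \<otimes> a)) = h b \<otimes> h (\<epsilon> j (q \<otimes> a))"
    if "j \<in> J" "a \<in> carrier A" "b \<in> carrier B" "q \<in> carrier A" for j a b q
    using that by (simp add: h.S.m_assoc FD(2,3))
  \<comment> \<open>The contraction \<open>\<nu> j a\<close>; it is well defined because
    \<open>\<epsilon> j\<close> is left \<open>B\<close>-linear.\<close>
  have "\<exists>f\<in>add_hom R.T A. \<forall>p\<in>carrier A. \<forall>q\<in>carrier A. f (R.pure p q) = p \<otimes> h (\<epsilon> j (q \<otimes> a))"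
    if "j \<in> J" "a \<in> carrier A" for j a
    by (rule R.mult_lift[OF Fy_hom[OF that] Fy_l[OF that]])
  then obtain \<nu> where \<nu>: "\<And>j a. \<lbrakk>j \<in> J; a \<in> carrier A\<rbrakk> \<Longrightarrow> \<nu> j a \<in> add_hom R.T A"
    and \<nu>_pure: "\<And>j a p q. \<lbrakk>j \<in> J; a \<in> carrier A; p \<in> carrier A; q \<in> carrier A\<rbrakk> \<Longrightarrow>
      \<nu> j a (R.pure p q) = p \<otimes> h (\<epsilon> j (q \<otimes> a))"
    by metis
  note \<nu>_closed = add_hom_closed[OF \<nu>]
  have mult_r: "(\<lambda>u. u \<otimes> c) \<in> add_hom A A" "(\<lambda>u. c \<otimes> u) \<in> add_hom A A" if "c \<in> carrier A" for c
    using that by (auto intro!: add_homI simp: h.S.l_distr h.S.r_distr)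
  note eqI = R.tensor_hom_eqI[OF h.S.is_abelian_group]
  have \<nu>_l: "\<nu> j a (c \<triangleright>\<^bsub>R.T\<^esub> u) = c \<otimes> \<nu> j a u"
    if "j \<in> J" "a \<in> carrier A" "c \<in> carrier A" "u \<in> carrier R.T" for j a c u
    by (rule eqI[OF add_hom_comp[OF R.lact_hom \<nu>] add_hom_comp[OF \<nu> mult_r(2)]])
       (use that in \<open>auto simp: R.lact_pure \<nu>_pure h.S.m_assoc FD(2)\<close>)
  have \<nu>_ract: "\<nu> j (h b \<otimes> a) u = \<nu> j a (u \<triangleleft>\<^bsub>R.T\<^esub> b)"
    if "j \<in> J" "a \<in> carrier A" "b \<in> carrier B" "u \<in> carrier R.T" for j a b u
    by (rule eqI[OF \<nu> add_hom_comp[OF R.ract_hom \<nu>]])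
       (use that in \<open>auto simp: R.ract_pure \<nu>_pure h.S.m_assoc\<close>)
  have \<nu>_r: "\<nu> j (a \<otimes> h b) u = \<nu> j a u \<otimes> h b"
    if "j \<in> J" "a \<in> carrier A" "b \<in> carrier B" "u \<in> carrier R.T" for j a b u
    by (rule eqI[OF \<nu> add_hom_comp[OF \<nu> mult_r(1)]])
       (use that in \<open>auto simp: \<nu>_pure h.S.m_assoc[symmetric] FD(2,4)\<close>)
  have \<nu>_add: "\<nu> j (a \<oplus> a') u = \<nu> j a u \<oplus> \<nu> j a' u"
    if "j \<in> J" "a \<in> carrier A" "a' \<in> carrier A" "u \<in> carrier R.T" for j a a' u
  proof (rule eqI[OF \<nu> _ _ that(4)])
    show "(\<lambda>u. \<nu> j a u \<oplus> \<nu> j a' u) \<in> add_hom R.T A"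
      using that by (intro add_homI) (simp_all add: \<nu>_closed add_hom_add[OF \<nu>] h.S.a_ac)
  qed (use that in \<open>auto simp: \<nu>_pure h.S.r_distr FD(2) add_hom_add[OF FD(1)]\<close>)
  define \<beta> where "\<beta> j i a = \<nu> j a (t i)" for j i a
  have \<beta>: "\<beta> j i \<in> bimod_end B B A h h" if ji: "j \<in> J" "i \<in> ?I" for j i
  proof -
    have "\<beta> j i \<in> add_hom A A"
      unfolding \<beta>_def using ji by (intro add_homI \<nu>_closed \<nu>_add tT)
    \<comment> \<open>The factor \<open>h b\<close> enters \<open>t i\<close> from the right by
      \<open>\<nu>_ract\<close>, crosses it by centrality and leaves on the left by
      \<open>\<nu>_l\<close>.\<close>
    moreover have "\<beta> j i (h b \<otimes> a) = h b \<otimes> \<beta> j i a" if "b \<in> carrier B" "a \<in> carrier A" for b a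
      using \<nu>_ract[OF ji(1) that(2,1) tT[OF ji(2)]] \<nu>_l[OF ji(1) that(2) _ tT[OF ji(2)], of "h b"]
        centralD(2)[OF t[OF ji(2)] that(1)] that by (simp add: \<beta>_def)
    moreover have "\<beta> j i (a \<otimes> h b) = \<beta> j i a \<otimes> h b" if "b \<in> carrier B" "a \<in> carrier A" for b a
      using \<nu>_r[OF ji(1) that(2,1) tT[OF ji(2)]] by (simp add: \<beta>_def)
    ultimately show ?thesis by (simp add: bimod_end_iff)
  qed
  note \<beta>_closed = bimod_endD(2)[OF \<beta>]
  define s where "s j i = (\<Oplus>\<^bsub>T\<^esub>k\<in>K. pure (x j k) (\<gamma> i (y j k)))" for j i
  have pure_closed': "pure (x j k) (\<gamma> i (y j k)) \<in> carrier T" if "j \<in> J" "i \<in> ?I" "k \<in> K" for j i k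
    using that xA yA \<gamma>D(2) by (intro pure_closed) auto
  have s_closed: "s j i \<in> carrier T" if "j \<in> J" "i \<in> ?I" for j i
    unfolding s_def using that pure_closed' by (intro T.finsum_closed) auto
  have s: "s j i \<in> central B id h T" if ji: "j \<in> J" "i \<in> ?I" for j i
  proof -
    \<comment> \<open>Left \<open>B\<close>-linearity of \<open>\<gamma> i\<close> makes
      \<open>p \<otimes> \<gamma>_i(q)\<close> balanced, so the Casimir property gives centrality of
      \<open>s j i\<close>; the emerging factor on the right leaves \<open>\<gamma> i\<close> by its
      right linearity.\<close>
    have "balanced B (ring_bimod h A h) (ring_bimod h A id) T (\<lambda>p q. pure p (\<gamma> i q))"
      unfolding balanced_def ring_bimod_simps add_hom_ring_bimod
    proof (intro conjI ballI)
      fix p assume "p \<in> carrier A"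
      then show "(\<lambda>q. pure p (\<gamma> i q)) \<in> add_hom A T"
        using pure_hom_right[of p] add_hom_comp[OF \<gamma>D(1)[OF ji(2)], of "pure p" T] by simp
    next
      fix q assume "q \<in> carrier A"
      then show "(\<lambda>p. pure p (\<gamma> i q)) \<in> add_hom A T"
        using pure_hom_left[of "\<gamma> i q"] \<gamma>D(2)[OF ji(2)] by simp
    qed (simp add: pure_mid \<gamma>D(2,3)[OF ji(2)])
    note cb = casimir_balanced[OF h.ring_hom_ring_axioms cas[OF ji(1)] T.abelian_group_axioms this]
    have "b \<triangleright>\<^bsub>T\<^esub> s j i = s j i \<triangleleft>\<^bsub>T\<^esub> h b" if b: "b \<in> carrier B" for b
    proof -
      have "b \<triangleright>\<^bsub>T\<^esub> s j i = (\<Oplus>\<^bsub>T\<^esub>k\<in>K. b \<triangleright>\<^bsub>T\<^esub> pure (x j k) (\<gamma> i (y j k)))"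
        unfolding s_def using b ji pure_closed' by (intro TB.lact_finsum) auto
      also have "\<dots> = (\<Oplus>\<^bsub>T\<^esub>k\<in>K. pure (h b \<otimes> x j k) (\<gamma> i (y j k)))"
        using b ji xA yA \<gamma>D(2) by (intro T.finsum_cong' refl) (auto simp: lact_pure)
      also have "\<dots> = (\<Oplus>\<^bsub>T\<^esub>k\<in>K. pure (x j k) (\<gamma> i (y j k \<otimes> h b)))"
        using b by (intro cb) simp
      also have "\<dots> = (\<Oplus>\<^bsub>T\<^esub>k\<in>K. pure (x j k) (\<gamma> i (y j k)) \<triangleleft>\<^bsub>T\<^esub> h b)"
        using b ji xA yA \<gamma>D(2,4)
        by (intro T.finsum_cong' refl) (auto simp: ract_pure intro!: TB.ract_closed)
      also have "\<dots> = s j i \<triangleleft>\<^bsub>T\<^esub> h b"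
        unfolding s_def using b ji pure_closed' by (intro TB.ract_finsum[symmetric]) auto
      finally show ?thesis .
    qed
    then show ?thesis using s_closed[OF ji] by (simp add: central_def)
  qed
  \<comment> \<open>Apply \<open>\<nu> j a\<close> to both sides of the depth two equation for
    \<open>1 \<otimes> q\<close>.\<close>
  have expand: "h (\<epsilon> j (q \<otimes> a)) = (\<Oplus>i\<in>?I. \<gamma> i q \<otimes> \<beta> j i a)"
    if j: "j \<in> J" and q: "q \<in> carrier A" and a: "a \<in> carrier A" for j q a
  proof -
    have "h (\<epsilon> j (q \<otimes> a)) = \<nu> j a (R.pure \<one> q)"
      using j q a by (simp add: \<nu>_pure FD(2))
    also have "\<dots> = (\<Oplus>i\<in>?I. \<nu> j a (\<gamma> i q \<triangleright>\<^bsub>R.T\<^esub> t i))"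
      unfolding D2_sum[OF q] using q \<gamma>D(2) tT
      by (intro add_hom_finsum[OF R.T.abelian_group_axioms h.S.is_abelian_group \<nu>[OF j a]]
          R.TB.lact_closed) auto
    also have "\<dots> = (\<Oplus>i\<in>?I. \<gamma> i q \<otimes> \<beta> j i a)"
      using j q a \<gamma>D(2) tT \<beta>_closed
      by (intro h.S.finsum_cong' refl) (auto simp: \<nu>_l \<beta>_def)
    finally show ?thesis .
  qed
  show left_quasibasis
    unfolding left_quasibasis_def
  proof (rule left_term_sum[OF J])
    fix j assume j: "j \<in> J"
    show "finite_sum_of T (carrier A) left_terms (\<lambda>a. \<Oplus>\<^bsub>T\<^esub>i\<in>?I. s j i \<triangleleft>\<^bsub>T\<^esub> \<beta> j i a)"
    proof (rule left_term_sum[of ?I, OF _ _ refl])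
      fix i assume i: "i \<in> ?I"
      show "finite_sum_of T (carrier A) left_terms (\<lambda>a. s j i \<triangleleft>\<^bsub>T\<^esub> \<beta> j i a)"
        by (rule left_term_base[OF \<beta>[OF j i] s[OF j i]])
    qed simp
  next
    fix a assume a: "a \<in> carrier A"
    have z_closed: "x j k \<otimes> h (\<epsilon> j (y j k \<otimes> a)) \<in> carrier A" if "j \<in> J" "k \<in> K" for j k
      using that a xA yA FD(2) by auto
    have p1: "(\<lambda>u. pure u \<one>) \<in> add_hom A T" using pure_hom_left[of "\<one>"] by simp
    note fs = add_hom_finsum[OF h.S.is_abelian_group T.abelian_group_axioms p1]
    have inner: "(\<Oplus>\<^bsub>T\<^esub>k\<in>K. pure (x j k \<otimes> h (\<epsilon> j (y j k \<otimes> a))) \<one>)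
        = (\<Oplus>\<^bsub>T\<^esub>i\<in>?I. s j i \<triangleleft>\<^bsub>T\<^esub> \<beta> j i a)" if j: "j \<in> J" for j
    proof -
      have term_closed: "pure (x j k) (\<gamma> i (y j k)) \<triangleleft>\<^bsub>T\<^esub> \<beta> j i a \<in> carrier T"
        if "k \<in> K" "i \<in> ?I" for k i
        using that j a \<beta>_closed pure_closed' by (intro TB.ract_closed) auto
      have "(\<Oplus>\<^bsub>T\<^esub>k\<in>K. pure (x j k \<otimes> h (\<epsilon> j (y j k \<otimes> a))) \<one>)
          = (\<Oplus>\<^bsub>T\<^esub>k\<in>K. \<Oplus>\<^bsub>T\<^esub>i\<in>?I. pure (x j k) (\<gamma> i (y j k)) \<triangleleft>\<^bsub>T\<^esub> \<beta> j i a)"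
      proof (rule T.finsum_cong'[OF refl])
        show "(\<lambda>k. \<Oplus>\<^bsub>T\<^esub>i\<in>?I. pure (x j k) (\<gamma> i (y j k)) \<triangleleft>\<^bsub>T\<^esub> \<beta> j i a) \<in> K \<rightarrow> carrier T"
          using term_closed by (auto intro!: T.finsum_closed)
        fix k assume k: "k \<in> K"
        have xk: "x j k \<in> carrier A" and yk: "y j k \<in> carrier A" using xA[OF j k] yA[OF j k] by auto
        have Fb: "\<epsilon> j (y j k \<otimes> a) \<in> carrier B" using FD(2)[OF j] yk a by simp
        \<comment> \<open>The value of \<open>\<epsilon> j\<close> lies in \<open>B\<close> and may
          cross to the second factor, where \<open>expand\<close> splits it.\<close>
        have "pure (x j k \<otimes> h (\<epsilon> j (y j k \<otimes> a))) \<one> = pure (x j k) (h (\<epsilon> j (y j k \<otimes> a)))"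
          using xk Fb by (simp add: pure_mid)
        also have "\<dots> = (\<Oplus>\<^bsub>T\<^esub>i\<in>?I. pure (x j k) (\<gamma> i (y j k) \<otimes> \<beta> j i a))"
          unfolding expand[OF j yk a] using xk yk a j \<gamma>D(2) \<beta>_closed pure_hom_right[of "x j k"]
          by (intro add_hom_finsum[OF h.S.is_abelian_group T.abelian_group_axioms, of "pure (x j k)"]) auto
        also have "\<dots> = (\<Oplus>\<^bsub>T\<^esub>i\<in>?I. pure (x j k) (\<gamma> i (y j k)) \<triangleleft>\<^bsub>T\<^esub> \<beta> j i a)"
          using xk yk a j k \<gamma>D(2) \<beta>_closed term_closed
          by (intro T.finsum_cong' refl) (auto simp: ract_pure)
        finally show "pure (x j k \<otimes> h (\<epsilon> j (y j k \<otimes> a))) \<one> = \<dots>" .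
      qed
      also have "\<dots> = (\<Oplus>\<^bsub>T\<^esub>i\<in>?I. \<Oplus>\<^bsub>T\<^esub>k\<in>K. pure (x j k) (\<gamma> i (y j k)) \<triangleleft>\<^bsub>T\<^esub> \<beta> j i a)"
        using term_closed by (intro T.finsum_swap)
      also have "\<dots> = (\<Oplus>\<^bsub>T\<^esub>i\<in>?I. s j i \<triangleleft>\<^bsub>T\<^esub> \<beta> j i a)"
      proof (rule T.finsum_cong'[OF refl])
        show "(\<lambda>i. s j i \<triangleleft>\<^bsub>T\<^esub> \<beta> j i a) \<in> ?I \<rightarrow> carrier T"
          using j a s_closed \<beta>_closed by (auto intro!: TB.ract_closed)
        fix i assume i: "i \<in> ?I"
        show "(\<Oplus>\<^bsub>T\<^esub>k\<in>K. pure (x j k) (\<gamma> i (y j k)) \<triangleleft>\<^bsub>T\<^esub> \<beta> j i a) = s j i \<triangleleft>\<^bsub>T\<^esub> \<beta> j i a"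
          unfolding s_def using \<beta>_closed[OF j i a] pure_closed' i j
          by (intro TB.ract_finsum[symmetric]) auto
      qed
      finally show ?thesis .
    qed
    have "pure a \<one> = pure (\<Oplus>j\<in>J. \<Oplus>k\<in>K. x j k \<otimes> h (\<epsilon> j (y j k \<otimes> a))) \<one>"
      by (simp add: sum[OF a])
    also have "\<dots> = (\<Oplus>\<^bsub>T\<^esub>j\<in>J. pure (\<Oplus>k\<in>K. x j k \<otimes> h (\<epsilon> j (y j k \<otimes> a))) \<one>)"
      using z_closed by (intro fs h.S.finsum_closed) auto
    also have "\<dots> = (\<Oplus>\<^bsub>T\<^esub>j\<in>J. \<Oplus>\<^bsub>T\<^esub>i\<in>?I. s j i \<triangleleft>\<^bsub>T\<^esub> \<beta> j i a)"
    proof (rule T.finsum_cong'[OF refl])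
      show "(\<lambda>j. \<Oplus>\<^bsub>T\<^esub>i\<in>?I. s j i \<triangleleft>\<^bsub>T\<^esub> \<beta> j i a) \<in> J \<rightarrow> carrier T"
        using a s_closed \<beta>_closed by (auto intro!: T.finsum_closed TB.ract_closed)
      fix j assume j: "j \<in> J"
      have "pure (\<Oplus>k\<in>K. x j k \<otimes> h (\<epsilon> j (y j k \<otimes> a))) \<one>
          = (\<Oplus>\<^bsub>T\<^esub>k\<in>K. pure (x j k \<otimes> h (\<epsilon> j (y j k \<otimes> a))) \<one>)"
        using z_closed j by (intro fs) auto
      then show "pure (\<Oplus>k\<in>K. x j k \<otimes> h (\<epsilon> j (y j k \<otimes> a))) \<one>
          = (\<Oplus>\<^bsub>T\<^esub>i\<in>?I. s j i \<triangleleft>\<^bsub>T\<^esub> \<beta> j i a)"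
        using inner[OF j] by simp
    qed
    finally show "pure a \<one> = \<dots>" .
  qed
qed

end

section \<open>Dual bases of finitely generated projective extensions\<close>

context extension
begin

lemma h_add_hom: "h \<in> add_hom B A"
  by (auto simp: add_hom_def)

lemma mult_add_homs:
  assumes "a \<in> carrier A"
  shows "(\<lambda>x. x \<otimes> a) \<in> add_hom A A" "(\<lambda>x. a \<otimes> x) \<in> add_hom A A"
  using assms by (auto intro!: add_homI simp: h.S.l_distr h.S.r_distr)

lemma BB: "bimodule B B (ring_bimod id B id)"
  by (intro ring_bimod_bimodule ring_hom_ring_id h.R.ring_axioms)

lemma AA: "bimodule B B (ring_bimod h A h)"
  by (intro ring_bimod_bimodule h.ring_hom_ring_axioms)

text \<open>Projectivity is given by a free module of possibly infinite rank. Finitely many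
  generators have finitely many nonzero coordinates in it, so the section ends in a free summand of
  finite rank.\<close>

lemma right_dual_basis:
  assumes "right_fin_gen B (ring_bimod h A h)" "right_projective B (ring_bimod h A h)"
  obtains K :: "'a set" and x :: "'a \<Rightarrow> 'a" and f :: "'a \<Rightarrow> 'a \<Rightarrow> 'b" where "finite K"
    "\<And>k. k \<in> K \<Longrightarrow> x k \<in> carrier A" "\<And>k. k \<in> K \<Longrightarrow> f k \<in> add_hom A B"
    "\<And>k a b. \<lbrakk>k \<in> K; a \<in> carrier A; b \<in> carrier B\<rbrakk> \<Longrightarrow> f k (a \<otimes> h b) = f k a \<otimes>\<^bsub>B\<^esub> b"
    "\<And>a. a \<in> carrier A \<Longrightarrow> (\<Oplus>k\<in>K. x k \<otimes> h (f k a)) = a"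
proof -
  let ?M = "ring_bimod h A h" and ?V = "ring_bimod id B id"
  interpret M: bimodule B B ?M by (rule AA)
  interpret V: bimodule B B ?V by (rule BB)
  obtain Q :: "('b, 'b, 'a \<Rightarrow> 'b) bimod" and I :: "'a set" and \<phi> where Q: "right_module B Q"
    and \<phi>: "\<phi> \<in> right_hom B (direct_sum ?M Q) (copower ?V I)"
    and bij: "bij_betw \<phi> (carrier (direct_sum ?M Q)) (carrier (copower ?V I))"
    using assms(2) unfolding right_projective_def right_isomorphic_def by blast
  interpret Q: right_module B Q by (rule Q)
  let ?C = "copower ?V I"
  interpret C: bimodule B B ?C by (rule V.copower_bimodule)
  interpret D: direct_decomposition ?M Q ?C \<phi>
    using \<phi> bij by unfold_locales (auto simp: right_hom_iff)
  have sect: "D.sect \<in> right_hom B ?M ?C" and retr: "D.retr \<in> right_hom B ?C ?M"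
    using D.right_linear[OF M.right_module_axioms Q \<phi>] by auto
  obtain G where G: "finite G" "G \<subseteq> carrier A"
    and gen: "\<And>a. a \<in> carrier A \<Longrightarrow> \<exists>c\<in>G \<rightarrow> carrier B. a = (\<Oplus>g\<in>G. g \<otimes> h (c g))"
    using assms(1) by (auto simp: right_fin_gen_def)
  have sC: "D.sect a \<in> carrier ?C" if "a \<in> carrier A" for a
    using add_hom_closed[OF D.sect_hom, of a] that by simp
  have sB: "D.sect a i \<in> carrier B" if "a \<in> carrier A" "i \<in> I" for a i
    using sC[OF that(1)] that(2) by (auto simp: copower_simps)
  \<comment> \<open>The coordinates that occur in the sections of the generators. By
    \<open>supp\<close>, linearity confines the section of every element to them.\<close>
  define K where "K = (\<Union>g\<in>G. {i \<in> I. D.sect g i \<noteq> \<zero>\<^bsub>B\<^esub>})"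
  have K: "finite K" "K \<subseteq> I"
    using G sC by (auto simp: K_def copower_simps)
  have supp: "D.sect a i = \<zero>\<^bsub>B\<^esub>" if a: "a \<in> carrier A" and i: "i \<in> I - K" for a i
  proof -
    obtain c where c: "c \<in> G \<rightarrow> carrier B" "a = (\<Oplus>g\<in>G. g \<otimes> h (c g))"
      using gen[OF a] by blast
    have cG: "c g \<in> carrier B" "g \<in> carrier A" if "g \<in> G" for g
      using that c(1) G(2) by auto
    have ev: "(\<lambda>a. D.sect a i) \<in> add_hom A B"
      using add_hom_comp[OF D.sect_hom copower_proj_hom[OF V.M.abelian_group_axioms, of i I]] i by simp
    have "D.sect a i = (\<Oplus>\<^bsub>B\<^esub>g\<in>G. D.sect (g \<otimes> h (c g)) i)"
      unfolding c(2) using cG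
      by (intro add_hom_finsum[OF h.S.is_abelian_group h.R.is_abelian_group ev]) auto
    also have "\<dots> = (\<Oplus>\<^bsub>B\<^esub>g\<in>G. \<zero>\<^bsub>B\<^esub>)"
    proof (rule h.R.finsum_cong'[OF refl])
      fix g assume g: "g \<in> G"
      have "D.sect (g \<otimes> h (c g)) = D.sect g \<triangleleft>\<^bsub>?C\<^esub> c g"
        using sect c(1) G(2) g by (auto simp: right_hom_iff)
      then show "D.sect (g \<otimes> h (c g)) i = \<zero>\<^bsub>B\<^esub>"
        using i g cG by (auto simp: copower_simps K_def)
    qed auto
    finally show ?thesis by simp
  qed
  show thesis
  proof
    show "finite K" by (rule K)
    \<comment> \<open>The standard dual basis of a summand of a free module: retractions of the
      basis vectors, and coordinates of the section.\<close>
    let ?x = "\<lambda>k. D.retr (unit_vec ?V I k \<one>\<^bsub>B\<^esub>)" and ?f = "\<lambda>k a. D.sect a k"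
    have uv: "unit_vec ?V I k b \<in> carrier ?C" if "b \<in> carrier B" for k b
      using that by (intro unit_vec_closed V.M.abelian_group_axioms) simp
    show xA: "?x k \<in> carrier A" for k
      using add_hom_closed[OF D.retr_hom uv[of "\<one>\<^bsub>B\<^esub>" k]] by simp
    show "?f k \<in> add_hom A B" if "k \<in> K" for k
      using add_hom_comp[OF D.sect_hom copower_proj_hom[OF V.M.abelian_group_axioms, of k I]] that K
      by auto
    show "?f k (a \<otimes> h b) = ?f k a \<otimes>\<^bsub>B\<^esub> b" if "k \<in> K" "a \<in> carrier A" "b \<in> carrier B" for k a b
      using sect that K by (auto simp: right_hom_iff copower_simps)
    show "(\<Oplus>k\<in>K. ?x k \<otimes> h (?f k a)) = a" if a: "a \<in> carrier A" for a
    proof -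
      have "a = D.retr (D.sect a)" using D.retr_sect[of a] a by simp
      also have "D.sect a = (\<Oplus>\<^bsub>?C\<^esub>i\<in>K. unit_vec ?V I i (D.sect a i))"
        using supp[OF a] by (intro copower_expand[OF V.M.abelian_group_axioms sC[OF a] K]) simp
      also have "D.retr \<dots> = (\<Oplus>i\<in>K. D.retr (unit_vec ?V I i (D.sect a i)))"
        using add_hom_finsum[OF D.C D.U D.retr_hom, of K "\<lambda>i. unit_vec ?V I i (D.sect a i)"]
          uv sB[OF a] K by auto
      also have "\<dots> = (\<Oplus>k\<in>K. ?x k \<otimes> h (?f k a))"
      proof (rule h.S.finsum_cong'[OF refl])
        show "(\<lambda>k. ?x k \<otimes> h (?f k a)) \<in> K \<rightarrow> carrier A" using xA sB[OF a] K by auto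
        fix k assume k: "k \<in> K"
        have b: "D.sect a k \<in> carrier B" using k K sB[OF a] by auto
        have "unit_vec ?V I k (D.sect a k) = unit_vec ?V I k \<one>\<^bsub>B\<^esub> \<triangleleft>\<^bsub>?C\<^esub> D.sect a k"
          using b by (simp add: V.ract_unit_vec)
        then show "D.retr (unit_vec ?V I k (D.sect a k)) = ?x k \<otimes> h (?f k a)"
          using retr uv[of "\<one>\<^bsub>B\<^esub>" k] b by (simp add: right_hom_iff)
      qed
      finally show ?thesis by simp
    qed
  qed
qed

text \<open>The same argument on the other side, with coefficients from \<open>B\<close> standing on
  the left.\<close>

lemma left_dual_basis:
  assumes "left_fin_gen B (ring_bimod h A h)" "left_projective B (ring_bimod h A h)"
  obtains K :: "'a set" and x :: "'a \<Rightarrow> 'a" and f :: "'a \<Rightarrow> 'a \<Rightarrow> 'b" where "finite K"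
    "\<And>k. k \<in> K \<Longrightarrow> x k \<in> carrier A" "\<And>k. k \<in> K \<Longrightarrow> f k \<in> add_hom A B"
    "\<And>k a b. \<lbrakk>k \<in> K; a \<in> carrier A; b \<in> carrier B\<rbrakk> \<Longrightarrow> f k (h b \<otimes> a) = b \<otimes>\<^bsub>B\<^esub> f k a"
    "\<And>a. a \<in> carrier A \<Longrightarrow> (\<Oplus>k\<in>K. h (f k a) \<otimes> x k) = a"
proof -
  let ?M = "ring_bimod h A h" and ?V = "ring_bimod id B id"
  interpret M: bimodule B B ?M by (rule AA)
  interpret V: bimodule B B ?V by (rule BB)
  obtain Q :: "('b, 'b, 'a \<Rightarrow> 'b) bimod" and I :: "'a set" and \<phi> where Q: "left_module B Q"
    and \<phi>: "\<phi> \<in> left_hom B (direct_sum ?M Q) (copower ?V I)"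
    and bij: "bij_betw \<phi> (carrier (direct_sum ?M Q)) (carrier (copower ?V I))"
    using assms(2) unfolding left_projective_def left_isomorphic_def by blast
  interpret Q: left_module B Q by (rule Q)
  let ?C = "copower ?V I"
  interpret C: bimodule B B ?C by (rule V.copower_bimodule)
  interpret D: direct_decomposition ?M Q ?C \<phi>
    using \<phi> bij by unfold_locales (auto simp: left_hom_iff)
  have sect: "D.sect \<in> left_hom B ?M ?C" and retr: "D.retr \<in> left_hom B ?C ?M"
    using D.left_linear[OF M.left_module_axioms Q \<phi>] by auto
  obtain G where G: "finite G" "G \<subseteq> carrier A"
    and gen: "\<And>a. a \<in> carrier A \<Longrightarrow> \<exists>c\<in>G \<rightarrow> carrier B. a = (\<Oplus>g\<in>G. h (c g) \<otimes> g)"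
    using assms(1) by (auto simp: left_fin_gen_def)
  have sC: "D.sect a \<in> carrier ?C" if "a \<in> carrier A" for a
    using add_hom_closed[OF D.sect_hom, of a] that by simp
  have sB: "D.sect a i \<in> carrier B" if "a \<in> carrier A" "i \<in> I" for a i
    using sC[OF that(1)] that(2) by (auto simp: copower_simps)
  define K where "K = (\<Union>g\<in>G. {i \<in> I. D.sect g i \<noteq> \<zero>\<^bsub>B\<^esub>})"
  have K: "finite K" "K \<subseteq> I"
    using G sC by (auto simp: K_def copower_simps)
  have supp: "D.sect a i = \<zero>\<^bsub>B\<^esub>" if a: "a \<in> carrier A" and i: "i \<in> I - K" for a i
  proof -
    obtain c where c: "c \<in> G \<rightarrow> carrier B" "a = (\<Oplus>g\<in>G. h (c g) \<otimes> g)"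
      using gen[OF a] by blast
    have cG: "c g \<in> carrier B" "g \<in> carrier A" if "g \<in> G" for g
      using that c(1) G(2) by auto
    have ev: "(\<lambda>a. D.sect a i) \<in> add_hom A B"
      using add_hom_comp[OF D.sect_hom copower_proj_hom[OF V.M.abelian_group_axioms, of i I]] i by simp
    have "D.sect a i = (\<Oplus>\<^bsub>B\<^esub>g\<in>G. D.sect (h (c g) \<otimes> g) i)"
      unfolding c(2) using cG
      by (intro add_hom_finsum[OF h.S.is_abelian_group h.R.is_abelian_group ev]) auto
    also have "\<dots> = (\<Oplus>\<^bsub>B\<^esub>g\<in>G. \<zero>\<^bsub>B\<^esub>)"
    proof (rule h.R.finsum_cong'[OF refl])
      fix g assume g: "g \<in> G"
      have "D.sect (h (c g) \<otimes> g) = c g \<triangleright>\<^bsub>?C\<^esub> D.sect g"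
        using sect c(1) G(2) g by (auto simp: left_hom_iff)
      then show "D.sect (h (c g) \<otimes> g) i = \<zero>\<^bsub>B\<^esub>"
        using i g cG by (auto simp: copower_simps K_def)
    qed auto
    finally show ?thesis by simp
  qed
  show thesis
  proof
    show "finite K" by (rule K)
    let ?x = "\<lambda>k. D.retr (unit_vec ?V I k \<one>\<^bsub>B\<^esub>)" and ?f = "\<lambda>k a. D.sect a k"
    have uv: "unit_vec ?V I k b \<in> carrier ?C" if "b \<in> carrier B" for k b
      using that by (intro unit_vec_closed V.M.abelian_group_axioms) simp
    show xA: "?x k \<in> carrier A" for k
      using add_hom_closed[OF D.retr_hom uv[of "\<one>\<^bsub>B\<^esub>" k]] by simp
    show "?f k \<in> add_hom A B" if "k \<in> K" for k
      using add_hom_comp[OF D.sect_hom copower_proj_hom[OF V.M.abelian_group_axioms, of k I]] that K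
      by auto
    show "?f k (h b \<otimes> a) = b \<otimes>\<^bsub>B\<^esub> ?f k a" if "k \<in> K" "a \<in> carrier A" "b \<in> carrier B" for k a b
      using sect that K by (auto simp: left_hom_iff copower_simps)
    show "(\<Oplus>k\<in>K. h (?f k a) \<otimes> ?x k) = a" if a: "a \<in> carrier A" for a
    proof -
      have "a = D.retr (D.sect a)" using D.retr_sect[of a] a by simp
      also have "D.sect a = (\<Oplus>\<^bsub>?C\<^esub>i\<in>K. unit_vec ?V I i (D.sect a i))"
        using supp[OF a] by (intro copower_expand[OF V.M.abelian_group_axioms sC[OF a] K]) simp
      also have "D.retr \<dots> = (\<Oplus>i\<in>K. D.retr (unit_vec ?V I i (D.sect a i)))"
        using add_hom_finsum[OF D.C D.U D.retr_hom, of K "\<lambda>i. unit_vec ?V I i (D.sect a i)"]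
          uv sB[OF a] K by auto
      also have "\<dots> = (\<Oplus>k\<in>K. h (?f k a) \<otimes> ?x k)"
      proof (rule h.S.finsum_cong'[OF refl])
        show "(\<lambda>k. h (?f k a) \<otimes> ?x k) \<in> K \<rightarrow> carrier A" using xA sB[OF a] K by auto
        fix k assume k: "k \<in> K"
        have b: "D.sect a k \<in> carrier B" using k K sB[OF a] by auto
        have "unit_vec ?V I k (D.sect a k) = D.sect a k \<triangleright>\<^bsub>?C\<^esub> unit_vec ?V I k \<one>\<^bsub>B\<^esub>"
          using b by (simp add: V.lact_unit_vec)
        then show "D.retr (unit_vec ?V I k (D.sect a k)) = h (?f k a) \<otimes> ?x k"
          using retr uv[of "\<one>\<^bsub>B\<^esub>" k] b by (simp add: left_hom_iff)
      qed
      finally show ?thesis by simp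
    qed
  qed
qed

section \<open>The duals as bimodules, and systems from the quasi-Frobenius conditions\<close>

lemma right_dual_simps:
  "g \<in> carrier (right_dual B A h) \<longleftrightarrow> g \<in> add_hom A B \<and> g \<in> extensional (carrier A) \<and>
    (\<forall>b\<in>carrier B. \<forall>x\<in>carrier A. g (x \<otimes> h b) = g x \<otimes>\<^bsub>B\<^esub> b)"
  "\<zero>\<^bsub>right_dual B A h\<^esub> = (\<lambda>x\<in>carrier A. \<zero>\<^bsub>B\<^esub>)"
  "f \<oplus>\<^bsub>right_dual B A h\<^esub> g = (\<lambda>x\<in>carrier A. f x \<oplus>\<^bsub>B\<^esub> g x)"
  "b \<triangleright>\<^bsub>right_dual B A h\<^esub> g = (\<lambda>x\<in>carrier A. b \<otimes>\<^bsub>B\<^esub> g x)"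
  "g \<triangleleft>\<^bsub>right_dual B A h\<^esub> a = (\<lambda>x\<in>carrier A. g (a \<otimes> x))"
  by (auto simp: right_dual_def right_hom_iff)

lemma left_dual_simps:
  "g \<in> carrier (left_dual B A h) \<longleftrightarrow> g \<in> add_hom A B \<and> g \<in> extensional (carrier A) \<and>
    (\<forall>b\<in>carrier B. \<forall>x\<in>carrier A. g (h b \<otimes> x) = b \<otimes>\<^bsub>B\<^esub> g x)"
  "\<zero>\<^bsub>left_dual B A h\<^esub> = (\<lambda>x\<in>carrier A. \<zero>\<^bsub>B\<^esub>)"
  "f \<oplus>\<^bsub>left_dual B A h\<^esub> g = (\<lambda>x\<in>carrier A. f x \<oplus>\<^bsub>B\<^esub> g x)"
  "a \<triangleright>\<^bsub>left_dual B A h\<^esub> g = (\<lambda>x\<in>carrier A. g (x \<otimes> a))"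
  "g \<triangleleft>\<^bsub>left_dual B A h\<^esub> b = (\<lambda>x\<in>carrier A. g x \<otimes>\<^bsub>B\<^esub> b)"
  by (auto simp: left_dual_def left_hom_iff)

text \<open>Duals and endomorphisms are stored as extensional functions. Additivity tests arguments
  from the carrier alone and sums stay in it, so restricting changes nothing.\<close>

lemma restrict_add_hom: "(\<lambda>x\<in>carrier A. g x) \<in> add_hom A G \<longleftrightarrow> g \<in> add_hom A G"
  by (auto simp: add_hom_def Pi_iff)

lemma right_dual_bimodule: "bimodule B A (right_dual B A h)"
proof -
  let ?D = "right_dual B A h"
  have clos: "g x \<in> carrier B" if "g \<in> carrier ?D" "x \<in> carrier A" for g x
    using that by (auto simp: right_dual_simps add_hom_closed)
  have hom: "g \<in> add_hom A B" if "g \<in> carrier ?D" for g using that by (simp add: right_dual_simps)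
  have lin: "g (x \<otimes> h b) = g x \<otimes>\<^bsub>B\<^esub> b"
    if "g \<in> carrier ?D" "x \<in> carrier A" "b \<in> carrier B" for g x b
    using that by (simp add: right_dual_simps)
  have ext: "g = (\<lambda>x\<in>carrier A. g x)" if "g \<in> carrier ?D" for g
    using that by (simp add: right_dual_simps extensional_restrict)
  have memI: "(\<lambda>x\<in>carrier A. k x) \<in> carrier ?D"
    if "k \<in> add_hom A B" "\<And>b x. \<lbrakk>b \<in> carrier B; x \<in> carrier A\<rbrakk> \<Longrightarrow> k (x \<otimes> h b) = k x \<otimes>\<^bsub>B\<^esub> b" for k
    using that by (simp add: right_dual_simps restrict_add_hom)
  interpret D: abelian_group ?D
  proof (rule abelian_groupI)
    fix f assume f: "f \<in> carrier ?D"
    show "\<exists>g\<in>carrier ?D. g \<oplus>\<^bsub>?D\<^esub> f = \<zero>\<^bsub>?D\<^esub>"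
    proof
      show "(\<lambda>x\<in>carrier A. \<ominus>\<^bsub>B\<^esub> f x) \<in> carrier ?D"
        using clos[OF f] lin[OF f]
        by (intro memI add_homI) (simp_all add: add_hom_add[OF hom[OF f]] h.R.minus_add h.R.l_minus)
      show "(\<lambda>x\<in>carrier A. \<ominus>\<^bsub>B\<^esub> f x) \<oplus>\<^bsub>?D\<^esub> f = \<zero>\<^bsub>?D\<^esub>"
        using clos[OF f] by (auto simp: right_dual_simps fun_eq_iff h.R.l_neg)
    qed
    show "\<zero>\<^bsub>?D\<^esub> \<oplus>\<^bsub>?D\<^esub> f = f"
      using clos[OF f] by (subst (2) ext[OF f]) (auto simp: right_dual_simps fun_eq_iff)
    fix g assume g: "g \<in> carrier ?D"
    show "f \<oplus>\<^bsub>?D\<^esub> g \<in> carrier ?D"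
      unfolding right_dual_simps(3) using clos[OF f] clos[OF g] lin[OF f] lin[OF g]
      by (intro memI add_homI)
         (simp_all add: add_hom_add[OF hom[OF f]] add_hom_add[OF hom[OF g]] h.R.a_ac h.R.l_distr)
    show "f \<oplus>\<^bsub>?D\<^esub> g = g \<oplus>\<^bsub>?D\<^esub> f"
      using clos[OF f] clos[OF g] by (auto simp: right_dual_simps fun_eq_iff h.R.a_comm)
    fix k assume k: "k \<in> carrier ?D"
    show "f \<oplus>\<^bsub>?D\<^esub> g \<oplus>\<^bsub>?D\<^esub> k = f \<oplus>\<^bsub>?D\<^esub> (g \<oplus>\<^bsub>?D\<^esub> k)"
      using clos[OF f] clos[OF g] clos[OF k] by (auto simp: right_dual_simps fun_eq_iff h.R.a_assoc)
  next
    show "\<zero>\<^bsub>?D\<^esub> \<in> carrier ?D"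
      unfolding right_dual_simps(2) by (intro memI add_homI) simp_all
  qed
  show ?thesis
  proof unfold_locales
    fix b g assume b: "b \<in> carrier B" and g: "g \<in> carrier ?D"
    show "b \<triangleright>\<^bsub>?D\<^esub> g \<in> carrier ?D"
      unfolding right_dual_simps(4) using b clos[OF g] lin[OF g]
      by (intro memI add_homI) (simp_all add: add_hom_add[OF hom[OF g]] h.R.r_distr h.R.m_assoc)
  next
    fix a g assume a: "a \<in> carrier A" and g: "g \<in> carrier ?D"
    show "g \<triangleleft>\<^bsub>?D\<^esub> a \<in> carrier ?D"
      unfolding right_dual_simps(5) using a clos[OF g] lin[OF g]
      by (intro memI add_homI)
         (simp_all add: add_hom_add[OF hom[OF g]] h.S.r_distr h.S.m_assoc[symmetric])
  next
    fix g assume g: "g \<in> carrier ?D"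
    show "\<one>\<^bsub>B\<^esub> \<triangleright>\<^bsub>?D\<^esub> g = g" "g \<triangleleft>\<^bsub>?D\<^esub> \<one> = g"
      by (subst (2) ext[OF g]; use clos[OF g] in \<open>auto simp: right_dual_simps fun_eq_iff\<close>)+
  next
    fix a a' g assume "a \<in> carrier A" "a' \<in> carrier A" and g: "g \<in> carrier ?D"
    then show "g \<triangleleft>\<^bsub>?D\<^esub> (a \<oplus> a') = g \<triangleleft>\<^bsub>?D\<^esub> a \<oplus>\<^bsub>?D\<^esub> g \<triangleleft>\<^bsub>?D\<^esub> a'"
      by (auto simp: right_dual_simps(3,5) fun_eq_iff h.S.l_distr add_hom_add[OF hom[OF g]])
  qed (auto simp: right_dual_simps(3,4,5) fun_eq_iff clos h.R.l_distr h.R.r_distr h.R.m_assoc h.S.m_assoc)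
qed

lemma left_dual_bimodule: "bimodule A B (left_dual B A h)"
proof -
  let ?D = "left_dual B A h"
  have clos: "g x \<in> carrier B" if "g \<in> carrier ?D" "x \<in> carrier A" for g x
    using that by (auto simp: left_dual_simps add_hom_closed)
  have hom: "g \<in> add_hom A B" if "g \<in> carrier ?D" for g using that by (simp add: left_dual_simps)
  have lin: "g (h b \<otimes> x) = b \<otimes>\<^bsub>B\<^esub> g x"
    if "g \<in> carrier ?D" "x \<in> carrier A" "b \<in> carrier B" for g x b
    using that by (simp add: left_dual_simps)
  have ext: "g = (\<lambda>x\<in>carrier A. g x)" if "g \<in> carrier ?D" for g
    using that by (simp add: left_dual_simps extensional_restrict)
  have memI: "(\<lambda>x\<in>carrier A. k x) \<in> carrier ?D"
    if "k \<in> add_hom A B" "\<And>b x. \<lbrakk>b \<in> carrier B; x \<in> carrier A\<rbrakk> \<Longrightarrow> k (h b \<otimes> x) = b \<otimes>\<^bsub>B\<^esub> k x" for k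
    using that by (simp add: left_dual_simps restrict_add_hom)
  interpret D: abelian_group ?D
  proof (rule abelian_groupI)
    fix f assume f: "f \<in> carrier ?D"
    show "\<exists>g\<in>carrier ?D. g \<oplus>\<^bsub>?D\<^esub> f = \<zero>\<^bsub>?D\<^esub>"
    proof
      show "(\<lambda>x\<in>carrier A. \<ominus>\<^bsub>B\<^esub> f x) \<in> carrier ?D"
        using clos[OF f] lin[OF f]
        by (intro memI add_homI) (simp_all add: add_hom_add[OF hom[OF f]] h.R.minus_add h.R.r_minus)
      show "(\<lambda>x\<in>carrier A. \<ominus>\<^bsub>B\<^esub> f x) \<oplus>\<^bsub>?D\<^esub> f = \<zero>\<^bsub>?D\<^esub>"
        using clos[OF f] by (auto simp: left_dual_simps fun_eq_iff h.R.l_neg)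
    qed
    show "\<zero>\<^bsub>?D\<^esub> \<oplus>\<^bsub>?D\<^esub> f = f"
      using clos[OF f] by (subst (2) ext[OF f]) (auto simp: left_dual_simps fun_eq_iff)
    fix g assume g: "g \<in> carrier ?D"
    show "f \<oplus>\<^bsub>?D\<^esub> g \<in> carrier ?D"
      unfolding left_dual_simps(3) using clos[OF f] clos[OF g] lin[OF f] lin[OF g]
      by (intro memI add_homI)
         (simp_all add: add_hom_add[OF hom[OF f]] add_hom_add[OF hom[OF g]] h.R.a_ac h.R.r_distr)
    show "f \<oplus>\<^bsub>?D\<^esub> g = g \<oplus>\<^bsub>?D\<^esub> f"
      using clos[OF f] clos[OF g] by (auto simp: left_dual_simps fun_eq_iff h.R.a_comm)
    fix k assume k: "k \<in> carrier ?D"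
    show "f \<oplus>\<^bsub>?D\<^esub> g \<oplus>\<^bsub>?D\<^esub> k = f \<oplus>\<^bsub>?D\<^esub> (g \<oplus>\<^bsub>?D\<^esub> k)"
      using clos[OF f] clos[OF g] clos[OF k] by (auto simp: left_dual_simps fun_eq_iff h.R.a_assoc)
  next
    show "\<zero>\<^bsub>?D\<^esub> \<in> carrier ?D"
      unfolding left_dual_simps(2) by (intro memI add_homI) simp_all
  qed
  show ?thesis
  proof unfold_locales
    fix b g assume b: "b \<in> carrier B" and g: "g \<in> carrier ?D"
    show "g \<triangleleft>\<^bsub>?D\<^esub> b \<in> carrier ?D"
      unfolding left_dual_simps(5) using b clos[OF g] lin[OF g]
      by (intro memI add_homI) (simp_all add: add_hom_add[OF hom[OF g]] h.R.l_distr h.R.m_assoc)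
  next
    fix a g assume a: "a \<in> carrier A" and g: "g \<in> carrier ?D"
    show "a \<triangleright>\<^bsub>?D\<^esub> g \<in> carrier ?D"
      unfolding left_dual_simps(4) using a clos[OF g] lin[OF g]
      by (intro memI add_homI)
         (simp_all add: add_hom_add[OF hom[OF g]] h.S.l_distr h.S.m_assoc)
  next
    fix g assume g: "g \<in> carrier ?D"
    show "\<one> \<triangleright>\<^bsub>?D\<^esub> g = g" "g \<triangleleft>\<^bsub>?D\<^esub> \<one>\<^bsub>B\<^esub> = g"
      by (subst (2) ext[OF g]; use clos[OF g] in \<open>auto simp: left_dual_simps fun_eq_iff\<close>)+
  next
    fix a a' g assume "a \<in> carrier A" "a' \<in> carrier A" and g: "g \<in> carrier ?D"
    then show "(a \<oplus> a') \<triangleright>\<^bsub>?D\<^esub> g = a \<triangleright>\<^bsub>?D\<^esub> g \<oplus>\<^bsub>?D\<^esub> a' \<triangleright>\<^bsub>?D\<^esub> g"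
      by (auto simp: left_dual_simps(3,4) fun_eq_iff h.S.r_distr add_hom_add[OF hom[OF g]])
  qed (auto simp: left_dual_simps(3,4,5) fun_eq_iff clos h.R.l_distr h.R.r_distr h.R.m_assoc h.S.m_assoc)
qed

text \<open>Divisibility of \<open>A\<close> by its dual gives maps \<open>\<phi> j\<close> into the
  dual and \<open>\<psi> j\<close> back with \<open>\<Sum>j. \<psi>_j \<phi>_j = id\<close>. Each
  \<open>\<phi> j\<close> is determined by the form \<open>\<phi>_j(1)\<close>, each
  \<open>\<psi> j\<close> by its values on the dual basis; these are the forms and the elements
  \<open>y j k\<close>, while the \<open>x k\<close> of the dual basis serve for all
  \<open>j\<close>.\<close>

lemma right_QF_imp_right_system:
  assumes "right_QF B A h"
  obtains J :: "nat set" and K :: "'a set" and x y and \<epsilon> where "right_system B A h J K x y \<epsilon>"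
proof -
  let ?D = "right_dual B A h"
  interpret D: bimodule B A ?D by (rule right_dual_bimodule)
  obtain K :: "'a set" and x :: "'a \<Rightarrow> 'a" and f0 :: "'a \<Rightarrow> 'a \<Rightarrow> 'b" where K: "finite K"
    and x: "\<And>k. k \<in> K \<Longrightarrow> x k \<in> carrier A" and f0: "\<And>k. k \<in> K \<Longrightarrow> f0 k \<in> add_hom A B"
    and f0_lin: "\<And>k a b. \<lbrakk>k \<in> K; a \<in> carrier A; b \<in> carrier B\<rbrakk> \<Longrightarrow> f0 k (a \<otimes> h b) = f0 k a \<otimes>\<^bsub>B\<^esub> b"
    and f0_sum: "\<And>a. a \<in> carrier A \<Longrightarrow> (\<Oplus>k\<in>K. x k \<otimes> h (f0 k a)) = a"
    by (rule right_dual_basis) (use assms in \<open>auto simp: right_QF_def\<close>)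
  define f where "f k = (\<lambda>a\<in>carrier A. f0 k a)" for k
  have fD: "f k \<in> carrier ?D" if "k \<in> K" for k
    using f0 f0_lin that by (simp add: right_dual_simps f_def restrict_add_hom)
  have f_closed: "f k a \<in> carrier B" if "k \<in> K" "a \<in> carrier A" for k a
    using add_hom_closed[OF f0] that by (simp add: f_def)
  have f_sum: "(\<Oplus>k\<in>K. x k \<otimes> h (f k a)) = a" if "a \<in> carrier A" for a
    using f0_sum[OF that] that by (simp add: f_def)
  have div: "bimod_divides B A (ring_bimod h A id) ?D" using assms by (simp add: right_QF_def)
  obtain n :: nat and \<phi> \<psi> where \<phi>: "\<phi> \<in> {..<n} \<rightarrow> bimod_hom B A (ring_bimod h A id) ?D"
    and \<psi>: "\<psi> \<in> {..<n} \<rightarrow> bimod_hom B A ?D (ring_bimod h A id)"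
    and id: "\<And>a. a \<in> carrier (ring_bimod h A id) \<Longrightarrow>
      a = (\<Oplus>\<^bsub>ring_bimod h A id\<^esub>j\<in>{..<n}. \<psi> j (\<phi> j a))"
    by (rule bimod_dividesE[OF N.bimodule_axioms right_dual_bimodule div]) (rule that)
  let ?J = "{..<n}"
  have \<phi>h: "\<phi> j \<in> add_hom A ?D" "\<And>b a. \<lbrakk>b \<in> carrier B; a \<in> carrier A\<rbrakk> \<Longrightarrow> \<phi> j (h b \<otimes> a) = b \<triangleright>\<^bsub>?D\<^esub> \<phi> j a"
    "\<And>c a. \<lbrakk>c \<in> carrier A; a \<in> carrier A\<rbrakk> \<Longrightarrow> \<phi> j (a \<otimes> c) = \<phi> j a \<triangleleft>\<^bsub>?D\<^esub> c" if "j \<in> ?J" for j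
  proof -
    have "\<phi> j \<in> bimod_hom B A (ring_bimod h A id) ?D" using \<phi> that by auto
    then show "\<phi> j \<in> add_hom A ?D"
      "\<And>b a. \<lbrakk>b \<in> carrier B; a \<in> carrier A\<rbrakk> \<Longrightarrow> \<phi> j (h b \<otimes> a) = b \<triangleright>\<^bsub>?D\<^esub> \<phi> j a"
      "\<And>c a. \<lbrakk>c \<in> carrier A; a \<in> carrier A\<rbrakk> \<Longrightarrow> \<phi> j (a \<otimes> c) = \<phi> j a \<triangleleft>\<^bsub>?D\<^esub> c"
      unfolding Int_iff left_hom_iff right_hom_iff ring_bimod_simps add_hom_ring_bimod id_apply
      by blast+
  qed
  have \<psi>h: "\<psi> j \<in> add_hom ?D A" "\<And>b g. \<lbrakk>b \<in> carrier B; g \<in> carrier ?D\<rbrakk> \<Longrightarrow> \<psi> j (b \<triangleright>\<^bsub>?D\<^esub> g) = h b \<otimes> \<psi> j g"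
    "\<And>a g. \<lbrakk>a \<in> carrier A; g \<in> carrier ?D\<rbrakk> \<Longrightarrow> \<psi> j (g \<triangleleft>\<^bsub>?D\<^esub> a) = \<psi> j g \<otimes> a" if "j \<in> ?J" for j
  proof -
    have "\<psi> j \<in> bimod_hom B A ?D (ring_bimod h A id)" using \<psi> that by auto
    then show "\<psi> j \<in> add_hom ?D A"
      "\<And>b g. \<lbrakk>b \<in> carrier B; g \<in> carrier ?D\<rbrakk> \<Longrightarrow> \<psi> j (b \<triangleright>\<^bsub>?D\<^esub> g) = h b \<otimes> \<psi> j g"
      "\<And>a g. \<lbrakk>a \<in> carrier A; g \<in> carrier ?D\<rbrakk> \<Longrightarrow> \<psi> j (g \<triangleleft>\<^bsub>?D\<^esub> a) = \<psi> j g \<otimes> a"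
      unfolding Int_iff left_hom_iff right_hom_iff ring_bimod_simps add_hom_ring_bimod id_apply
      by blast+
  qed
  note \<psi>_closed = add_hom_closed[OF \<psi>h(1)]
  \<comment> \<open>The coordinate functions \<open>f k\<close> generate the dual over
    \<open>B\<close>, with coefficients \<open>g (x k)\<close>.\<close>
  have expand: "g = (\<Oplus>\<^bsub>?D\<^esub>k\<in>K. g (x k) \<triangleright>\<^bsub>?D\<^esub> f k)" if g: "g \<in> carrier ?D" for g
  proof -
    have g_hom: "g \<in> add_hom A B" and g_ext: "g \<in> extensional (carrier A)"
      and g_lin: "\<And>b x. \<lbrakk>b \<in> carrier B; x \<in> carrier A\<rbrakk> \<Longrightarrow> g (x \<otimes> h b) = g x \<otimes>\<^bsub>B\<^esub> b"
      using g by (auto simp: right_dual_simps)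
    have gx: "g (x k) \<in> carrier B" if "k \<in> K" for k using add_hom_closed[OF g_hom x[OF that]] .
    have summand: "g (x k) \<triangleright>\<^bsub>?D\<^esub> f k \<in> carrier ?D" if "k \<in> K" for k
      using that gx fD by (intro D.lact_closed)
    show ?thesis
    proof (rule extensionalityI[OF g_ext])
      have "(\<Oplus>\<^bsub>?D\<^esub>k\<in>K. g (x k) \<triangleright>\<^bsub>?D\<^esub> f k) \<in> carrier ?D"
        using summand by (intro D.M.finsum_closed) auto
      then show "(\<Oplus>\<^bsub>?D\<^esub>k\<in>K. g (x k) \<triangleright>\<^bsub>?D\<^esub> f k) \<in> extensional (carrier A)"
        by (simp add: right_dual_simps)
      fix a assume a: "a \<in> carrier A"
      have ev: "(\<lambda>g. g a) \<in> add_hom ?D B"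
        using a by (intro add_homI) (auto simp: right_dual_simps add_hom_closed)
      have "g a = g (\<Oplus>k\<in>K. x k \<otimes> h (f k a))" by (simp add: f_sum[OF a])
      also have "\<dots> = (\<Oplus>\<^bsub>B\<^esub>k\<in>K. g (x k \<otimes> h (f k a)))"
        using x a f_closed
        by (intro add_hom_finsum[OF h.S.is_abelian_group h.R.is_abelian_group g_hom]) auto
      also have "\<dots> = (\<Oplus>\<^bsub>B\<^esub>k\<in>K. (g (x k) \<triangleright>\<^bsub>?D\<^esub> f k) a)"
        using x a f_closed gx
        by (intro h.R.finsum_cong' refl) (auto simp: g_lin right_dual_simps)
      also have "\<dots> = (\<Oplus>\<^bsub>?D\<^esub>k\<in>K. g (x k) \<triangleright>\<^bsub>?D\<^esub> f k) a"
        by (intro add_hom_finsum[symmetric, OF D.M.abelian_group_axioms h.R.is_abelian_group ev] summand)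
      finally show "g a = \<dots>" .
    qed
  qed
  have \<psi>_expand: "\<psi> j g = (\<Oplus>k\<in>K. h (g (x k)) \<otimes> \<psi> j (f k))"
    if j: "j \<in> ?J" and g: "g \<in> carrier ?D" for j g
  proof -
    have gx: "g (x k) \<in> carrier B" if "k \<in> K" for k
      using g x[OF that] by (auto simp: right_dual_simps add_hom_closed)
    have "\<psi> j g = \<psi> j (\<Oplus>\<^bsub>?D\<^esub>k\<in>K. g (x k) \<triangleright>\<^bsub>?D\<^esub> f k)" using expand[OF g] by simp
    also have "\<dots> = (\<Oplus>k\<in>K. \<psi> j (g (x k) \<triangleright>\<^bsub>?D\<^esub> f k))"
      using gx fD by (intro add_hom_finsum[OF D.M.abelian_group_axioms h.S.is_abelian_group \<psi>h(1)[OF j]]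
          D.lact_closed)
    also have "\<dots> = (\<Oplus>k\<in>K. h (g (x k)) \<otimes> \<psi> j (f k))"
      using gx fD j \<psi>_closed by (intro h.S.finsum_cong' refl) (auto simp: \<psi>h(2))
    finally show ?thesis .
  qed
  define \<epsilon> where "\<epsilon> j = \<phi> j \<one>" for j
  have \<epsilon>D: "\<epsilon> j \<in> carrier ?D" if "j \<in> ?J" for j
    unfolding \<epsilon>_def by (rule add_hom_closed[OF \<phi>h(1)[OF that]]) simp
  have \<phi>_eq: "\<phi> j a = \<epsilon> j \<triangleleft>\<^bsub>?D\<^esub> a" if "j \<in> ?J" "a \<in> carrier A" for j a
    using \<phi>h(3)[OF that(1) that(2), of "\<one>"] that(2) by (simp add: \<epsilon>_def)
  have \<epsilon>: "\<epsilon> j \<in> bilinear_forms B A h" if j: "j \<in> ?J" for j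
  proof -
    have "\<epsilon> j (h b \<otimes> a) = b \<otimes>\<^bsub>B\<^esub> \<epsilon> j a" if "b \<in> carrier B" "a \<in> carrier A" for b a
    proof -
      \<comment> \<open>Both sides are \<open>\<phi> j (h b)\<close>, once with \<open>h b\<close>
        read as \<open>\<one> \<otimes> h b\<close> and once as \<open>h b \<otimes> \<one>\<close>.
        This supplies left linearity of the form; right linearity is membership in the dual.\<close>
      have "\<epsilon> j \<triangleleft>\<^bsub>?D\<^esub> h b = b \<triangleright>\<^bsub>?D\<^esub> \<epsilon> j"
        using \<phi>_eq[OF j, of "h b"] \<phi>h(2)[OF j, of b "\<one>"] that(1) by (simp add: \<epsilon>_def)
      from fun_cong[OF this, of a] show ?thesis using that by (simp add: right_dual_simps)
    qed
    with \<epsilon>D[OF j] show ?thesis by (auto simp: bilinear_forms_iff right_dual_simps)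
  qed
  have "casimir B A h K x (\<lambda>k. \<psi> j (f k))" if j: "j \<in> ?J" for j
    unfolding casimir_def
  proof (intro conjI ballI)
    show "x \<in> K \<rightarrow> carrier A" "(\<lambda>k. \<psi> j (f k)) \<in> K \<rightarrow> carrier A"
      using x fD \<psi>_closed[OF j] by auto
    fix a assume a: "a \<in> carrier A"
    show "\<exists>b. (\<forall>l\<in>K. \<forall>k\<in>K. b l k \<in> carrier B) \<and>
        (\<forall>k\<in>K. a \<otimes> x k = (\<Oplus>l\<in>K. x l \<otimes> h (b l k))) \<and>
        (\<forall>l\<in>K. \<psi> j (f l) \<otimes> a = (\<Oplus>k\<in>K. h (b l k) \<otimes> \<psi> j (f k)))"
    \<comment> \<open>The matrix of left multiplication by \<open>a\<close> in the dual basis. Its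
      entries are also the coefficients of the translate of \<open>f l\<close> by \<open>a\<close>,
      since that functional takes the value \<open>f l (a \<otimes> x k)\<close> at
      \<open>x k\<close>; so one matrix satisfies both equations.\<close>
    proof (intro exI[of _ "\<lambda>l k. f l (a \<otimes> x k)"] conjI ballI)
      fix l k assume "l \<in> K" "k \<in> K"
      then show "f l (a \<otimes> x k) \<in> carrier B" using a x f_closed by simp
    next
      fix k assume "k \<in> K"
      then show "a \<otimes> x k = (\<Oplus>l\<in>K. x l \<otimes> h (f l (a \<otimes> x k)))"
        using f_sum[of "a \<otimes> x k"] a x by simp
    next
      fix l assume l: "l \<in> K"
      have "\<psi> j (f l) \<otimes> a = (\<Oplus>k\<in>K. h ((f l \<triangleleft>\<^bsub>?D\<^esub> a) (x k)) \<otimes> \<psi> j (f k))"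
        using \<psi>h(3)[OF j a fD[OF l]] \<psi>_expand[OF j D.ract_closed[OF a fD[OF l]]] by simp
      also have "\<dots> = (\<Oplus>k\<in>K. h (f l (a \<otimes> x k)) \<otimes> \<psi> j (f k))"
        using x l a f_closed \<psi>_closed[OF j] fD
        by (intro h.S.finsum_cong' refl) (auto simp: right_dual_simps(5))
      finally show "\<psi> j (f l) \<otimes> a = \<dots>" .
    qed
  qed
  moreover have "(\<Oplus>j\<in>?J. \<Oplus>k\<in>K. h (\<epsilon> j (a \<otimes> x k)) \<otimes> \<psi> j (f k)) = a"
    if a: "a \<in> carrier A" for a
  proof -
    have t_closed: "h (\<epsilon> j (a \<otimes> x k)) \<otimes> \<psi> j (f k) \<in> carrier A" if "j \<in> ?J" "k \<in> K" for j k
      using that a x bilinear_formsD(2)[OF \<epsilon>] \<psi>_closed fD by auto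
    have "a = (\<Oplus>j\<in>?J. \<psi> j (\<phi> j a))" using id[of a] a by simp
    also have "\<dots> = (\<Oplus>j\<in>?J. \<Oplus>k\<in>K. h (\<epsilon> j (a \<otimes> x k)) \<otimes> \<psi> j (f k))"
    proof (rule h.S.finsum_cong'[OF refl])
      show "(\<lambda>j. \<Oplus>k\<in>K. h (\<epsilon> j (a \<otimes> x k)) \<otimes> \<psi> j (f k)) \<in> ?J \<rightarrow> carrier A"
        using t_closed by (auto intro!: h.S.finsum_closed)
      fix j assume j: "j \<in> ?J"
      \<comment> \<open>As \<open>\<phi> j a\<close> is the translate of \<open>\<epsilon> j\<close>
        by \<open>a\<close>, its coefficients are \<open>\<epsilon> j (a \<otimes> x k)\<close>.
        Summing over \<open>j\<close> gives back \<open>a\<close>.\<close>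
      have "\<psi> j (\<phi> j a) = (\<Oplus>k\<in>K. h ((\<epsilon> j \<triangleleft>\<^bsub>?D\<^esub> a) (x k)) \<otimes> \<psi> j (f k))"
        unfolding \<phi>_eq[OF j a] by (rule \<psi>_expand[OF j D.ract_closed[OF a \<epsilon>D[OF j]]])
      also have "\<dots> = (\<Oplus>k\<in>K. h (\<epsilon> j (a \<otimes> x k)) \<otimes> \<psi> j (f k))"
        using t_closed[OF j] x by (intro h.S.finsum_cong' refl) (auto simp: right_dual_simps(5))
      finally show "\<psi> j (\<phi> j a) = \<dots>" .
    qed
    finally show ?thesis by simp
  qed
  ultimately have "right_system B A h ?J K (\<lambda>_. x) (\<lambda>j k. \<psi> j (f k)) \<epsilon>"
    using K \<epsilon> unfolding right_system_def by blast
  then show thesis by (rule that)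
qed

text \<open>The mirror argument. Here the left dual basis provides the \<open>y k\<close>, common to
  all \<open>j\<close>, and the values \<open>\<psi> j (f k)\<close> take the place of the
  \<open>x j k\<close>.\<close>

lemma left_QF_imp_left_system:
  assumes "left_QF B A h"
  obtains J :: "nat set" and K :: "'a set" and x y and \<epsilon> where "left_system B A h J K x y \<epsilon>"
proof -
  let ?D = "left_dual B A h" and ?V = "ring_bimod id A h"
  interpret D: bimodule A B ?D by (rule left_dual_bimodule)
  have V: "bimodule A B ?V"
    by (intro ring_bimod_bimodule ring_hom_ring_id h.S.ring_axioms h.ring_hom_ring_axioms)
  obtain K :: "'a set" and y :: "'a \<Rightarrow> 'a" and f0 :: "'a \<Rightarrow> 'a \<Rightarrow> 'b" where K: "finite K"
    and y: "\<And>k. k \<in> K \<Longrightarrow> y k \<in> carrier A" and f0: "\<And>k. k \<in> K \<Longrightarrow> f0 k \<in> add_hom A B"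
    and f0_lin: "\<And>k a b. \<lbrakk>k \<in> K; a \<in> carrier A; b \<in> carrier B\<rbrakk> \<Longrightarrow> f0 k (h b \<otimes> a) = b \<otimes>\<^bsub>B\<^esub> f0 k a"
    and f0_sum: "\<And>a. a \<in> carrier A \<Longrightarrow> (\<Oplus>k\<in>K. h (f0 k a) \<otimes> y k) = a"
    by (rule left_dual_basis) (use assms in \<open>auto simp: left_QF_def\<close>)
  define f where "f k = (\<lambda>a\<in>carrier A. f0 k a)" for k
  have fD: "f k \<in> carrier ?D" if "k \<in> K" for k
    using f0 f0_lin that by (simp add: left_dual_simps f_def restrict_add_hom)
  have f_closed: "f k a \<in> carrier B" if "k \<in> K" "a \<in> carrier A" for k a
    using add_hom_closed[OF f0] that by (simp add: f_def)
  have f_sum: "(\<Oplus>k\<in>K. h (f k a) \<otimes> y k) = a" if "a \<in> carrier A" for a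
    using f0_sum[OF that] that by (simp add: f_def)
  have div: "bimod_divides A B ?V ?D" using assms by (simp add: left_QF_def)
  obtain n :: nat and \<phi> \<psi> where \<phi>: "\<phi> \<in> {..<n} \<rightarrow> bimod_hom A B ?V ?D"
    and \<psi>: "\<psi> \<in> {..<n} \<rightarrow> bimod_hom A B ?D ?V"
    and id: "\<And>a. a \<in> carrier ?V \<Longrightarrow> a = (\<Oplus>\<^bsub>?V\<^esub>j\<in>{..<n}. \<psi> j (\<phi> j a))"
    by (rule bimod_dividesE[OF V left_dual_bimodule div]) (rule that)
  let ?J = "{..<n}"
  have \<phi>h: "\<phi> j \<in> add_hom A ?D" "\<And>b a. \<lbrakk>b \<in> carrier B; a \<in> carrier A\<rbrakk> \<Longrightarrow> \<phi> j (a \<otimes> h b) = \<phi> j a \<triangleleft>\<^bsub>?D\<^esub> b"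
    "\<And>c a. \<lbrakk>c \<in> carrier A; a \<in> carrier A\<rbrakk> \<Longrightarrow> \<phi> j (c \<otimes> a) = c \<triangleright>\<^bsub>?D\<^esub> \<phi> j a" if "j \<in> ?J" for j
  proof -
    have "\<phi> j \<in> bimod_hom A B ?V ?D" using \<phi> that by auto
    then show "\<phi> j \<in> add_hom A ?D"
      "\<And>b a. \<lbrakk>b \<in> carrier B; a \<in> carrier A\<rbrakk> \<Longrightarrow> \<phi> j (a \<otimes> h b) = \<phi> j a \<triangleleft>\<^bsub>?D\<^esub> b"
      "\<And>c a. \<lbrakk>c \<in> carrier A; a \<in> carrier A\<rbrakk> \<Longrightarrow> \<phi> j (c \<otimes> a) = c \<triangleright>\<^bsub>?D\<^esub> \<phi> j a"
      unfolding Int_iff left_hom_iff right_hom_iff ring_bimod_simps add_hom_ring_bimod id_apply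
      by blast+
  qed
  have \<psi>h: "\<psi> j \<in> add_hom ?D A" "\<And>b g. \<lbrakk>b \<in> carrier B; g \<in> carrier ?D\<rbrakk> \<Longrightarrow> \<psi> j (g \<triangleleft>\<^bsub>?D\<^esub> b) = \<psi> j g \<otimes> h b"
    "\<And>a g. \<lbrakk>a \<in> carrier A; g \<in> carrier ?D\<rbrakk> \<Longrightarrow> \<psi> j (a \<triangleright>\<^bsub>?D\<^esub> g) = a \<otimes> \<psi> j g" if "j \<in> ?J" for j
  proof -
    have "\<psi> j \<in> bimod_hom A B ?D ?V" using \<psi> that by auto
    then show "\<psi> j \<in> add_hom ?D A"
      "\<And>b g. \<lbrakk>b \<in> carrier B; g \<in> carrier ?D\<rbrakk> \<Longrightarrow> \<psi> j (g \<triangleleft>\<^bsub>?D\<^esub> b) = \<psi> j g \<otimes> h b"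
      "\<And>a g. \<lbrakk>a \<in> carrier A; g \<in> carrier ?D\<rbrakk> \<Longrightarrow> \<psi> j (a \<triangleright>\<^bsub>?D\<^esub> g) = a \<otimes> \<psi> j g"
      unfolding Int_iff left_hom_iff right_hom_iff ring_bimod_simps add_hom_ring_bimod id_apply
      by blast+
  qed
  note \<psi>_closed = add_hom_closed[OF \<psi>h(1)]
  have expand: "g = (\<Oplus>\<^bsub>?D\<^esub>k\<in>K. f k \<triangleleft>\<^bsub>?D\<^esub> g (y k))" if g: "g \<in> carrier ?D" for g
  proof -
    have g_hom: "g \<in> add_hom A B" and g_ext: "g \<in> extensional (carrier A)"
      and g_lin: "\<And>b x. \<lbrakk>b \<in> carrier B; x \<in> carrier A\<rbrakk> \<Longrightarrow> g (h b \<otimes> x) = b \<otimes>\<^bsub>B\<^esub> g x"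
      using g by (auto simp: left_dual_simps)
    have gy: "g (y k) \<in> carrier B" if "k \<in> K" for k using add_hom_closed[OF g_hom y[OF that]] .
    have summand: "f k \<triangleleft>\<^bsub>?D\<^esub> g (y k) \<in> carrier ?D" if "k \<in> K" for k
      using that gy fD by (intro D.ract_closed)
    show ?thesis
    proof (rule extensionalityI[OF g_ext])
      have "(\<Oplus>\<^bsub>?D\<^esub>k\<in>K. f k \<triangleleft>\<^bsub>?D\<^esub> g (y k)) \<in> carrier ?D"
        using summand by (intro D.M.finsum_closed) auto
      then show "(\<Oplus>\<^bsub>?D\<^esub>k\<in>K. f k \<triangleleft>\<^bsub>?D\<^esub> g (y k)) \<in> extensional (carrier A)"
        by (simp add: left_dual_simps)
      fix a assume a: "a \<in> carrier A"
      have ev: "(\<lambda>g. g a) \<in> add_hom ?D B"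
        using a by (intro add_homI) (auto simp: left_dual_simps add_hom_closed)
      have "g a = g (\<Oplus>k\<in>K. h (f k a) \<otimes> y k)" by (simp add: f_sum[OF a])
      also have "\<dots> = (\<Oplus>\<^bsub>B\<^esub>k\<in>K. g (h (f k a) \<otimes> y k))"
        using y a f_closed
        by (intro add_hom_finsum[OF h.S.is_abelian_group h.R.is_abelian_group g_hom]) auto
      also have "\<dots> = (\<Oplus>\<^bsub>B\<^esub>k\<in>K. (f k \<triangleleft>\<^bsub>?D\<^esub> g (y k)) a)"
        using y a f_closed gy
        by (intro h.R.finsum_cong' refl) (auto simp: g_lin left_dual_simps)
      also have "\<dots> = (\<Oplus>\<^bsub>?D\<^esub>k\<in>K. f k \<triangleleft>\<^bsub>?D\<^esub> g (y k)) a"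
        by (intro add_hom_finsum[symmetric, OF D.M.abelian_group_axioms h.R.is_abelian_group ev] summand)
      finally show "g a = \<dots>" .
    qed
  qed
  have \<psi>_expand: "\<psi> j g = (\<Oplus>k\<in>K. \<psi> j (f k) \<otimes> h (g (y k)))"
    if j: "j \<in> ?J" and g: "g \<in> carrier ?D" for j g
  proof -
    have gy: "g (y k) \<in> carrier B" if "k \<in> K" for k
      using g y[OF that] by (auto simp: left_dual_simps add_hom_closed)
    have "\<psi> j g = \<psi> j (\<Oplus>\<^bsub>?D\<^esub>k\<in>K. f k \<triangleleft>\<^bsub>?D\<^esub> g (y k))" using expand[OF g] by simp
    also have "\<dots> = (\<Oplus>k\<in>K. \<psi> j (f k \<triangleleft>\<^bsub>?D\<^esub> g (y k)))"
      using gy fD by (intro add_hom_finsum[OF D.M.abelian_group_axioms h.S.is_abelian_group \<psi>h(1)[OF j]]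
          D.ract_closed)
    also have "\<dots> = (\<Oplus>k\<in>K. \<psi> j (f k) \<otimes> h (g (y k)))"
      using gy fD j \<psi>_closed by (intro h.S.finsum_cong' refl) (auto simp: \<psi>h(2))
    finally show ?thesis .
  qed
  define \<epsilon> where "\<epsilon> j = \<phi> j \<one>" for j
  have \<epsilon>D: "\<epsilon> j \<in> carrier ?D" if "j \<in> ?J" for j
    unfolding \<epsilon>_def by (rule add_hom_closed[OF \<phi>h(1)[OF that]]) simp
  have \<phi>_eq: "\<phi> j a = a \<triangleright>\<^bsub>?D\<^esub> \<epsilon> j" if "j \<in> ?J" "a \<in> carrier A" for j a
    using \<phi>h(3)[OF that(1) that(2), of "\<one>"] that(2) by (simp add: \<epsilon>_def)
  have \<epsilon>: "\<epsilon> j \<in> bilinear_forms B A h" if j: "j \<in> ?J" for j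
  proof -
    have "\<epsilon> j (a \<otimes> h b) = \<epsilon> j a \<otimes>\<^bsub>B\<^esub> b" if "b \<in> carrier B" "a \<in> carrier A" for b a
    proof -
      have "h b \<triangleright>\<^bsub>?D\<^esub> \<epsilon> j = \<epsilon> j \<triangleleft>\<^bsub>?D\<^esub> b"
        using \<phi>_eq[OF j, of "h b"] \<phi>h(2)[OF j, of b "\<one>"] that(1) by (simp add: \<epsilon>_def)
      from fun_cong[OF this, of a] show ?thesis using that by (simp add: left_dual_simps)
    qed
    with \<epsilon>D[OF j] show ?thesis by (auto simp: bilinear_forms_iff left_dual_simps)
  qed
  have "casimir B A h K (\<lambda>k. \<psi> j (f k)) y" if j: "j \<in> ?J" for j
    unfolding casimir_def
  proof (intro conjI ballI)
    show "y \<in> K \<rightarrow> carrier A" "(\<lambda>k. \<psi> j (f k)) \<in> K \<rightarrow> carrier A"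
      using y fD \<psi>_closed[OF j] by auto
    fix a assume a: "a \<in> carrier A"
    show "\<exists>b. (\<forall>l\<in>K. \<forall>k\<in>K. b l k \<in> carrier B) \<and>
        (\<forall>k\<in>K. a \<otimes> \<psi> j (f k) = (\<Oplus>l\<in>K. \<psi> j (f l) \<otimes> h (b l k))) \<and>
        (\<forall>l\<in>K. y l \<otimes> a = (\<Oplus>k\<in>K. h (b l k) \<otimes> y k))"
    \<comment> \<open>The matrix of right multiplication by \<open>a\<close> in the left dual
      basis.\<close>
    proof (intro exI[of _ "\<lambda>l k. f k (y l \<otimes> a)"] conjI ballI)
      fix l k assume "l \<in> K" "k \<in> K"
      then show "f k (y l \<otimes> a) \<in> carrier B" using a y f_closed by simp
    next
      fix l assume "l \<in> K"
      then show "y l \<otimes> a = (\<Oplus>k\<in>K. h (f k (y l \<otimes> a)) \<otimes> y k)"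
        using f_sum[of "y l \<otimes> a"] a y by simp
    next
      fix k assume k: "k \<in> K"
      have "a \<otimes> \<psi> j (f k) = (\<Oplus>l\<in>K. \<psi> j (f l) \<otimes> h ((a \<triangleright>\<^bsub>?D\<^esub> f k) (y l)))"
        using \<psi>h(3)[OF j a fD[OF k]] \<psi>_expand[OF j D.lact_closed[OF a fD[OF k]]] by simp
      also have "\<dots> = (\<Oplus>l\<in>K. \<psi> j (f l) \<otimes> h (f k (y l \<otimes> a)))"
        using y k a f_closed \<psi>_closed[OF j] fD
        by (intro h.S.finsum_cong' refl) (auto simp: left_dual_simps(4))
      finally show "a \<otimes> \<psi> j (f k) = \<dots>" .
    qed
  qed
  moreover have "(\<Oplus>j\<in>?J. \<Oplus>k\<in>K. \<psi> j (f k) \<otimes> h (\<epsilon> j (y k \<otimes> a))) = a"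
    if a: "a \<in> carrier A" for a
  proof -
    have t_closed: "\<psi> j (f k) \<otimes> h (\<epsilon> j (y k \<otimes> a)) \<in> carrier A" if "j \<in> ?J" "k \<in> K" for j k
      using that a y bilinear_formsD(2)[OF \<epsilon>] \<psi>_closed fD by auto
    have "a = (\<Oplus>j\<in>?J. \<psi> j (\<phi> j a))" using id[of a] a by simp
    also have "\<dots> = (\<Oplus>j\<in>?J. \<Oplus>k\<in>K. \<psi> j (f k) \<otimes> h (\<epsilon> j (y k \<otimes> a)))"
    proof (rule h.S.finsum_cong'[OF refl])
      show "(\<lambda>j. \<Oplus>k\<in>K. \<psi> j (f k) \<otimes> h (\<epsilon> j (y k \<otimes> a))) \<in> ?J \<rightarrow> carrier A"
        using t_closed by (auto intro!: h.S.finsum_closed)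
      fix j assume j: "j \<in> ?J"
      have "\<psi> j (\<phi> j a) = (\<Oplus>k\<in>K. \<psi> j (f k) \<otimes> h ((a \<triangleright>\<^bsub>?D\<^esub> \<epsilon> j) (y k)))"
        unfolding \<phi>_eq[OF j a] by (rule \<psi>_expand[OF j D.lact_closed[OF a \<epsilon>D[OF j]]])
      also have "\<dots> = (\<Oplus>k\<in>K. \<psi> j (f k) \<otimes> h (\<epsilon> j (y k \<otimes> a)))"
        using t_closed[OF j] y by (intro h.S.finsum_cong' refl) (auto simp: left_dual_simps(4))
      finally show "\<psi> j (\<phi> j a) = \<dots>" .
    qed
    finally show ?thesis by simp
  qed
  ultimately have "left_system B A h ?J K (\<lambda>j k. \<psi> j (f k)) (\<lambda>_. y) \<epsilon>"
    using K \<epsilon> unfolding left_system_def by blast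
  then show thesis by (rule that)
qed

end

section \<open>The endomorphism ring\<close>

context extension
begin

abbreviation "E \<equiv> End_ring B A h"
abbreviation "lam \<equiv> left_mult A"

lemma End_ring_simps:
  "f \<in> carrier E \<longleftrightarrow> f \<in> add_hom A A \<and> f \<in> extensional (carrier A) \<and>
    (\<forall>b\<in>carrier B. \<forall>x\<in>carrier A. f (x \<otimes> h b) = f x \<otimes> h b)"
  "f \<otimes>\<^bsub>E\<^esub> g = compose (carrier A) f g"
  "\<one>\<^bsub>E\<^esub> = (\<lambda>x\<in>carrier A. x)"
  "\<zero>\<^bsub>E\<^esub> = (\<lambda>x\<in>carrier A. \<zero>)"
  "f \<oplus>\<^bsub>E\<^esub> g = (\<lambda>x\<in>carrier A. f x \<oplus> g x)"
  by (auto simp: End_ring_def right_hom_iff)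

lemma End_ringD:
  assumes "f \<in> carrier E"
  shows "f \<in> add_hom A A" "f \<in> extensional (carrier A)"
    and "x \<in> carrier A \<Longrightarrow> f x \<in> carrier A"
    and "\<lbrakk>x \<in> carrier A; b \<in> carrier B\<rbrakk> \<Longrightarrow> f (x \<otimes> h b) = f x \<otimes> h b"
    and "\<lbrakk>x \<in> carrier A; y \<in> carrier A\<rbrakk> \<Longrightarrow> f (x \<oplus> y) = f x \<oplus> f y"
  using assms by (auto simp: End_ring_simps(1) add_hom_closed add_hom_add)

lemma End_ring_restrictI:
  assumes "f \<in> add_hom A A"
    and "\<And>b x. \<lbrakk>b \<in> carrier B; x \<in> carrier A\<rbrakk> \<Longrightarrow> f (x \<otimes> h b) = f x \<otimes> h b"
  shows "(\<lambda>x\<in>carrier A. f x) \<in> carrier E"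
  using assms by (simp add: End_ring_simps(1) restrict_add_hom)

lemma End_ring_eqI:
  "\<lbrakk>f \<in> carrier E; g \<in> carrier E; \<And>x. x \<in> carrier A \<Longrightarrow> f x = g x\<rbrakk> \<Longrightarrow> f = g"
  by (rule extensionalityI[of f "carrier A"]) (auto simp: End_ringD(2))

lemma End_mult_apply: "x \<in> carrier A \<Longrightarrow> (f \<otimes>\<^bsub>E\<^esub> g) x = f (g x)"
  by (simp add: End_ring_simps compose_def)

lemma End_mult_closed: "\<lbrakk>f \<in> carrier E; g \<in> carrier E\<rbrakk> \<Longrightarrow> f \<otimes>\<^bsub>E\<^esub> g \<in> carrier E"
  unfolding End_ring_simps(2) compose_def
  by (rule End_ring_restrictI) (auto simp: End_ringD intro!: add_hom_comp[of g A A f A])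

lemma End_add_closed: "\<lbrakk>f \<in> carrier E; g \<in> carrier E\<rbrakk> \<Longrightarrow> f \<oplus>\<^bsub>E\<^esub> g \<in> carrier E"
  unfolding End_ring_simps(5)
  by (intro End_ring_restrictI add_homI) (simp_all add: End_ringD h.S.l_distr h.S.a_ac)

lemma End_ring_ring: "ring E"
proof (rule ringI)
  show "abelian_group E"
  proof (rule abelian_groupI)
    show zero: "\<zero>\<^bsub>E\<^esub> \<in> carrier E"
      unfolding End_ring_simps(4) by (intro End_ring_restrictI add_homI) simp_all
    fix f assume f: "f \<in> carrier E"
    show "\<zero>\<^bsub>E\<^esub> \<oplus>\<^bsub>E\<^esub> f = f"
      by (rule End_ring_eqI[OF End_add_closed[OF zero f] f])
         (simp add: End_ring_simps End_ringD(3)[OF f])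
    have m: "(\<lambda>x\<in>carrier A. \<ominus> f x) \<in> carrier E"
      using f by (intro End_ring_restrictI add_homI) (simp_all add: End_ringD h.S.minus_add h.S.l_minus)
    have "(\<lambda>x\<in>carrier A. \<ominus> f x) \<oplus>\<^bsub>E\<^esub> f = \<zero>\<^bsub>E\<^esub>"
      by (rule End_ring_eqI[OF End_add_closed[OF m f] zero])
         (simp add: End_ring_simps End_ringD(3)[OF f] h.S.l_neg)
    with m show "\<exists>g\<in>carrier E. g \<oplus>\<^bsub>E\<^esub> f = \<zero>\<^bsub>E\<^esub>" by blast
    fix g assume g: "g \<in> carrier E"
    show "f \<oplus>\<^bsub>E\<^esub> g \<in> carrier E" by (rule End_add_closed[OF f g])
    show "f \<oplus>\<^bsub>E\<^esub> g = g \<oplus>\<^bsub>E\<^esub> f"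
      by (rule End_ring_eqI[OF End_add_closed[OF f g] End_add_closed[OF g f]])
         (simp add: End_ring_simps(5) End_ringD(3)[OF f] End_ringD(3)[OF g] h.S.a_comm)
    fix k assume k: "k \<in> carrier E"
    show "f \<oplus>\<^bsub>E\<^esub> g \<oplus>\<^bsub>E\<^esub> k = f \<oplus>\<^bsub>E\<^esub> (g \<oplus>\<^bsub>E\<^esub> k)"
      by (rule End_ring_eqI[OF End_add_closed[OF End_add_closed[OF f g] k]
            End_add_closed[OF f End_add_closed[OF g k]]])
         (simp add: End_ring_simps(5) End_ringD(3)[OF f] End_ringD(3)[OF g] End_ringD(3)[OF k] h.S.a_assoc)
  qed
  have one: "\<one>\<^bsub>E\<^esub> \<in> carrier E"
    unfolding End_ring_simps(3) by (intro End_ring_restrictI add_homI) simp_all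
  show "monoid E"
  proof (rule monoidI)
    show "\<one>\<^bsub>E\<^esub> \<in> carrier E" by (rule one)
    fix f assume f: "f \<in> carrier E"
    show "\<one>\<^bsub>E\<^esub> \<otimes>\<^bsub>E\<^esub> f = f" "f \<otimes>\<^bsub>E\<^esub> \<one>\<^bsub>E\<^esub> = f"
      by (rule End_ring_eqI[OF End_mult_closed[OF one f] f],
          simp add: End_mult_apply End_ring_simps(3) End_ringD(3)[OF f])
         (rule End_ring_eqI[OF End_mult_closed[OF f one] f],
          simp add: End_mult_apply End_ring_simps(3) End_ringD(3)[OF f])
    fix g assume g: "g \<in> carrier E"
    show "f \<otimes>\<^bsub>E\<^esub> g \<in> carrier E" by (rule End_mult_closed[OF f g])
    fix k assume k: "k \<in> carrier E"
    show "f \<otimes>\<^bsub>E\<^esub> g \<otimes>\<^bsub>E\<^esub> k = f \<otimes>\<^bsub>E\<^esub> (g \<otimes>\<^bsub>E\<^esub> k)"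
      by (rule End_ring_eqI[OF End_mult_closed[OF End_mult_closed[OF f g] k]
            End_mult_closed[OF f End_mult_closed[OF g k]]])
         (simp add: End_mult_apply End_ringD(3)[OF g] End_ringD(3)[OF k])
  qed
  fix f g k assume f: "f \<in> carrier E" and g: "g \<in> carrier E" and k: "k \<in> carrier E"
  note D = End_ringD(3)[OF f] End_ringD(3)[OF g] End_ringD(3)[OF k]
  show "(f \<oplus>\<^bsub>E\<^esub> g) \<otimes>\<^bsub>E\<^esub> k = f \<otimes>\<^bsub>E\<^esub> k \<oplus>\<^bsub>E\<^esub> g \<otimes>\<^bsub>E\<^esub> k"
    by (rule End_ring_eqI[OF End_mult_closed[OF End_add_closed[OF f g] k]
          End_add_closed[OF End_mult_closed[OF f k] End_mult_closed[OF g k]]])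
       (simp add: End_mult_apply End_ring_simps(5) D)
  show "k \<otimes>\<^bsub>E\<^esub> (f \<oplus>\<^bsub>E\<^esub> g) = k \<otimes>\<^bsub>E\<^esub> f \<oplus>\<^bsub>E\<^esub> k \<otimes>\<^bsub>E\<^esub> g"
    by (rule End_ring_eqI[OF End_mult_closed[OF k End_add_closed[OF f g]]
          End_add_closed[OF End_mult_closed[OF k f] End_mult_closed[OF k g]]])
       (simp add: End_mult_apply End_ring_simps(5) D End_ringD(5)[OF k])
qed

lemma lam_apply [simp]: "x \<in> carrier A \<Longrightarrow> lam a x = a \<otimes> x"
  by (simp add: left_mult_def)

lemma lam_closed [simp]: "a \<in> carrier A \<Longrightarrow> lam a \<in> carrier E"
  unfolding left_mult_def
  by (intro End_ring_restrictI mult_add_homs(2)) (simp_all add: h.S.m_assoc)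

lemma lam_ring_hom: "ring_hom_ring A E lam"
proof (intro ring_hom_ringI h.S.ring_axioms End_ring_ring)
  interpret E: ring E by (rule End_ring_ring)
  show "lam \<one> = \<one>\<^bsub>E\<^esub>"
    by (intro End_ring_eqI E.one_closed) (simp_all add: End_ring_simps(3))
  fix a c assume ac: "a \<in> carrier A" "c \<in> carrier A"
  show "lam (a \<otimes> c) = lam a \<otimes>\<^bsub>E\<^esub> lam c"
    using ac by (intro End_ring_eqI E.m_closed) (simp_all add: End_mult_apply h.S.m_assoc)
  show "lam (a \<oplus> c) = lam a \<oplus>\<^bsub>E\<^esub> lam c"
    using ac by (intro End_ring_eqI E.a_closed) (simp_all add: End_ring_simps(5) h.S.l_distr)
qed simp

lemma End_apply_hom: "x \<in> carrier A \<Longrightarrow> (\<lambda>f. f x) \<in> add_hom E A"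
  by (intro add_homI) (simp_all add: End_ringD End_ring_simps(5))

lemma End_finsum_apply:
  assumes "x \<in> carrier A" "\<And>i. i \<in> I \<Longrightarrow> f i \<in> carrier E"
  shows "(\<Oplus>\<^bsub>E\<^esub>i\<in>I. f i) x = (\<Oplus>i\<in>I. f i x)"
  by (rule add_hom_finsum[OF ring.is_abelian_group[OF End_ring_ring] h.S.is_abelian_group
        End_apply_hom[OF assms(1)] assms(2)])

text \<open>Specializes the general passage from depth three to depth two to the tower
  \<open>B \<rightarrow> A \<rightarrow> E\<close>. The required retractions come from the maps
  \<open>w \<mapsto> \<Sum>k. w(x_jk) \<otimes> y_jk\<close> from \<open>E\<close> to
  \<open>A \<otimes> A\<close> over \<open>B\<close>, combined with the multiplication of
  \<open>E\<close>.\<close>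

theorem End_right_D3_imp_right_D2:
  assumes D3: "right_D3_tower B A E h lam" and sys: "right_system B A h J K x y \<epsilon>"
  shows "right_D2 B E (lam \<circ> h)"
proof -
  interpret W: tower B A E h lam
    by (intro tower.intro h.ring_hom_ring_axioms lam_ring_hom)
  interpret R: tower B B E id "lam \<circ> h" rewrites "lam \<circ> h \<circ> id = lam \<circ> h"
    by (intro tower.intro ring_hom_ring_id h.R.ring_axioms W.hk.ring_hom_ring_axioms) simp
  have J: "finite J" and K: "finite K"
    and cas: "\<And>j. j \<in> J \<Longrightarrow> casimir B A h K (x j) (y j)"
    and \<epsilon>: "\<And>j. j \<in> J \<Longrightarrow> \<epsilon> j \<in> bilinear_forms B A h"
    and sum: "\<And>a. a \<in> carrier A \<Longrightarrow>
      (\<Oplus>j\<in>J. \<Oplus>k\<in>K. h (\<epsilon> j (a \<otimes> x j k)) \<otimes> y j k) = a"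
    using sys unfolding right_system_def by blast+
  note xA = casimirD(1)[OF cas] and yA = casimirD(2)[OF cas] and \<epsilon>D = bilinear_formsD[OF \<epsilon>]
  have lam_hom: "lam \<in> add_hom A E" by (auto simp: add_hom_def)
  have mult_homs: "(\<lambda>u. u \<otimes>\<^bsub>E\<^esub> w) \<in> add_hom E E" "(\<lambda>u. w \<otimes>\<^bsub>E\<^esub> u) \<in> add_hom E E"
    if "w \<in> carrier E" for w
    using that by (auto intro!: add_homI simp: W.h.S.l_distr W.h.S.r_distr)
  have Rl: "(\<lambda>u. R.pure u v) \<in> add_hom E R.T" and Rr: "R.pure v \<in> add_hom E R.T"
    if "v \<in> carrier E" for v
    using R.pure_hom_left[of v] R.pure_hom_right[of v] that by simp_all
  \<comment> \<open>The form \<open>\<epsilon> j\<close> followed by \<open>h\<close>, as an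
    endomorphism of \<open>A\<close>. It lies in \<open>E\<close> by right linearity of the form and
    commutes with the image of \<open>B\<close> by left linearity.\<close>
  define e where "e j = (\<lambda>a\<in>carrier A. h (\<epsilon> j a))" for j
  have e: "e j \<in> carrier E" if "j \<in> J" for j
    unfolding e_def using \<epsilon>D[OF that]
    by (intro End_ring_restrictI add_hom_comp[OF \<epsilon>D(1)[OF that] h_add_hom]) simp_all
  have e_comm: "e j \<otimes>\<^bsub>E\<^esub> lam (h b) = lam (h b) \<otimes>\<^bsub>E\<^esub> e j" if "j \<in> J" "b \<in> carrier B" for j b
    using that by (intro End_ring_eqI W.h.S.m_closed)
      (simp_all add: e End_mult_apply, simp add: e_def \<epsilon>D(2,3))
  \<comment> \<open>\<open>w\<close> is evaluated at \<open>x j k\<close>, re-enters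
    \<open>E\<close> as a left multiplication, and \<open>y j k\<close> is absorbed into
    \<open>v\<close>.\<close>
  define tm where "tm j k w v = R.pure (lam (w (x j k))) (lam (y j k) \<otimes>\<^bsub>E\<^esub> v)" for j k w v
  have tm_closed: "tm j k w v \<in> carrier R.T"
    if "j \<in> J" "k \<in> K" "w \<in> carrier E" "v \<in> carrier E" for j k w v
    unfolding tm_def using that by (intro R.pure_closed) (simp_all add: xA yA End_ringD(3))
  have "\<exists>\<theta>\<in>add_hom W.T R.T. \<forall>w\<in>carrier E. \<forall>v\<in>carrier E.
      \<theta> (W.pure w v) = (\<Oplus>\<^bsub>R.T\<^esub>k\<in>K. tm j k w v)" if j: "j \<in> J" for j
  proof -
    have "balanced A (ring_bimod id E lam) (ring_bimod lam E (lam \<circ> h)) R.T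
        (\<lambda>w v. \<Oplus>\<^bsub>R.T\<^esub>k\<in>K. tm j k w v)"
      unfolding balanced_def ring_bimod_simps add_hom_ring_bimod
    proof (intro conjI ballI)
      fix w assume w: "w \<in> carrier E"
      show "(\<lambda>v. \<Oplus>\<^bsub>R.T\<^esub>k\<in>K. tm j k w v) \<in> add_hom E R.T"
      proof (rule add_hom_sum[OF R.T.abelian_group_axioms])
        fix k assume k: "k \<in> K"
        show "tm j k w \<in> add_hom E R.T"
          unfolding tm_def using w j k
          by (intro add_hom_comp[OF mult_homs(2) Rr]) (simp_all add: xA yA End_ringD(3))
      qed
    next
      fix v assume v: "v \<in> carrier E"
      show "(\<lambda>w. \<Oplus>\<^bsub>R.T\<^esub>k\<in>K. tm j k w v) \<in> add_hom E R.T"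
      proof (rule add_hom_sum[OF R.T.abelian_group_axioms])
        fix k assume k: "k \<in> K"
        show "(\<lambda>w. tm j k w v) \<in> add_hom E R.T"
          unfolding tm_def using v j k
          by (intro add_hom_comp[OF add_hom_comp[OF End_apply_hom lam_hom] Rl])
             (simp_all add: xA yA)
      qed
    next
      fix w a v assume w: "w \<in> carrier E" and a: "a \<in> carrier A" and v: "v \<in> carrier E"
      \<comment> \<open>Balance over \<open>A\<close> is the Casimir property:
        \<open>w \<otimes> lam a\<close> takes \<open>x j k\<close> to
        \<open>w (a \<otimes> x j k)\<close>, and \<open>a\<close> moves across to
        \<open>y j k \<otimes> a\<close>. The displayed map is balanced over \<open>B\<close>
        because \<open>w\<close> is right \<open>B\<close>-linear.\<close>
      have "balanced B (ring_bimod h A h) (ring_bimod h A h) R.T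
          (\<lambda>p q. R.pure (lam (w p)) (lam q \<otimes>\<^bsub>E\<^esub> v))"
        unfolding balanced_def ring_bimod_simps add_hom_ring_bimod
      proof (intro conjI ballI)
        fix p assume "p \<in> carrier A"
        then show "(\<lambda>q. R.pure (lam (w p)) (lam q \<otimes>\<^bsub>E\<^esub> v)) \<in> add_hom A R.T"
          using w v by (intro add_hom_comp[OF add_hom_comp[OF lam_hom mult_homs(1)] Rr])
            (simp_all add: End_ringD(3))
      next
        fix q assume "q \<in> carrier A"
        then show "(\<lambda>p. R.pure (lam (w p)) (lam q \<otimes>\<^bsub>E\<^esub> v)) \<in> add_hom A R.T"
          using w v by (intro add_hom_comp[OF add_hom_comp[OF End_ringD(1) lam_hom] Rl]) simp_all
      next
        fix p b q assume "p \<in> carrier A" "b \<in> carrier B" "q \<in> carrier A"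
        then show "R.pure (lam (w (p \<otimes> h b))) (lam q \<otimes>\<^bsub>E\<^esub> v)
            = R.pure (lam (w p)) (lam (h b \<otimes> q) \<otimes>\<^bsub>E\<^esub> v)"
          using w v R.pure_mid[of b "lam (w p)" "lam q \<otimes>\<^bsub>E\<^esub> v"]
          by (simp add: End_ringD(3,4) W.h.S.m_assoc)
      qed
      from casimir_balanced[OF h.ring_hom_ring_axioms cas[OF j] R.T.abelian_group_axioms this a]
      have *: "(\<Oplus>\<^bsub>R.T\<^esub>k\<in>K. R.pure (lam (w (a \<otimes> x j k))) (lam (y j k) \<otimes>\<^bsub>E\<^esub> v))
          = (\<Oplus>\<^bsub>R.T\<^esub>k\<in>K. R.pure (lam (w (x j k))) (lam (y j k \<otimes> a) \<otimes>\<^bsub>E\<^esub> v))" .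
      have "(\<Oplus>\<^bsub>R.T\<^esub>k\<in>K. tm j k (w \<otimes>\<^bsub>E\<^esub> lam a) v)
          = (\<Oplus>\<^bsub>R.T\<^esub>k\<in>K. R.pure (lam (w (a \<otimes> x j k))) (lam (y j k) \<otimes>\<^bsub>E\<^esub> v))"
        unfolding tm_def using w a v j
        by (intro R.T.finsum_cong' refl) (auto simp: End_mult_apply xA yA End_ringD(3))
      moreover have "(\<Oplus>\<^bsub>R.T\<^esub>k\<in>K. tm j k w (lam a \<otimes>\<^bsub>E\<^esub> v))
          = (\<Oplus>\<^bsub>R.T\<^esub>k\<in>K. R.pure (lam (w (x j k))) (lam (y j k \<otimes> a) \<otimes>\<^bsub>E\<^esub> v))"
        unfolding tm_def using w a v j
        by (intro R.T.finsum_cong' refl) (auto simp: xA yA End_ringD(3) W.h.S.m_assoc)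
      ultimately show "(\<Oplus>\<^bsub>R.T\<^esub>k\<in>K. tm j k (w \<otimes>\<^bsub>E\<^esub> lam a) v) = (\<Oplus>\<^bsub>R.T\<^esub>k\<in>K. tm j k w (lam a \<otimes>\<^bsub>E\<^esub> v))"
        using * by simp
    qed
    from W.tensor_lift_exists[OF R.T.abelian_group_axioms this] show ?thesis
      unfolding ring_bimod_simps .
  qed
  then obtain \<theta> where \<theta>: "\<And>j. j \<in> J \<Longrightarrow> \<theta> j \<in> add_hom W.T R.T"
    and \<theta>_pure: "\<And>j w v. \<lbrakk>j \<in> J; w \<in> carrier E; v \<in> carrier E\<rbrakk> \<Longrightarrow>
      \<theta> j (W.pure w v) = (\<Oplus>\<^bsub>R.T\<^esub>k\<in>K. tm j k w v)"
    by metis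
  note eqI = W.tensor_hom_eqI[OF R.T.abelian_group_axioms]
  show ?thesis
  proof (rule W.right_D3_imp_right_D2[OF D3 J e e_comm \<theta>])
    fix j a u assume j: "j \<in> J" and a: "a \<in> carrier A" and u: "u \<in> carrier W.T"
    have la: "lam a \<in> carrier E" using a by simp
    show "\<theta> j (lam a \<triangleright>\<^bsub>W.T\<^esub> u) = lam a \<triangleright>\<^bsub>R.T\<^esub> \<theta> j u"
    proof (rule eqI[OF add_hom_comp[OF W.lact_hom[OF la] \<theta>[OF j]] add_hom_comp[OF \<theta>[OF j] R.lact_hom[OF la]] _ u])
      fix w v assume "w \<in> carrier (ring_bimod id E lam)" "v \<in> carrier (ring_bimod lam E (lam \<circ> h))"
      then have w: "w \<in> carrier E" and v: "v \<in> carrier E" by simp_all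
      have "lam a \<triangleright>\<^bsub>R.T\<^esub> (\<Oplus>\<^bsub>R.T\<^esub>k\<in>K. tm j k w v) = (\<Oplus>\<^bsub>R.T\<^esub>k\<in>K. lam a \<triangleright>\<^bsub>R.T\<^esub> tm j k w v)"
        using tm_closed[OF j _ w v] la by (intro R.TB.lact_finsum)
      also have "\<dots> = (\<Oplus>\<^bsub>R.T\<^esub>k\<in>K. tm j k (lam a \<otimes>\<^bsub>E\<^esub> w) v)"
        using tm_closed[OF j _ _ v] w v a j
        by (intro R.T.finsum_cong' refl)
           (auto simp: tm_def R.lact_pure xA yA End_ringD(3) End_mult_apply)
      finally show "\<theta> j (lam a \<triangleright>\<^bsub>W.T\<^esub> W.pure w v) = lam a \<triangleright>\<^bsub>R.T\<^esub> \<theta> j (W.pure w v)"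
        using w v la j by (simp add: W.lact_pure \<theta>_pure)
    qed
  next
    fix j b u assume j: "j \<in> J" and b: "b \<in> carrier B" and u: "u \<in> carrier W.T"
    show "\<theta> j (u \<triangleleft>\<^bsub>W.T\<^esub> b) = \<theta> j u \<triangleleft>\<^bsub>R.T\<^esub> b"
    proof (rule eqI[OF add_hom_comp[OF W.ract_hom[OF b] \<theta>[OF j]] add_hom_comp[OF \<theta>[OF j] R.ract_hom[OF b]] _ u])
      fix w v assume "w \<in> carrier (ring_bimod id E lam)" "v \<in> carrier (ring_bimod lam E (lam \<circ> h))"
      then have w: "w \<in> carrier E" and v: "v \<in> carrier E" by simp_all
      have "(\<Oplus>\<^bsub>R.T\<^esub>k\<in>K. tm j k w v) \<triangleleft>\<^bsub>R.T\<^esub> b = (\<Oplus>\<^bsub>R.T\<^esub>k\<in>K. tm j k w v \<triangleleft>\<^bsub>R.T\<^esub> b)"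
        using tm_closed[OF j _ w v] b by (intro R.TB.ract_finsum)
      also have "\<dots> = (\<Oplus>\<^bsub>R.T\<^esub>k\<in>K. tm j k w (v \<otimes>\<^bsub>E\<^esub> lam (h b)))"
        using tm_closed[OF j _ w] w v b j
        by (intro R.T.finsum_cong' refl)
           (auto simp: tm_def R.ract_pure xA yA End_ringD(3) W.h.S.m_assoc)
      finally show "\<theta> j (W.pure w v \<triangleleft>\<^bsub>W.T\<^esub> b) = \<theta> j (W.pure w v) \<triangleleft>\<^bsub>R.T\<^esub> b"
        using w v b j by (simp add: W.ract_pure \<theta>_pure)
    qed
  next
    fix v assume v: "v \<in> carrier E"
    have t_closed: "h (\<epsilon> j (x j k)) \<otimes> y j k \<in> carrier A" if "j \<in> J" "k \<in> K" for j k
      using that by (simp add: \<epsilon>D(2) xA yA)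
    have \<Phi>: "(\<lambda>a. R.pure \<one>\<^bsub>E\<^esub> (lam a \<otimes>\<^bsub>E\<^esub> v)) \<in> add_hom A R.T"
      using v by (intro add_hom_comp[OF add_hom_comp[OF lam_hom mult_homs(1)] Rr]) simp_all
    note \<Phi>_sum = add_hom_finsum[OF h.S.is_abelian_group R.T.abelian_group_axioms \<Phi>]
    \<comment> \<open>The reproducing formula of the right system at the unit. Since the values
      \<open>h (\<epsilon> j (x j k))\<close> are \<open>e j\<close> at \<open>x j k\<close>, it
      says that the retractions applied to the \<open>e j\<close> add up to
      \<open>1 \<otimes> 1\<close>.\<close>
    have "\<one> = (\<Oplus>j\<in>J. \<Oplus>k\<in>K. h (\<epsilon> j (\<one> \<otimes> x j k)) \<otimes> y j k)"
      using sum[of "\<one>"] by simp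
    also have "\<dots> = (\<Oplus>j\<in>J. \<Oplus>k\<in>K. h (\<epsilon> j (x j k)) \<otimes> y j k)"
      using t_closed by (intro h.S.finsum_cong' refl) (auto simp: xA intro!: h.S.finsum_closed h.S.finsum_cong')
    finally have one: "\<one> = (\<Oplus>j\<in>J. \<Oplus>k\<in>K. h (\<epsilon> j (x j k)) \<otimes> y j k)" .
    have "R.pure \<one>\<^bsub>E\<^esub> v = R.pure \<one>\<^bsub>E\<^esub> (lam \<one> \<otimes>\<^bsub>E\<^esub> v)" using v by simp
    also have "\<dots> = (\<Oplus>\<^bsub>R.T\<^esub>j\<in>J. R.pure \<one>\<^bsub>E\<^esub> (lam (\<Oplus>k\<in>K. h (\<epsilon> j (x j k)) \<otimes> y j k) \<otimes>\<^bsub>E\<^esub> v))"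
      by (subst one, rule \<Phi>_sum) (use t_closed in \<open>auto intro!: h.S.finsum_closed\<close>)
    also have "\<dots> = (\<Oplus>\<^bsub>R.T\<^esub>j\<in>J. \<theta> j (W.pure (e j) v))"
    proof (rule R.T.finsum_cong'[OF refl])
      show "(\<lambda>j. \<theta> j (W.pure (e j) v)) \<in> J \<rightarrow> carrier R.T"
        using v by (auto intro!: add_hom_closed[OF \<theta>] W.pure_closed simp: e)
      fix j assume j: "j \<in> J"
      have "R.pure \<one>\<^bsub>E\<^esub> (lam (\<Oplus>k\<in>K. h (\<epsilon> j (x j k)) \<otimes> y j k) \<otimes>\<^bsub>E\<^esub> v)
          = (\<Oplus>\<^bsub>R.T\<^esub>k\<in>K. R.pure \<one>\<^bsub>E\<^esub> (lam (h (\<epsilon> j (x j k)) \<otimes> y j k) \<otimes>\<^bsub>E\<^esub> v))"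
        using t_closed[OF j] by (rule \<Phi>_sum)
      also have "\<dots> = (\<Oplus>\<^bsub>R.T\<^esub>k\<in>K. tm j k (e j) v)"
      proof (rule R.T.finsum_cong'[OF refl])
        show "(\<lambda>k. tm j k (e j) v) \<in> K \<rightarrow> carrier R.T" using tm_closed[OF j _ e[OF j] v] by auto
        fix k assume k: "k \<in> K"
        have b: "\<epsilon> j (x j k) \<in> carrier B" using \<epsilon>D(2)[OF j xA[OF j k]] .
        \<comment> \<open>The value of \<open>\<epsilon> j\<close> lies in \<open>B\<close>, so it
          crosses to the first factor and becomes left multiplication by \<open>e j\<close>
          evaluated at \<open>x j k\<close>.\<close>
        show "R.pure \<one>\<^bsub>E\<^esub> (lam (h (\<epsilon> j (x j k)) \<otimes> y j k) \<otimes>\<^bsub>E\<^esub> v) = tm j k (e j) v"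
          using R.pure_mid[OF b, of "\<one>\<^bsub>E\<^esub>" "lam (y j k) \<otimes>\<^bsub>E\<^esub> v"] b v xA[OF j k] yA[OF j k]
          by (simp add: tm_def e_def W.h.S.m_assoc)
      qed
      finally show "R.pure \<one>\<^bsub>E\<^esub> (lam (\<Oplus>k\<in>K. h (\<epsilon> j (x j k)) \<otimes> y j k) \<otimes>\<^bsub>E\<^esub> v) = \<theta> j (W.pure (e j) v)"
        using e[OF j] v j by (simp add: \<theta>_pure)
    qed
    finally show "R.pure \<one>\<^bsub>E\<^esub> v = (\<Oplus>\<^bsub>R.T\<^esub>j\<in>J. \<theta> j (W.pure (e j) v))" .
  qed
qed

text \<open>A transitivity argument: in the pair \<open>(i, j)\<close> the index \<open>i\<close>
  belongs to \<open>A/B\<close> and \<open>j\<close> to \<open>E/A\<close>. The form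
  \<open>\<delta>\<close> is \<open>\<epsilon>_i\<close> after the map
  \<open>w \<mapsto> \<Sum>m. w(x_jm) y_jm\<close> from \<open>E\<close> to \<open>A\<close>. The
  elements \<open>u\<close> and \<open>v\<close> factor through \<open>B\<close>, with the dual
  basis \<open>r, f\<close> of \<open>A\<close> over \<open>B\<close> on the outer sides and the
  Casimir element of index \<open>i\<close> on the inner sides.\<close>

theorem End_left_system:
  fixes r :: "'l \<Rightarrow> 'a"
  assumes sys: "left_system B A h J K x y \<epsilon>" and L: "finite L"
    and r: "\<And>l. l \<in> L \<Longrightarrow> r l \<in> carrier A" and f: "\<And>l. l \<in> L \<Longrightarrow> f l \<in> add_hom A B"
    and f_lin: "\<And>l a b. \<lbrakk>l \<in> L; a \<in> carrier A; b \<in> carrier B\<rbrakk> \<Longrightarrow> f l (a \<otimes> h b) = f l a \<otimes>\<^bsub>B\<^esub> b"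
    and f_sum: "\<And>a. a \<in> carrier A \<Longrightarrow> (\<Oplus>l\<in>L. r l \<otimes> h (f l a)) = a"
  defines "u \<equiv> \<lambda>p q. \<lambda>z\<in>carrier A. r (fst q) \<otimes> h (\<epsilon> (snd p) (x (fst p) (snd q) \<otimes> z))"
    and "v \<equiv> \<lambda>p q. \<lambda>z\<in>carrier A. y (fst p) (snd q) \<otimes> h (f (fst q) z)"
    and "\<delta> \<equiv> \<lambda>p w. \<epsilon> (fst p) (\<Oplus>m\<in>K. w (x (snd p) m) \<otimes> y (snd p) m)"
  shows "left_system B E (lam \<circ> h) (J \<times> J) (L \<times> K) u v \<delta>"
proof -
  interpret lam: ring_hom_ring A E lam by (rule lam_ring_hom)
  have J: "finite J" and K: "finite K"
    and cas: "\<And>j. j \<in> J \<Longrightarrow> casimir B A h K (x j) (y j)"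
    and \<epsilon>: "\<And>j. j \<in> J \<Longrightarrow> \<epsilon> j \<in> bilinear_forms B A h"
    and sum: "\<And>a. a \<in> carrier A \<Longrightarrow>
      (\<Oplus>j\<in>J. \<Oplus>k\<in>K. x j k \<otimes> h (\<epsilon> j (y j k \<otimes> a))) = a"
    using sys unfolding left_system_def by blast+
  note xA [simp] = casimirD(1)[OF cas] and yA [simp] = casimirD(2)[OF cas]
  note \<epsilon>D = bilinear_formsD[OF \<epsilon>]
  have [simp]: "\<epsilon> j a \<in> carrier B" if "j \<in> J" "a \<in> carrier A" for j a using \<epsilon>D(2) that by blast
  have fB [simp]: "f l a \<in> carrier B" if "l \<in> L" "a \<in> carrier A" for l a
    using add_hom_closed[OF f] that by blast
  note [simp] = r
  have wA [simp]: "w a \<in> carrier A" if "w \<in> carrier E" "a \<in> carrier A" for w a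
    using End_ringD(3) that by blast
  have \<Phi>: "(\<lambda>a. r l \<otimes> h (\<epsilon> j (a \<otimes> z))) \<in> add_hom A A"
    if "l \<in> L" "j \<in> J" "z \<in> carrier A" for l j z
    using that by (intro add_homI) (simp_all add: h.S.l_distr h.S.r_distr add_hom_add[OF \<epsilon>D(1)])
  note \<Phi>_sum = add_hom_finsum[OF h.S.is_abelian_group h.S.is_abelian_group \<Phi>]
  have u_eq: "u (i, j) (l, m) = (\<lambda>z\<in>carrier A. r l \<otimes> h (\<epsilon> j (x i m \<otimes> z)))"
    and v_eq: "v (i, j) (l, m) = (\<lambda>z\<in>carrier A. y i m \<otimes> h (f l z))" for i j l m
    by (simp_all add: u_def v_def)
  have u: "u (i, j) (l, m) \<in> carrier E" if "i \<in> J" "j \<in> J" "l \<in> L" "m \<in> K" for i j l m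
    unfolding u_eq using that
    by (intro End_ring_restrictI add_homI)
       (simp_all add: h.S.r_distr add_hom_add[OF \<epsilon>D(1)] \<epsilon>D(4) h.S.m_assoc[symmetric])
  have v: "v (i, j) (l, m) \<in> carrier E" if "i \<in> J" "j \<in> J" "l \<in> L" "m \<in> K" for i j l m
    unfolding v_eq using that
    by (intro End_ring_restrictI add_homI)
       (simp_all add: h.S.r_distr add_hom_add[OF f] f_lin h.S.m_assoc)
  have casimir: "casimir B E (lam \<circ> h) (L \<times> K) (u (i, j)) (v (i, j))" if i: "i \<in> J" and j: "j \<in> J" for i j
    unfolding casimir_def
  proof (intro conjI ballI)
    show "u (i, j) \<in> L \<times> K \<rightarrow> carrier E" "v (i, j) \<in> L \<times> K \<rightarrow> carrier E"
      using u v i j by auto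
    fix w assume w: "w \<in> carrier E"
    \<comment> \<open>The matrix over \<open>B\<close> of the endomorphism \<open>w\<close> in the
      dual basis.\<close>
    define b where "b l k = f l (w (r k))" for l k
    have b [simp]: "b l k \<in> carrier B" if "l \<in> L" "k \<in> L" for l k
      using that w by (simp add: b_def)
    define M where "M l k c \<longleftrightarrow> (\<forall>n\<in>K. \<forall>m\<in>K. c n m \<in> carrier B) \<and>
        (\<forall>m\<in>K. h (b l k) \<otimes> x i m = (\<Oplus>n\<in>K. x i n \<otimes> h (c n m))) \<and>
        (\<forall>n\<in>K. y i n \<otimes> h (b l k) = (\<Oplus>m\<in>K. h (c n m) \<otimes> y i m))" for l k c
    \<comment> \<open>For each entry of the matrix of \<open>w\<close>, a matrix by which that entry
      commutes with the Casimir element of index \<open>i\<close>; the choice is made once for all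
      pairs of indices.\<close>
    define c where "c l k = (SOME c. M l k c)" for l k
    have M: "M l k (c l k)" if "l \<in> L" "k \<in> L" for l k
    proof -
      have hb: "h (b l k) \<in> carrier A" using that by simp
      have "\<exists>c. M l k c"
        unfolding M_def by (rule casimirE[OF cas[OF i] hb]) (rule exI, intro conjI ballI)
      then show ?thesis unfolding c_def by (rule someI_ex)
    qed
    have c: "c l k n m \<in> carrier B" if "l \<in> L" "k \<in> L" "n \<in> K" "m \<in> K" for l k n m
      using M[OF that(1,2), unfolded M_def, THEN conjunct1] that(3,4) by blast
    have cx: "h (b l k) \<otimes> x i m = (\<Oplus>n\<in>K. x i n \<otimes> h (c l k n m))"
      if "l \<in> L" "k \<in> L" "m \<in> K" for l k m
      using M[OF that(1,2), unfolded M_def, THEN conjunct2, THEN conjunct1] that(3) by (rule bspec)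
    have cy: "y i n \<otimes> h (b l k) = (\<Oplus>m\<in>K. h (c l k n m) \<otimes> y i m)"
      if "l \<in> L" "k \<in> L" "n \<in> K" for l k n
      using M[OF that(1,2), unfolded M_def, THEN conjunct2, THEN conjunct2] that(3) by (rule bspec)
    note [simp] = c
    \<comment> \<open>The block matrix obtained by replacing every entry \<open>b l k\<close> by its
      matrix \<open>c l k\<close>. It is the witness for \<open>w\<close> over
      \<open>L \<times> K\<close>.\<close>
    define d where "d q' q = c (fst q') (fst q) (snd q') (snd q)" for q' q
    have d [simp]: "d q' q \<in> carrier B" if "q' \<in> L \<times> K" "q \<in> L \<times> K" for q' q
      using that by (auto simp: d_def)
    have left: "w \<otimes>\<^bsub>E\<^esub> u (i, j) (k, m) = (\<Oplus>\<^bsub>E\<^esub>q'\<in>L \<times> K. u (i, j) q' \<otimes>\<^bsub>E\<^esub> (lam \<circ> h) (d q' (k, m)))"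
      if k: "k \<in> L" and m: "m \<in> K" for k m
    proof (rule End_ring_eqI)
      have km: "(k, m) \<in> L \<times> K" using k m by simp
      have tE: "u (i, j) q' \<otimes>\<^bsub>E\<^esub> (lam \<circ> h) (d q' (k, m)) \<in> carrier E" if "q' \<in> L \<times> K" for q'
        using u[OF i j] d[OF that km] that by auto
      show "w \<otimes>\<^bsub>E\<^esub> u (i, j) (k, m) \<in> carrier E" using w u[OF i j k m] by simp
      show "(\<Oplus>\<^bsub>E\<^esub>q'\<in>L \<times> K. u (i, j) q' \<otimes>\<^bsub>E\<^esub> (lam \<circ> h) (d q' (k, m))) \<in> carrier E"
        using tE by (intro lam.S.finsum_closed) auto
      fix z assume z: "z \<in> carrier A"
      have "(w \<otimes>\<^bsub>E\<^esub> u (i, j) (k, m)) z = w (r k) \<otimes> h (\<epsilon> j (x i m \<otimes> z))"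
        using z k m i j w by (simp add: End_mult_apply u_eq End_ringD(4))
      also have "w (r k) = (\<Oplus>l\<in>L. r l \<otimes> h (b l k))"
        using f_sum[of "w (r k)"] w k by (simp add: b_def)
      also have "\<dots> \<otimes> h (\<epsilon> j (x i m \<otimes> z))
          = (\<Oplus>l\<in>L. r l \<otimes> h (b l k) \<otimes> h (\<epsilon> j (x i m \<otimes> z)))"
        using z k m i j by (intro h.S.finsum_ldistr L) auto
      also have "\<dots> = (\<Oplus>l\<in>L. \<Oplus>n\<in>K. r l \<otimes> h (\<epsilon> j (x i n \<otimes> h (c l k n m) \<otimes> z)))"
      proof (rule h.S.finsum_cong'[OF refl])
        show "(\<lambda>l. \<Oplus>n\<in>K. r l \<otimes> h (\<epsilon> j (x i n \<otimes> h (c l k n m) \<otimes> z))) \<in> L \<rightarrow> carrier A"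
          using z k m i j by (auto intro!: h.S.finsum_closed)
        fix l assume l: "l \<in> L"
        \<comment> \<open>The entry enters \<open>\<epsilon> j\<close> by left linearity, meets
          \<open>x i m\<close> and is replaced by its matrix, whose entries come out to the right of
          the \<open>x i n\<close>.\<close>
        have "r l \<otimes> h (b l k) \<otimes> h (\<epsilon> j (x i m \<otimes> z))
            = r l \<otimes> h (\<epsilon> j (h (b l k) \<otimes> x i m \<otimes> z))"
          using z k m i j l by (simp add: h.S.m_assoc \<epsilon>D(3))
        also have "\<dots> = (\<Oplus>n\<in>K. r l \<otimes> h (\<epsilon> j (x i n \<otimes> h (c l k n m) \<otimes> z)))"
          unfolding cx[OF l k m] using z k m i l by (intro \<Phi>_sum[OF l j z]) simp
        finally show "r l \<otimes> h (b l k) \<otimes> h (\<epsilon> j (x i m \<otimes> z)) = \<dots>" .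
      qed
      also have "\<dots> = (\<Oplus>q'\<in>L \<times> K. r (fst q') \<otimes>
          h (\<epsilon> j (x i (snd q') \<otimes> h (c (fst q') k (snd q') m) \<otimes> z)))"
        using z k m i j by (intro h.S.finsum_Times[symmetric] L K) simp
      also have "\<dots> = (\<Oplus>q'\<in>L \<times> K. (u (i, j) q' \<otimes>\<^bsub>E\<^esub> (lam \<circ> h) (d q' (k, m))) z)"
        using z k m i j
        by (intro h.S.finsum_cong' refl) (auto simp: End_mult_apply u_eq d_def h.S.m_assoc)
      also have "\<dots> = (\<Oplus>\<^bsub>E\<^esub>q'\<in>L \<times> K. u (i, j) q' \<otimes>\<^bsub>E\<^esub> (lam \<circ> h) (d q' (k, m))) z"
        by (rule End_finsum_apply[OF z tE, symmetric])
      finally show "(w \<otimes>\<^bsub>E\<^esub> u (i, j) (k, m)) z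
        = (\<Oplus>\<^bsub>E\<^esub>q'\<in>L \<times> K. u (i, j) q' \<otimes>\<^bsub>E\<^esub> (lam \<circ> h) (d q' (k, m))) z" .
    qed
    have right: "v (i, j) (l, n) \<otimes>\<^bsub>E\<^esub> w = (\<Oplus>\<^bsub>E\<^esub>q\<in>L \<times> K. (lam \<circ> h) (d (l, n) q) \<otimes>\<^bsub>E\<^esub> v (i, j) q)"
      if l: "l \<in> L" and n: "n \<in> K" for l n
    proof (rule End_ring_eqI)
      have ln: "(l, n) \<in> L \<times> K" using l n by simp
      have tE: "(lam \<circ> h) (d (l, n) q) \<otimes>\<^bsub>E\<^esub> v (i, j) q \<in> carrier E" if "q \<in> L \<times> K" for q
        using v[OF i j] d[OF ln that] that by auto
      show "v (i, j) (l, n) \<otimes>\<^bsub>E\<^esub> w \<in> carrier E" using w v[OF i j l n] by simp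
      show "(\<Oplus>\<^bsub>E\<^esub>q\<in>L \<times> K. (lam \<circ> h) (d (l, n) q) \<otimes>\<^bsub>E\<^esub> v (i, j) q) \<in> carrier E"
        using tE by (intro lam.S.finsum_closed) auto
      fix z assume z: "z \<in> carrier A"
      have \<Xi>: "(\<lambda>a. y i n \<otimes> h (f l (w a))) \<in> add_hom A A"
        using l n i w by (intro add_homI)
          (simp_all add: End_ringD(5) h.S.r_distr add_hom_add[OF f])
      have "(v (i, j) (l, n) \<otimes>\<^bsub>E\<^esub> w) z = y i n \<otimes> h (f l (w z))"
        using z w by (simp add: End_mult_apply v_eq)
      \<comment> \<open>Expanding \<open>z\<close> in the dual basis produces the entries
        \<open>f l (w (r k))\<close>, which then meet \<open>y i n\<close>.\<close>
      also have "\<dots> = y i n \<otimes> h (f l (w (\<Oplus>k\<in>L. r k \<otimes> h (f k z))))"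
        by (simp add: f_sum[OF z])
      also have "\<dots> = (\<Oplus>k\<in>L. y i n \<otimes> h (f l (w (r k \<otimes> h (f k z)))))"
        using z by (intro add_hom_finsum[OF h.S.is_abelian_group h.S.is_abelian_group \<Xi>]) simp
      also have "\<dots> = (\<Oplus>k\<in>L. \<Oplus>m\<in>K. h (c l k n m) \<otimes> y i m \<otimes> h (f k z))"
      proof (rule h.S.finsum_cong'[OF refl])
        show "(\<lambda>k. \<Oplus>m\<in>K. h (c l k n m) \<otimes> y i m \<otimes> h (f k z)) \<in> L \<rightarrow> carrier A"
          using z l n i by (auto intro!: h.S.finsum_closed)
        fix k assume k: "k \<in> L"
        have "y i n \<otimes> h (f l (w (r k \<otimes> h (f k z)))) = y i n \<otimes> h (b l k) \<otimes> h (f k z)"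
          using z l n i k w by (simp add: End_ringD(4) f_lin b_def h.S.m_assoc)
        also have "\<dots> = (\<Oplus>m\<in>K. h (c l k n m) \<otimes> y i m \<otimes> h (f k z))"
          unfolding cy[OF l k n] using z l n i k by (intro h.S.finsum_ldistr K) auto
        finally show "y i n \<otimes> h (f l (w (r k \<otimes> h (f k z)))) = \<dots>" .
      qed
      also have "\<dots> = (\<Oplus>q\<in>L \<times> K. h (c l (fst q) n (snd q)) \<otimes> y i (snd q) \<otimes> h (f (fst q) z))"
        using z l n i by (intro h.S.finsum_Times[symmetric] L K) simp
      also have "\<dots> = (\<Oplus>q\<in>L \<times> K. ((lam \<circ> h) (d (l, n) q) \<otimes>\<^bsub>E\<^esub> v (i, j) q) z)"
        using z l n i
        by (intro h.S.finsum_cong' refl) (auto simp: End_mult_apply v_eq d_def h.S.m_assoc)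
      also have "\<dots> = (\<Oplus>\<^bsub>E\<^esub>q\<in>L \<times> K. (lam \<circ> h) (d (l, n) q) \<otimes>\<^bsub>E\<^esub> v (i, j) q) z"
        by (rule End_finsum_apply[OF z tE, symmetric])
      finally show "(v (i, j) (l, n) \<otimes>\<^bsub>E\<^esub> w) z
        = (\<Oplus>\<^bsub>E\<^esub>q\<in>L \<times> K. (lam \<circ> h) (d (l, n) q) \<otimes>\<^bsub>E\<^esub> v (i, j) q) z" .
    qed
    show "\<exists>b. (\<forall>l\<in>L \<times> K. \<forall>k\<in>L \<times> K. b l k \<in> carrier B) \<and>
        (\<forall>k\<in>L \<times> K. w \<otimes>\<^bsub>E\<^esub> u (i, j) k = (\<Oplus>\<^bsub>E\<^esub>l\<in>L \<times> K. u (i, j) l \<otimes>\<^bsub>E\<^esub> (lam \<circ> h) (b l k))) \<and>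
        (\<forall>l\<in>L \<times> K. v (i, j) l \<otimes>\<^bsub>E\<^esub> w = (\<Oplus>\<^bsub>E\<^esub>k\<in>L \<times> K. (lam \<circ> h) (b l k) \<otimes>\<^bsub>E\<^esub> v (i, j) k))"
    proof (intro exI[of _ d] conjI ballI)
      fix q assume "q \<in> L \<times> K"
      then obtain k m where q: "q = (k, m)" "k \<in> L" "m \<in> K" by blast
      show "w \<otimes>\<^bsub>E\<^esub> u (i, j) q = (\<Oplus>\<^bsub>E\<^esub>l\<in>L \<times> K. u (i, j) l \<otimes>\<^bsub>E\<^esub> (lam \<circ> h) (d l q))"
        unfolding q(1) by (rule left[OF q(2,3)])
      show "v (i, j) q \<otimes>\<^bsub>E\<^esub> w = (\<Oplus>\<^bsub>E\<^esub>k\<in>L \<times> K. (lam \<circ> h) (d q k) \<otimes>\<^bsub>E\<^esub> v (i, j) k)"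
        unfolding q(1) by (rule right[OF q(2,3)])
    qed (rule d)
  qed
  have S_closed [simp]: "(\<Oplus>m\<in>K. w (x j m) \<otimes> y j m) \<in> carrier A" if "j \<in> J" "w \<in> carrier E" for j w
    using that by (intro h.S.finsum_closed) auto
  have \<delta>: "\<delta> (i, j) \<in> bilinear_forms B E (lam \<circ> h)" if i: "i \<in> J" and j: "j \<in> J" for i j
  proof -
    have S_hom: "(\<lambda>w. \<Oplus>m\<in>K. w (x j m) \<otimes> y j m) \<in> add_hom E A"
      using j by (intro add_hom_sum h.S.is_abelian_group add_hom_comp[OF End_apply_hom mult_add_homs(1)])
        simp_all
    have "\<delta> (i, j) \<in> add_hom E B"
      unfolding \<delta>_def fst_conv snd_conv by (rule add_hom_comp[OF S_hom \<epsilon>D(1)[OF i]])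
    moreover have "\<delta> (i, j) (lam (h b) \<otimes>\<^bsub>E\<^esub> w) = b \<otimes>\<^bsub>B\<^esub> \<delta> (i, j) w"
      if b: "b \<in> carrier B" and w: "w \<in> carrier E" for b w
    proof -
      have "(\<Oplus>m\<in>K. (lam (h b) \<otimes>\<^bsub>E\<^esub> w) (x j m) \<otimes> y j m)
          = (\<Oplus>m\<in>K. h b \<otimes> (w (x j m) \<otimes> y j m))"
        using b w j by (intro h.S.finsum_cong' refl) (auto simp: End_mult_apply h.S.m_assoc)
      also have "\<dots> = h b \<otimes> (\<Oplus>m\<in>K. w (x j m) \<otimes> y j m)"
        using b w j by (intro h.S.finsum_rdistr[symmetric] K) auto
      finally show ?thesis using b w i j by (simp add: \<delta>_def \<epsilon>D(3))
    qed
    moreover have "\<delta> (i, j) (w \<otimes>\<^bsub>E\<^esub> lam (h b)) = \<delta> (i, j) w \<otimes>\<^bsub>B\<^esub> b"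
      if b: "b \<in> carrier B" and w: "w \<in> carrier E" for b w
    proof -
      \<comment> \<open>Balanced since \<open>w\<close> is right \<open>B\<close>-linear. The
        Casimir property then lets \<open>h b\<close> pass from the argument of \<open>w\<close> to
        the right of \<open>y j m\<close>, and right linearity of \<open>\<epsilon> i\<close> takes
        it out.\<close>
      have "balanced B (ring_bimod h A h) (ring_bimod h A h) A (\<lambda>p q. w p \<otimes> q)"
        unfolding balanced_def ring_bimod_simps add_hom_ring_bimod
        using w by (intro conjI ballI add_homI)
          (simp_all add: h.S.r_distr h.S.l_distr End_ringD(4,5) h.S.m_assoc)
      from casimir_balanced[OF h.ring_hom_ring_axioms cas[OF j] h.S.is_abelian_group this, of "h b"] b
      have cb: "(\<Oplus>m\<in>K. w (h b \<otimes> x j m) \<otimes> y j m) = (\<Oplus>m\<in>K. w (x j m) \<otimes> (y j m \<otimes> h b))"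
        by simp
      have "(\<Oplus>m\<in>K. (w \<otimes>\<^bsub>E\<^esub> lam (h b)) (x j m) \<otimes> y j m)
          = (\<Oplus>m\<in>K. w (h b \<otimes> x j m) \<otimes> y j m)"
        using b w j by (intro h.S.finsum_cong' refl) (auto simp: End_mult_apply)
      also note cb
      also have "(\<Oplus>m\<in>K. w (x j m) \<otimes> (y j m \<otimes> h b))
          = (\<Oplus>m\<in>K. w (x j m) \<otimes> y j m \<otimes> h b)"
        using b w j by (intro h.S.finsum_cong' refl) (auto simp: h.S.m_assoc)
      also have "\<dots> = (\<Oplus>m\<in>K. w (x j m) \<otimes> y j m) \<otimes> h b"
        using b w j by (intro h.S.finsum_ldistr[symmetric] K) auto
      finally show ?thesis using b w i j by (simp add: \<delta>_def \<epsilon>D(4))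
    qed
    ultimately show ?thesis by (simp add: bilinear_forms_iff)
  qed
  have total: "(\<Oplus>\<^bsub>E\<^esub>p\<in>J \<times> J. \<Oplus>\<^bsub>E\<^esub>q\<in>L \<times> K. u p q \<otimes>\<^bsub>E\<^esub> (lam \<circ> h) (\<delta> p (v p q \<otimes>\<^bsub>E\<^esub> w))) = w"
    if w: "w \<in> carrier E" for w
  proof (rule End_ring_eqI[OF _ w])
    let ?t = "\<lambda>p q. u p q \<otimes>\<^bsub>E\<^esub> (lam \<circ> h) (\<delta> p (v p q \<otimes>\<^bsub>E\<^esub> w))"
    have vw: "v (i, j) (l, m) \<otimes>\<^bsub>E\<^esub> w \<in> carrier E" if "i \<in> J" "j \<in> J" "l \<in> L" "m \<in> K" for i j l m
      using v[OF that] w by simp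
    have \<delta>B [simp]: "\<delta> (i, j) (v (i, j) (l, m) \<otimes>\<^bsub>E\<^esub> w) \<in> carrier B"
      if "i \<in> J" "j \<in> J" "l \<in> L" "m \<in> K" for i j l m
      using bilinear_formsD(2)[OF \<delta>[OF that(1,2)] vw[OF that]] .
    have tE: "?t p q \<in> carrier E" if "p \<in> J \<times> J" "q \<in> L \<times> K" for p q
      using that u by (auto simp del: fst_conv snd_conv)
    have tE': "(\<Oplus>\<^bsub>E\<^esub>q\<in>L \<times> K. ?t p q) \<in> carrier E" if "p \<in> J \<times> J" for p
      using tE that by (intro lam.S.finsum_closed) auto
    show "(\<Oplus>\<^bsub>E\<^esub>p\<in>J \<times> J. \<Oplus>\<^bsub>E\<^esub>q\<in>L \<times> K. ?t p q) \<in> carrier E"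
      using tE' by (intro lam.S.finsum_closed) auto
    fix z assume z: "z \<in> carrier A"
    \<comment> \<open>The map \<open>w \<mapsto> \<Sum>p. w(x_jp) y_jp\<close> applied to the
      composite of \<open>w\<close>, \<open>f l\<close> and \<open>h\<close>. After composing with
      \<open>v\<close> a factor \<open>y i m\<close> stands in front, so the form
      \<open>\<delta>\<close> becomes \<open>\<epsilon> i\<close> at
      \<open>y i m \<otimes> W j l\<close>.\<close>
    define W where "W j l = (\<Oplus>p\<in>K. h (f l (w (x j p))) \<otimes> y j p)" for j l
    have W [simp]: "W j l \<in> carrier A" if "j \<in> J" "l \<in> L" for j l
      unfolding W_def using that w by (intro h.S.finsum_closed) auto
    have \<delta>_eq: "\<delta> (i, j) (v (i, j) (l, m) \<otimes>\<^bsub>E\<^esub> w) = \<epsilon> i (y i m \<otimes> W j l)"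
      if "i \<in> J" "j \<in> J" "l \<in> L" "m \<in> K" for i j l m
    proof -
      have "(\<Oplus>p\<in>K. (v (i, j) (l, m) \<otimes>\<^bsub>E\<^esub> w) (x j p) \<otimes> y j p)
          = (\<Oplus>p\<in>K. y i m \<otimes> (h (f l (w (x j p))) \<otimes> y j p))"
        using that w by (intro h.S.finsum_cong' refl) (auto simp: End_mult_apply v_eq h.S.m_assoc)
      also have "\<dots> = y i m \<otimes> W j l"
        unfolding W_def using that w by (intro h.S.finsum_rdistr[symmetric] K) auto
      finally show ?thesis by (simp add: \<delta>_def)
    qed
    let ?s = "\<lambda>i j l m. r l \<otimes> h (\<epsilon> j (x i m \<otimes> h (\<epsilon> i (y i m \<otimes> W j l)) \<otimes> z))"
    have s_closed [simp]: "?s i j l m \<in> carrier A" if "i \<in> J" "j \<in> J" "l \<in> L" "m \<in> K" for i j l m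
      using that z by simp
    have "(\<Oplus>\<^bsub>E\<^esub>p\<in>J \<times> J. \<Oplus>\<^bsub>E\<^esub>q\<in>L \<times> K. ?t p q) z = (\<Oplus>p\<in>J \<times> J. (\<Oplus>\<^bsub>E\<^esub>q\<in>L \<times> K. ?t p q) z)"
      by (rule End_finsum_apply[OF z tE'])
    also have "\<dots> = (\<Oplus>p\<in>J \<times> J. \<Oplus>l\<in>L. \<Oplus>m\<in>K. ?s (fst p) (snd p) l m)"
    proof (rule h.S.finsum_cong'[OF refl])
      show "(\<lambda>p. \<Oplus>l\<in>L. \<Oplus>m\<in>K. ?s (fst p) (snd p) l m) \<in> J \<times> J \<rightarrow> carrier A"
        by (auto intro!: h.S.finsum_closed simp: z)
      fix p assume p: "p \<in> J \<times> J"
      then obtain i j where ij: "p = (i, j)" "i \<in> J" "j \<in> J" by blast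
      have "(\<Oplus>\<^bsub>E\<^esub>q\<in>L \<times> K. ?t p q) z = (\<Oplus>q\<in>L \<times> K. ?t p q z)"
        by (rule End_finsum_apply[OF z tE[OF p]])
      also have "\<dots> = (\<Oplus>q\<in>L \<times> K. ?s i j (fst q) (snd q))"
        using z ij(2,3) \<delta>B by (intro h.S.finsum_cong' refl)
          (auto simp: ij(1) End_mult_apply u_eq \<delta>_eq h.S.m_assoc)
      also have "\<dots> = (\<Oplus>l\<in>L. \<Oplus>m\<in>K. ?s i j l m)"
        using ij by (intro h.S.finsum_Times L K) (rule s_closed)
      finally show "(\<Oplus>\<^bsub>E\<^esub>q\<in>L \<times> K. ?t p q) z = (\<Oplus>l\<in>L. \<Oplus>m\<in>K. ?s (fst p) (snd p) l m)"
        using ij(1) by simp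
    qed
    also have "\<dots> = (\<Oplus>i\<in>J. \<Oplus>j\<in>J. \<Oplus>l\<in>L. \<Oplus>m\<in>K. ?s i j l m)"
      by (intro h.S.finsum_Times J h.S.finsum_closed funcsetI s_closed)
    \<comment> \<open>The index \<open>i\<close> goes inside so that the sum over \<open>i\<close>
      and \<open>m\<close> is the first to collapse.\<close>
    also have "\<dots> = (\<Oplus>j\<in>J. \<Oplus>i\<in>J. \<Oplus>l\<in>L. \<Oplus>m\<in>K. ?s i j l m)"
      by (intro h.S.finsum_swap h.S.finsum_closed funcsetI s_closed)
    also have "\<dots> = (\<Oplus>j\<in>J. \<Oplus>p\<in>K. w (x j p) \<otimes> h (\<epsilon> j (y j p \<otimes> z)))"
    proof (rule h.S.finsum_cong'[OF refl])
      show "(\<lambda>j. \<Oplus>p\<in>K. w (x j p) \<otimes> h (\<epsilon> j (y j p \<otimes> z))) \<in> J \<rightarrow> carrier A"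
        using w z by (auto intro!: h.S.finsum_closed)
      fix j assume j: "j \<in> J"
      have "(\<Oplus>i\<in>J. \<Oplus>l\<in>L. \<Oplus>m\<in>K. ?s i j l m) = (\<Oplus>l\<in>L. \<Oplus>i\<in>J. \<Oplus>m\<in>K. ?s i j l m)"
        using j by (intro h.S.finsum_swap h.S.finsum_closed funcsetI s_closed)
      also have "\<dots> = (\<Oplus>l\<in>L. \<Oplus>p\<in>K. r l \<otimes> h (f l (w (x j p))) \<otimes> h (\<epsilon> j (y j p \<otimes> z)))"
      proof (rule h.S.finsum_cong'[OF refl])
        show "(\<lambda>l. \<Oplus>p\<in>K. r l \<otimes> h (f l (w (x j p))) \<otimes> h (\<epsilon> j (y j p \<otimes> z))) \<in> L \<rightarrow> carrier A"
          using w z j by (auto intro!: h.S.finsum_closed)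
        fix l assume l: "l \<in> L"
        let ?\<Phi> = "\<lambda>a. r l \<otimes> h (\<epsilon> j (a \<otimes> z))"
        note ps = \<Phi>_sum[OF l j z]
        let ?g = "\<lambda>i m. x i m \<otimes> h (\<epsilon> i (y i m \<otimes> W j l))"
        have g: "?g i m \<in> carrier A" if "i \<in> J" "m \<in> K" for i m using that l j by simp
        have "(\<Oplus>i\<in>J. \<Oplus>m\<in>K. ?\<Phi> (?g i m)) = (\<Oplus>i\<in>J. ?\<Phi> (\<Oplus>m\<in>K. ?g i m))"
        proof (rule h.S.finsum_cong'[OF refl])
          show "(\<lambda>i. ?\<Phi> (\<Oplus>m\<in>K. ?g i m)) \<in> J \<rightarrow> carrier A"
            by (intro funcsetI add_hom_closed[OF \<Phi>[OF l j z]] h.S.finsum_closed g)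
          fix i assume i: "i \<in> J"
          show "(\<Oplus>m\<in>K. ?\<Phi> (?g i m)) = ?\<Phi> (\<Oplus>m\<in>K. ?g i m)"
            by (rule ps[symmetric]) (rule g[OF i])
        qed
        also have "\<dots> = ?\<Phi> (\<Oplus>i\<in>J. \<Oplus>m\<in>K. ?g i m)"
          by (rule ps[symmetric]) (intro h.S.finsum_closed funcsetI g)
        \<comment> \<open>First use of the reproducing formula, at the element \<open>W j l\<close>.
          The sum over \<open>l\<close> will collapse next, by the dual basis identity at
          \<open>w (x j p)\<close>.\<close>
        also have "\<dots> = ?\<Phi> (\<Oplus>p\<in>K. h (f l (w (x j p))) \<otimes> y j p)"
          using sum[OF W[OF j l]] by (simp only: W_def)
        also have "\<dots> = (\<Oplus>p\<in>K. ?\<Phi> (h (f l (w (x j p))) \<otimes> y j p))"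
          using w j l by (intro ps) simp
        also have "\<dots> = (\<Oplus>p\<in>K. r l \<otimes> h (f l (w (x j p))) \<otimes> h (\<epsilon> j (y j p \<otimes> z)))"
          using w j l z by (intro h.S.finsum_cong' refl) (auto simp: h.S.m_assoc \<epsilon>D(3))
        finally show "(\<Oplus>i\<in>J. \<Oplus>m\<in>K. ?s i j l m) = \<dots>" .
      qed
      also have "\<dots> = (\<Oplus>p\<in>K. \<Oplus>l\<in>L. r l \<otimes> h (f l (w (x j p))) \<otimes> h (\<epsilon> j (y j p \<otimes> z)))"
        using w z j by (intro h.S.finsum_swap) simp
      also have "\<dots> = (\<Oplus>p\<in>K. w (x j p) \<otimes> h (\<epsilon> j (y j p \<otimes> z)))"
      proof (rule h.S.finsum_cong'[OF refl])
        show "(\<lambda>p. w (x j p) \<otimes> h (\<epsilon> j (y j p \<otimes> z))) \<in> K \<rightarrow> carrier A" using w z j by simp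
        fix p assume p: "p \<in> K"
        have wx: "w (x j p) \<in> carrier A" using w j p by simp
        have "(\<Oplus>l\<in>L. r l \<otimes> h (f l (w (x j p))) \<otimes> h (\<epsilon> j (y j p \<otimes> z)))
            = (\<Oplus>l\<in>L. r l \<otimes> h (f l (w (x j p)))) \<otimes> h (\<epsilon> j (y j p \<otimes> z))"
          using w z j p by (intro h.S.finsum_ldistr[symmetric] L) auto
        then show "(\<Oplus>l\<in>L. r l \<otimes> h (f l (w (x j p))) \<otimes> h (\<epsilon> j (y j p \<otimes> z)))
            = w (x j p) \<otimes> h (\<epsilon> j (y j p \<otimes> z))"
          by (simp only: f_sum[OF wx])
      qed
      finally show "(\<Oplus>i\<in>J. \<Oplus>l\<in>L. \<Oplus>m\<in>K. ?s i j l m) = \<dots>" .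
    qed
    \<comment> \<open>\<open>w\<close> is additive and right \<open>B\<close>-linear, hence can be
      pulled out of the sums; a second use of the reproducing formula, at \<open>z\<close>, then
      leaves \<open>w z\<close>.\<close>
    also have "\<dots> = (\<Oplus>j\<in>J. w (\<Oplus>p\<in>K. x j p \<otimes> h (\<epsilon> j (y j p \<otimes> z))))"
    proof (rule h.S.finsum_cong'[OF refl])
      show "(\<lambda>j. w (\<Oplus>p\<in>K. x j p \<otimes> h (\<epsilon> j (y j p \<otimes> z)))) \<in> J \<rightarrow> carrier A"
        using z by (intro funcsetI add_hom_closed[OF End_ringD(1)[OF w]] h.S.finsum_closed) simp_all
      fix j assume j: "j \<in> J"
      have "w (\<Oplus>p\<in>K. x j p \<otimes> h (\<epsilon> j (y j p \<otimes> z))) = (\<Oplus>p\<in>K. w (x j p \<otimes> h (\<epsilon> j (y j p \<otimes> z))))"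
        using j z by (intro add_hom_finsum[OF h.S.is_abelian_group h.S.is_abelian_group End_ringD(1)[OF w]]) simp
      also have "\<dots> = (\<Oplus>p\<in>K. w (x j p) \<otimes> h (\<epsilon> j (y j p \<otimes> z)))"
        using j z w by (intro h.S.finsum_cong' refl) (auto simp: End_ringD(4))
      finally show "(\<Oplus>p\<in>K. w (x j p) \<otimes> h (\<epsilon> j (y j p \<otimes> z)))
        = w (\<Oplus>p\<in>K. x j p \<otimes> h (\<epsilon> j (y j p \<otimes> z)))" by simp
    qed
    also have "\<dots> = w (\<Oplus>j\<in>J. \<Oplus>p\<in>K. x j p \<otimes> h (\<epsilon> j (y j p \<otimes> z)))"
      using z by (intro add_hom_finsum[symmetric, OF h.S.is_abelian_group h.S.is_abelian_group
            End_ringD(1)[OF w]] h.S.finsum_closed) simp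
    also have "\<dots> = w z" by (simp only: sum[OF z])
    finally show "(\<Oplus>\<^bsub>E\<^esub>p\<in>J \<times> J. \<Oplus>\<^bsub>E\<^esub>q\<in>L \<times> K. ?t p q) z = w z" .
  qed
  show ?thesis
    unfolding left_system_def
    by (intro conjI ballI finite_cartesian_product J K L total)
       (auto simp: casimir \<delta>)
qed

end

section \<open>The equivalence\<close>

theorem mainTheorem6:
  fixes B :: "('b, 'd) ring_scheme" and A :: "('a, 'c) ring_scheme" and h :: "'b \<Rightarrow> 'a"
  assumes "ring_hom_ring B A h"
    and "separable_extension B A h"
    and "QF_extension B A h"
  shows "D3_extension B A h \<longleftrightarrow> D2 B (End_ring B A h) (left_mult A \<circ> h)"
proof -
  interpret X: extension B A h using assms(1) by (rule extension.intro)
  interpret W: tower B A "End_ring B A h" h "left_mult A"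
    by (intro tower.intro assms(1) X.lam_ring_hom)
  interpret Y: extension B "End_ring B A h" "left_mult A \<circ> h"
    by (intro extension.intro W.hk.ring_hom_ring_axioms)
  have QF: "left_QF B A h" "right_QF B A h" using assms(3) by (simp_all add: QF_extension_def)
  show ?thesis
    unfolding D3_extension_def D2_def
  proof (intro iffI conjI)
    assume "right_D3_tower B A (End_ring B A h) h (left_mult A)"
    \<comment> \<open>The right half of the quasi-Frobenius condition supplies the right system for
      this step; the left depth two below starts from its result.\<close>
    then show D2: "right_D2 B (End_ring B A h) (left_mult A \<circ> h)"
      using X.right_QF_imp_right_system[OF QF(2)] X.End_right_D3_imp_right_D2 by metis
    obtain J :: "nat set" and K :: "'a set" and x y \<epsilon> where sys: "left_system B A h J K x y \<epsilon>"
      using X.left_QF_imp_left_system[OF QF(1)] by metis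
    \<comment> \<open>The left system of \<open>E/B\<close> mixes both halves: its forms come from
      left QF, the dual basis of \<open>A\<close> as a right module from right QF.\<close>
    obtain L :: "'a set" and r :: "'a \<Rightarrow> 'a" and f :: "'a \<Rightarrow> 'a \<Rightarrow> 'b" where basis: "finite L"
      "\<And>k. k \<in> L \<Longrightarrow> r k \<in> carrier A" "\<And>k. k \<in> L \<Longrightarrow> f k \<in> add_hom A B"
      "\<And>k a b. \<lbrakk>k \<in> L; a \<in> carrier A; b \<in> carrier B\<rbrakk> \<Longrightarrow> f k (a \<otimes>\<^bsub>A\<^esub> h b) = f k a \<otimes>\<^bsub>B\<^esub> b"
      "\<And>a. a \<in> carrier A \<Longrightarrow> (\<Oplus>\<^bsub>A\<^esub>k\<in>L. r k \<otimes>\<^bsub>A\<^esub> h (f k a)) = a"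
      by (rule X.right_dual_basis) (use QF(2) in \<open>auto simp: right_QF_def\<close>)
    show "left_D2 B (End_ring B A h) (left_mult A \<circ> h)"
      by (rule Y.right_D2_imp_left_D2[OF D2 X.End_left_system[OF sys basis]])
  next
    assume "left_D2 B (End_ring B A h) (left_mult A \<circ> h) \<and> right_D2 B (End_ring B A h) (left_mult A \<circ> h)"
    \<comment> \<open>In the tower \<open>B \<rightarrow> A \<rightarrow> E\<close> the lower
      extension, along which averaging takes place, is \<open>A/B\<close>.\<close>
    then show "right_D3_tower B A (End_ring B A h) h (left_mult A)"
      using W.separable_right_D2_imp_right_D3[OF assms(2)] by blast
  qed
qed

end
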